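(* Let $G$ be a $K_{2,3}$-minor-free graph and let $\ell$ be an integer with $\ell\geq 5$. For every pair of $\ell$-colorings $\alpha$ and $\beta$ of $G$, there exists a transformation from $\alpha$ to $\beta$ (through $\ell$-colorings of $G$) in which each vertex of $G$ is recolored at most $t$ times, where: (1) $t=3$ if $\ell\geq 6$; (2) $t=1387$ if $\ell=5$.
   Context: All graphs are finite and simple. An $\ell$-coloring of a graph $G$ is a proper coloring, i.e. a map $c:V(G)\to\{1,2,\ldots,\ell\}$ such that adjacent vertices receive different colors. The $\ell$-reconfiguration graph $\mathcal{R}_\ell(G)$ has as vertices the $\ell$-colorings of $G$, two colorings being adjacent if they differ in color on exactly one vertex of $G$. A transformation from $\alpha$ to $\beta$ is a path from $\alpha$ to $\beta$ in $\mathcal{R}_\ell(G)$; each edge of the path recolors exactly one vertex of $G$, and the number of times a vertex $v$ is recolored is the number of edges of the path along which the color of $v$ changes. A graph is $K_{2,3}$-minor-free if it does not contain the complete bipartite graph $K_{2,3}$ as a minor. *)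

theory Defs
  imports "Graph_Theory.Kuratowski"
begin

text \<open>
  A finite simple graph is a \<^locale>\<open>pair_graph\<close>: every edge is represented by its two
  orientations.
\<close>

text \<open>
  Minors are given by branch sets: pairwise disjoint, connected vertex sets of \<open>G\<close>, one for each
  vertex of \<open>H\<close>, such that every edge of \<open>H\<close> is realised by an edge of \<open>G\<close> between the
  corresponding sets.  Branch sets are nonempty because
  \<^const>\<open>Digraph_Component.connected\<close> excludes the null graph.
\<close>

definition minor_of :: "'b pair_pre_digraph \<Rightarrow> 'a pair_pre_digraph \<Rightarrow> bool" where
  "minor_of H G \<longleftrightarrow> (\<exists>B.
     (\<forall>x\<in>pverts H. B x \<subseteq> pverts G \<and> Digraph_Component.connected (with_proj G \<restriction> B x)) \<and>
     (\<forall>x\<in>pverts H. \<forall>y\<in>pverts H. x \<noteq> y \<longrightarrow> B x \<inter> B y = {}) \<and>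
     (\<forall>(x, y)\<in>parcs H. \<exists>u\<in>B x. \<exists>v\<in>B y. (u, v) \<in> parcs G))"

text \<open>
  The library's \<open>K\<^bsub>m,n\<^esub>\<close> is a predicate, so we quantify over the copies of \<open>K\<^bsub>2,3\<^esub>\<close>;
  the vertex type \<^typ>\<open>nat\<close> has room for one, and minors are invariant under isomorphism.
\<close>

definition K23_minor_free :: "'a pair_pre_digraph \<Rightarrow> bool" where
  "K23_minor_free G \<longleftrightarrow>
     \<not> (\<exists>H :: nat pair_pre_digraph. K\<^bsub>2,3\<^esub> (with_proj H) \<and> minor_of H G)"

text \<open>
  Colorings are extensional functions, so that two of them are equal iff they agree on all
  vertices of \<open>G\<close>.
\<close>

definition colorings :: "'a pair_pre_digraph \<Rightarrow> nat \<Rightarrow> ('a \<Rightarrow> nat) set" where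
  "colorings G l = {c \<in> pverts G \<rightarrow>\<^sub>E {1..l}. \<forall>(u, v)\<in>parcs G. c u \<noteq> c v}"

definition reconf_graph :: "'a pair_pre_digraph \<Rightarrow> nat \<Rightarrow> ('a \<Rightarrow> nat) pair_pre_digraph" where
  "reconf_graph G l =
     \<lparr> pverts = colorings G l,
       parcs = {(c, d). c \<in> colorings G l \<and> d \<in> colorings G l \<and>
                        (\<exists>!v. v \<in> pverts G \<and> c v \<noteq> d v)} \<rparr>"

lemma pair_graph_reconf_graph:
  assumes "pair_graph G"
  shows "pair_graph (reconf_graph G l)"
proof -
  interpret pair_graph G by fact
  have "finite (pverts G \<rightarrow>\<^sub>E {1..l})"
    by (intro finite_PiE pair_finite_verts) simp
  then have fin: "finite (colorings G l)"
    unfolding colorings_def by (rule rev_finite_subset) auto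
  have sub: "parcs (reconf_graph G l) \<subseteq> colorings G l \<times> colorings G l"
    by (auto simp: reconf_graph_def)
  have "finite (parcs (reconf_graph G l))"
    using sub fin by (meson finite_SigmaI finite_subset)
  moreover have "sym (parcs (reconf_graph G l))"
    unfolding reconf_graph_def sym_def by (simp add: eq_commute)
  ultimately show ?thesis
    using fin sub by unfold_locales (auto simp: symmetric_def reconf_graph_def)
qed

text \<open>A path in the reconfiguration graph is represented by the list of its edges.\<close>

definition transformation ::
    "'a pair_pre_digraph \<Rightarrow> nat \<Rightarrow> ('a \<Rightarrow> nat) \<Rightarrow> (('a \<Rightarrow> nat) \<times> ('a \<Rightarrow> nat)) list \<Rightarrow> ('a \<Rightarrow> nat) \<Rightarrow> bool" where
  "transformation G l \<alpha> p \<beta> \<longleftrightarrow> pre_digraph.apath (with_proj (reconf_graph G l)) \<alpha> p \<beta>"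

definition recolorings :: "(('a \<Rightarrow> nat) \<times> ('a \<Rightarrow> nat)) list \<Rightarrow> 'a \<Rightarrow> nat" where
  "recolorings p v = length (filter (\<lambda>(c, d). c v \<noteq> d v) p)"

end

theory Submission
  imports Defs
begin

text \<open>
  A graph without a $K_{2,3}$ minor has a vertex of degree at most 2, or a $K_4$ three of whose vertices
  have no further neighbours; a transformation of the rest of the graph is extended to these vertices.
  With six colors, a vertex of degree 2 has to move only once per three moves of its neighbours, so
  three moves per vertex suffice.

  With five colors, both colorings are first transformed into colorings that avoid color 5, with two
  moves per vertex.  Here the moves of the two ends of an edge are always interleaved in one of
  finitely many ways, which can be extended to any common neighbour of the ends.  Between colorings
  with the colors 1 to 4, one first gives color 5 to an independent set \<open>I\<close> whose removal leaves a
  graph that is built by attaching leaves and triangles; this graph needs three moves per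
  vertex with four colors.  Altogether seven moves per vertex suffice.
\<close>

section \<open>Sequences of recolorings\<close>

text \<open>The counts decide the shape of the proof. A vertex with n scheduled neighbours and l
  colors can evade l-n-1 of their moves with one move of its own, and needs one further move to
  reach its target. If every neighbour moves at most b times, this costs the ceiling of nb/(l-n-1),
  plus one. For n = 2, l = 6, b = 3 the result is 3 again, so the bound survives the induction. It
  also does for n = 1, l = 4, b = 3, which is why the four-color part sets an independent set aside:
  a vertex of degree 2 is then left with at most one scheduled neighbour or is itself set aside. For
  n = 2, l = 5 the result is b + 1, and the bound grows with every step. Counting moves is therefore
  not enough with five colors; what has to stay bounded is the set of interleavings along edges. To
  leave room for this, the part that handles five colors prescribes no target, only that color 5 is
  gone at the end. It is applied to both given colorings, and run backwards for the second
  one.\<close>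

text \<open>
  A transformation is a list of moves \<open>(x, k)\<close>, giving color \<open>k\<close> to \<open>x\<close>.  Whether an edge is properly
  colored throughout depends only on the moves of its two ends, so a list of moves is built edge by
  edge: two lists that agree on common vertices can be amalgamated.
\<close>

definition recolor :: "('a \<times> 'c) list \<Rightarrow> ('a \<Rightarrow> 'c) \<Rightarrow> 'a \<Rightarrow> 'c" where
  "recolor ms c = fold (\<lambda>m c. c(fst m := snd m)) ms c"

fun apart :: "'a \<Rightarrow> 'a \<Rightarrow> ('a \<Rightarrow> 'c) \<Rightarrow> ('a \<times> 'c) list \<Rightarrow> bool" where
  "apart x y c [] \<longleftrightarrow> c x \<noteq> c y"
| "apart x y c (m # ms) \<longleftrightarrow> c x \<noteq> c y \<and> apart x y (c(fst m := snd m)) ms"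

definition moves_of :: "'a set \<Rightarrow> ('a \<times> 'c) list \<Rightarrow> ('a \<times> 'c) list" where
  "moves_of X ms = filter (\<lambda>m. fst m \<in> X) ms"

definition num_moves :: "('a \<times> 'c) list \<Rightarrow> 'a \<Rightarrow> nat" where
  "num_moves ms x = length (moves_of {x} ms)"

lemma recolor_simps [simp]:
  "recolor [] c = c"
  "recolor (m # ms) c = recolor ms (c(fst m := snd m))"
  "recolor (ms @ ns) c = recolor ns (recolor ms c)"
  by (simp_all add: recolor_def)

lemma moves_of_simps [simp]:
  "moves_of X [] = []"
  "moves_of X (m # ms) = (if fst m \<in> X then m # moves_of X ms else moves_of X ms)"
  "moves_of X (ms @ ns) = moves_of X ms @ moves_of X ns"
  "moves_of X (moves_of Y ms) = moves_of (X \<inter> Y) ms"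
  "fst ` set (moves_of X ms) \<subseteq> X"
  "set (moves_of X ms) = {m \<in> set ms. fst m \<in> X}"
  by (auto simp: moves_of_def conj_commute intro: filter_cong)

lemma num_moves_simps [simp]:
  "num_moves [] x = 0"
  "num_moves (m # ms) x = (if fst m = x then Suc (num_moves ms x) else num_moves ms x)"
  "num_moves (ms @ ns) x = num_moves ms x + num_moves ns x"
  "num_moves (moves_of X ms) x = (if x \<in> X then num_moves ms x else 0)"
  by (auto simp: num_moves_def moves_of_def Int_insert_left simp flip: moves_of_def)
    (simp add: moves_of_def)

lemma moves_of_all: "fst ` set ms \<subseteq> X \<Longrightarrow> moves_of X ms = ms"
  by (auto simp: moves_of_def intro: filter_True)

lemma moves_of_none: "fst ` set ms \<inter> X = {} \<Longrightarrow> moves_of X ms = []"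
  by (auto simp: moves_of_def filter_empty_conv)

lemma num_moves_eq_0: "x \<notin> fst ` set ms \<Longrightarrow> num_moves ms x = 0"
  by (auto simp: num_moves_def intro: moves_of_none)

lemma num_moves_le_length: "num_moves ms x \<le> length ms"
  by (simp add: num_moves_def moves_of_def)

lemma recolor_notin: "x \<notin> fst ` set ms \<Longrightarrow> recolor ms c x = c x"
  by (induction ms arbitrary: c) auto

lemma recolor_cong: "c x = d x \<Longrightarrow> recolor ms c x = recolor ms d x"
proof (induction ms arbitrary: c d)
  case (Cons m ms)
  have "recolor ms (c(fst m := snd m)) x = recolor ms (d(fst m := snd m)) x"
    by (rule Cons.IH) (use Cons.prems in auto)
  then show ?case by simp
qed simp

lemma recolor_moves_of: "x \<in> X \<Longrightarrow> recolor (moves_of X ms) c x = recolor ms c x"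
proof (induction ms arbitrary: c)
  case (Cons m ms)
  have "recolor ms (c(fst m := snd m)) x = recolor ms c x" if "fst m \<notin> X"
    by (rule recolor_cong) (use that Cons.prems in auto)
  with Cons show ?case by simp
qed simp

lemma recolor_in: "recolor ms c x = c x \<or> (x, recolor ms c x) \<in> set ms"
proof (induction ms arbitrary: c)
  case (Cons m ms)
  define d where "d = c(fst m := snd m)"
  have "d x = c x \<or> m = (x, d x)" by (cases m) (auto simp: d_def)
  with Cons.IH[of d] show ?case by (auto simp flip: d_def)
qed simp

lemma apart_start: "apart x y c ms \<Longrightarrow> c x \<noteq> c y"
  by (cases ms) auto

lemma apart_end: "apart x y c ms \<Longrightarrow> recolor ms c x \<noteq> recolor ms c y"
  by (induction ms arbitrary: c) auto

lemma apart_append: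
  "apart x y c (ms @ ns) \<longleftrightarrow> apart x y c ms \<and> apart x y (recolor ms c) ns"
  by (induction ms arbitrary: c) (auto dest: apart_start)

lemma apart_sym: "apart x y c ms \<longleftrightarrow> apart y x c ms"
  by (induction ms arbitrary: c) auto

lemma apart_cong: "c x = d x \<Longrightarrow> c y = d y \<Longrightarrow> apart x y c ms \<longleftrightarrow> apart x y d ms"
proof (induction ms arbitrary: c d)
  case (Cons m ms)
  have "apart x y (c(fst m := snd m)) ms \<longleftrightarrow> apart x y (d(fst m := snd m)) ms"
    by (rule Cons.IH) (use Cons.prems in auto)
  with Cons.prems show ?case by simp
qed simp

lemma apart_moves_of:
  assumes "x \<in> X" "y \<in> X"
  shows "apart x y c (moves_of X ms) \<longleftrightarrow> apart x y c ms"
proof (induction ms arbitrary: c)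
  case (Cons m ms)
  show ?case
  proof (cases "fst m \<in> X")
    case False
    with assms have "x \<noteq> fst m" "y \<noteq> fst m" by auto
    then have "apart x y (c(fst m := snd m)) ms \<longleftrightarrow> apart x y c ms"
      by (intro apart_cong) auto
    then show ?thesis using False Cons.IH[of c] by (auto dest: apart_start)
  next
    case True
    with Cons.IH[of "c(fst m := snd m)"] show ?thesis by (simp del: fun_upd_apply)
  qed
qed simp

lemma apart_notin: "x \<notin> fst ` set ms \<Longrightarrow> y \<notin> fst ` set ms \<Longrightarrow> apart x y c ms \<longleftrightarrow> c x \<noteq> c y"
  using apart_moves_of[of x "{x, y}" y c ms] by (simp add: moves_of_none)

lemma apart_const:
  assumes "x \<notin> fst ` set ms" "c y \<noteq> c x" "\<And>k. (y, k) \<in> set ms \<Longrightarrow> k \<noteq> c x"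
  shows "apart x y c ms"
  using assms
proof (induction ms arbitrary: c)
  case (Cons m ms)
  have "apart x y (c(fst m := snd m)) ms"
    by (rule Cons.IH) (use Cons.prems in \<open>cases m; auto\<close>)+
  with Cons.prems show ?case by auto
qed auto

text \<open>Carries schedules over from hues to the vertices and colors of a graph. Injectivity is
  asked only on the vertices and colors that occur, because the maps used later are inverses on a
  single clique.\<close>

lemma apart_map:
  assumes "inj_on f X" "inj_on s K" "x \<in> X" "y \<in> X" "fst ` set ms \<subseteq> X" "snd ` set ms \<subseteq> K"
    and "c x \<in> K" "c y \<in> K" "d (f x) = s (c x)" "d (f y) = s (c y)"
  shows "apart (f x) (f y) d (map (map_prod f s) ms) \<longleftrightarrow> apart x y c ms"
  using assms(5-)
proof (induction ms arbitrary: c d)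
  case Nil
  then show ?case using assms(2) by (auto dest: inj_onD)
next
  case (Cons m ms)
  have "f (fst m) = f x \<longleftrightarrow> fst m = x" "f (fst m) = f y \<longleftrightarrow> fst m = y"
    using Cons.prems assms(1,3,4) by (auto dest: inj_onD)
  then have "apart (f x) (f y) (d(f (fst m) := s (snd m))) (map (map_prod f s) ms)
      \<longleftrightarrow> apart x y (c(fst m := snd m)) ms"
    by (intro Cons.IH) (use Cons.prems in auto)
  moreover have "d (f x) = d (f y) \<longleftrightarrow> c x = c y"
    using Cons.prems assms(2) by (auto dest: inj_onD)
  ultimately show ?case by simp
qed

lemma recolor_map:
  assumes "inj_on f X" "x \<in> X" "fst ` set ms \<subseteq> X" "d (f x) = s (c x)"
  shows "recolor (map (map_prod f s) ms) d (f x) = s (recolor ms c x)"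
  using assms(3,4)
proof (induction ms arbitrary: c d)
  case (Cons m ms)
  have "f (fst m) = f x \<longleftrightarrow> fst m = x"
    using Cons.prems assms(1,2) by (auto dest: inj_onD)
  then show ?case
    by (simp, intro Cons.IH) (use Cons.prems in auto)
qed simp

lemma moves_of_map:
  assumes "inj_on f X" "fst ` set ms \<subseteq> X" "Y \<subseteq> X"
  shows "moves_of (f ` Y) (map (map_prod f s) ms) = map (map_prod f s) (moves_of Y ms)"
  using assms(2)
proof (induction ms)
  case (Cons m ms)
  have "f (fst m) \<in> f ` Y \<longleftrightarrow> fst m \<in> Y"
    using Cons.prems assms(1,3) by (auto dest: inj_onD)
  with Cons show ?case by simp
qed simp

lemma num_moves_map:
  assumes "inj_on f X" "fst ` set ms \<subseteq> X" "x \<in> X"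
  shows "num_moves (map (map_prod f s) ms) (f x) = num_moves ms x"
  using moves_of_map[OF assms(1,2), of "{x}" s] assms(3) by (simp add: num_moves_def)

section \<open>Amalgamation and reversal of sequences of moves\<close>

text \<open>A head that moves a vertex outside the other domain can be emitted at once. When neither
  list starts with such a move, both heads move common vertices, so they are equal by the agreement
  of the projections and are emitted together.\<close>

lemma amalgamate:
  assumes "moves_of Y ms = moves_of X ns" "fst ` set ms \<subseteq> X" "fst ` set ns \<subseteq> Y"
  shows "\<exists>zs. moves_of X zs = ms \<and> moves_of Y zs = ns \<and> fst ` set zs \<subseteq> X \<union> Y"
  using assms
proof (induction "length ms + length ns" arbitrary: ms ns rule: less_induct)
  case less
  show ?case
  proof (cases "\<exists>m ms'. ms = m # ms' \<and> fst m \<notin> Y")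
    case True
    then obtain m ms' where ms: "ms = m # ms'" "fst m \<notin> Y" by auto
    with less.prems obtain zs where "moves_of X zs = ms'" "moves_of Y zs = ns" "fst ` set zs \<subseteq> X \<union> Y"
      using less.hyps[of ms' ns] by auto
    with ms less.prems show ?thesis by (intro exI[of _ "m # zs"]) auto
  next
    case nms: False
    show ?thesis
    proof (cases "\<exists>n ns'. ns = n # ns' \<and> fst n \<notin> X")
      case True
      then obtain n ns' where ns: "ns = n # ns'" "fst n \<notin> X" by auto
      with less.prems obtain zs where "moves_of X zs = ms" "moves_of Y zs = ns'" "fst ` set zs \<subseteq> X \<union> Y"
        using less.hyps[of ms ns'] by auto
      with ns less.prems show ?thesis by (intro exI[of _ "n # zs"]) auto
    next
      case nns: False
      show ?thesis
      proof (cases ms)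
        case Nil
        with nns less.prems have "ns = []" by (cases ns) auto
        with Nil show ?thesis by (intro exI[of _ "[]"]) auto
      next
        case (Cons m ms')
        with nms less.prems(1) nns obtain ns' where ns: "ns = m # ns'" "fst m \<in> X" "fst m \<in> Y"
          by (cases ns) (auto split: if_splits)
        with Cons less.prems obtain zs where "moves_of X zs = ms'" "moves_of Y zs = ns'" "fst ` set zs \<subseteq> X \<union> Y"
          using less.hyps[of ms' ns'] by auto
        with ns Cons show ?thesis by (intro exI[of _ "m # zs"]) auto
      qed
    qed
  qed
qed

text \<open>A move records only the new color, so the coloring before each move has to be carried
  along to know what the reversed move restores.\<close>

fun undo :: "('a \<times> 'c) list \<Rightarrow> ('a \<Rightarrow> 'c) \<Rightarrow> ('a \<times> 'c) list" where
  "undo [] c = []"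
| "undo (m # ms) c = undo ms (c(fst m := snd m)) @ [(fst m, c (fst m))]"

lemma recolor_undo [simp]: "recolor (undo ms c) (recolor ms c) = c"
  by (induction ms arbitrary: c) auto

lemma apart_undo: "apart x y (recolor ms c) (undo ms c) \<longleftrightarrow> apart x y c ms"
  by (induction ms arbitrary: c) (auto simp: apart_append dest: apart_start)

lemma num_moves_undo [simp]: "num_moves (undo ms c) x = num_moves ms x"
  by (induction ms arbitrary: c) auto

lemma fst_undo [simp]: "fst ` set (undo ms c) = fst ` set ms"
  by (induction ms arbitrary: c) auto

lemma snd_undo: "snd ` set (undo ms c) \<subseteq> snd ` set ms \<union> c ` fst ` set ms"
proof (induction ms arbitrary: c)
  case (Cons m ms)
  define d where "d = c(fst m := snd m)"
  have "d ` fst ` set ms \<subseteq> insert (snd m) (c ` fst ` set ms)" by (auto simp: d_def)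
  have "snd ` set (undo (m # ms) c) = insert (c (fst m)) (snd ` set (undo ms d))"
    by (simp add: d_def del: fun_upd_apply)
  also have "\<dots> \<subseteq> snd ` set (m # ms) \<union> c ` fst ` set (m # ms)"
    using Cons.IH[of d] \<open>d ` fst ` set ms \<subseteq> _\<close> by (simp del: image_image) blast
  finally show ?case .
qed simp

section \<open>Graphs without a $K_{2,3}$ minor\<close>

definition fgraph :: "'a set \<Rightarrow> ('a \<times> 'a) set \<Rightarrow> bool" where
  "fgraph V R \<longleftrightarrow> finite V \<and> R \<subseteq> V \<times> V \<and> sym R \<and> irrefl R"

definition conn :: "('a \<times> 'a) set \<Rightarrow> 'a set \<Rightarrow> bool" where
  "conn R S \<longleftrightarrow> S \<noteq> {} \<and> (\<forall>x\<in>S. \<forall>y\<in>S. (x, y) \<in> (R \<inter> S \<times> S)\<^sup>*)"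

text \<open>The indices 0 and 1 form the side of size two. A vertex set need not be mentioned: every
  branch set contains an end of an edge and is connected.\<close>

definition K23_model :: "('a \<times> 'a) set \<Rightarrow> (nat \<Rightarrow> 'a set) \<Rightarrow> bool" where
  "K23_model R h \<longleftrightarrow> (\<forall>i<5. conn R (h i)) \<and> (\<forall>i<5. \<forall>j<5. i \<noteq> j \<longrightarrow> h i \<inter> h j = {}) \<and>
     (\<forall>i\<in>{0, 1}. \<forall>j\<in>{2, 3, 4}. \<exists>u\<in>h i. \<exists>v\<in>h j. (u, v) \<in> R)"

definition has_K23 :: "('a \<times> 'a) set \<Rightarrow> bool" where
  "has_K23 R \<longleftrightarrow> (\<exists>h. K23_model R h)"

lemma fgraphD:
  assumes "fgraph V R"
  shows "finite V" "R \<subseteq> V \<times> V" "(x, y) \<in> R \<Longrightarrow> (y, x) \<in> R" "(x, x) \<notin> R"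
    "(x, y) \<in> R \<Longrightarrow> x \<in> V" "(x, y) \<in> R \<Longrightarrow> y \<in> V" "(x, y) \<in> R \<Longrightarrow> x \<noteq> y"
  using assms by (auto simp: fgraph_def sym_def irrefl_def)

lemma fgraph_restrict: "fgraph V R \<Longrightarrow> fgraph (V - X) (R \<inter> (V - X) \<times> (V - X))"
  by (auto simp: fgraph_def sym_def irrefl_def)

lemma conn_singleton: "conn R {x}"
  by (simp add: conn_def)

lemma K23_model_edge:
  assumes "K23_model R h" "i \<in> {0, 1}" "j \<in> {2, 3, 4}"
  shows "\<exists>u\<in>h i. \<exists>v\<in>h j. (u, v) \<in> R"
  by (rule bspec[OF bspec[OF conjunct2[OF conjunct2[OF assms(1)[unfolded K23_model_def]]] assms(2)] assms(3)])

text \<open>A minor of a contraction is a minor. The map \<open>\<phi>\<close> contracts connected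
  fibers and every edge of \<open>R'\<close> lifts to \<open>R\<close>, so preimages of branch sets
  are branch sets.\<close>

lemma has_K23_pullback:
  assumes K23: "has_K23 R'"
    and edge: "\<And>a b. (a, b) \<in> R' \<Longrightarrow> \<exists>x\<in>D. \<exists>y\<in>D. \<phi> x = a \<and> \<phi> y = b \<and> (x, y) \<in> R"
    and fiber: "\<And>a. a \<in> Field R' \<Longrightarrow> conn R {x \<in> D. \<phi> x = a}"
  shows "has_K23 R"
proof -
  from K23 obtain h where h: "K23_model R' h" by (auto simp: has_K23_def)
  define g where "g i = {x \<in> D. \<phi> x \<in> h i}" for i
  have edges: "\<exists>u\<in>g i. \<exists>v\<in>g j. (u, v) \<in> R" if "i \<in> {0, 1}" "j \<in> {2, 3, 4}" for i j
  proof -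
    from K23_model_edge[OF h that] obtain a b where "a \<in> h i" "b \<in> h j" "(a, b) \<in> R'"
      by auto
    with edge[of a b] show ?thesis by (fastforce simp: g_def)
  qed
  have conn: "conn R (g i)" if i: "i < 5" for i
  proof -
    have hc: "conn R' (h i)" using h i by (simp add: K23_model_def)
    \<comment> \<open>Fibers are known to be connected only over ends of edges. A one-element branch
      set meets an edge of the K_{2,3} pattern, a larger one has an inner edge at each of its
      vertices.\<close>
    have field: "a \<in> Field R'" if a: "a \<in> h i" for a
    proof (cases "h i = {a}")
      case True
      have "i \<in> {0, 1} \<or> i \<in> {2, 3, 4}" using i by auto
      then have "\<exists>b. (a, b) \<in> R' \<or> (b, a) \<in> R'"
      proof
        assume "i \<in> {0, 1}"
        from K23_model_edge[OF h this, of 2] True show ?thesis by auto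
      next
        assume "i \<in> {2, 3, 4}"
        from K23_model_edge[OF h _ this, of 0] True show ?thesis by auto
      qed
      then show ?thesis by (auto simp: Field_def)
    next
      case False
      with a obtain b where b: "b \<in> h i" "b \<noteq> a" by auto
      with hc a have "(a, b) \<in> (R' \<inter> h i \<times> h i)\<^sup>*" by (auto simp: conn_def)
      with b(2) obtain c where "(a, c) \<in> R'" by (auto elim: converse_rtranclE)
      then show ?thesis by (auto simp: Field_def)
    qed
    let ?S = "R \<inter> g i \<times> g i"
    have in_fiber: "(x, y) \<in> ?S\<^sup>*" if "x \<in> g i" "y \<in> g i" "\<phi> x = \<phi> y" for x y
    proof -
      let ?F = "{z \<in> D. \<phi> z = \<phi> x}"
      have "conn R ?F" using that field[of "\<phi> x"] by (intro fiber) (auto simp: g_def)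
      moreover have "x \<in> ?F" "y \<in> ?F" using that by (auto simp: g_def)
      ultimately have "(x, y) \<in> (R \<inter> ?F \<times> ?F)\<^sup>*" unfolding conn_def by blast
      moreover have "?F \<subseteq> g i" using that by (auto simp: g_def)
      then have "R \<inter> ?F \<times> ?F \<subseteq> ?S" by blast
      ultimately show ?thesis using rtrancl_mono by blast
    qed
    have "(x, y) \<in> ?S\<^sup>*" if "x \<in> g i" "y \<in> g i" for x y
    proof -
      have "(\<phi> x, \<phi> y) \<in> (R' \<inter> h i \<times> h i)\<^sup>*"
        using hc that by (auto simp: conn_def g_def)
      then show ?thesis using that(2)
      proof (induction "\<phi> y" arbitrary: y rule: rtrancl_induct)
        case base
        with that show ?case by (intro in_fiber) auto
      next
        case (step b)
        then obtain u v where uv: "u \<in> D" "v \<in> D" "\<phi> u = b" "\<phi> v = \<phi> y" "(u, v) \<in> R"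
          using edge[of b "\<phi> y"] by auto
        with step have g: "u \<in> g i" "v \<in> g i" by (auto simp: g_def)
        have "(x, u) \<in> ?S\<^sup>*" using step.hyps(3) uv g by blast
        also have "(u, v) \<in> ?S" using uv g by blast
        also have "(v, y) \<in> ?S\<^sup>*" using uv g step by (intro in_fiber) auto
        finally show ?case .
      qed
    qed
    moreover have "g i \<noteq> {}"
    proof -
      from hc obtain a where a: "a \<in> h i" by (auto simp: conn_def)
      from fiber[OF field[OF a]] obtain x where "x \<in> D" "\<phi> x = a" by (auto simp: conn_def)
      with a show ?thesis by (auto simp: g_def)
    qed
    ultimately show ?thesis by (auto simp: conn_def)
  qed
  have "g i \<inter> g j = {}" if "i < 5" "j < 5" "i \<noteq> j" for i j
    using h that by (auto simp: g_def K23_model_def)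
  with conn edges have "K23_model R g" by (simp add: K23_model_def)
  then show ?thesis by (auto simp: has_K23_def)
qed

lemma has_K23_mono:
  assumes "has_K23 R'" "R' \<subseteq> R"
  shows "has_K23 R"
  using assms by (intro has_K23_pullback[OF assms(1), of UNIV "\<lambda>x. x"]) (auto simp: conn_singleton)

text \<open>
  The end of a longest path has all its neighbours on the path, and so has every vertex that becomes
  an end by reversing an initial segment.  With minimum degree 3 the chords at these ends give a
  $K_{2,3}$ minor, unless the first three vertices have no neighbours outside the first four.
\<close>

definition path :: "('a \<times> 'a) set \<Rightarrow> 'a list \<Rightarrow> bool" where
  "path R p \<longleftrightarrow> p \<noteq> [] \<and> distinct p \<and> (\<forall>i. Suc i < length p \<longrightarrow> (p ! i, p ! Suc i) \<in> R)"

definition longest_path :: "('a \<times> 'a) set \<Rightarrow> 'a list \<Rightarrow> bool" where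
  "longest_path R p \<longleftrightarrow> path R p \<and> (\<forall>q. path R q \<longrightarrow> length q \<le> length p)"

lemma longest_path_exists:
  assumes G: "fgraph V R" and "(x, y) \<in> R"
  shows "\<exists>p. longest_path R p"
proof -
  \<comment> \<open>\<open>path\<close> looks only at \<open>R\<close>, so a one-vertex path may lie
    outside \<open>V\<close>; every later vertex is an end of an edge.\<close>
  have "set p \<subseteq> insert (hd p) V" if "path R p" for p
  proof
    fix z assume "z \<in> set p"
    then obtain k where k: "k < length p" "z = p ! k" by (auto simp: in_set_conv_nth)
    show "z \<in> insert (hd p) V"
    proof (cases k)
      case 0
      with k that show ?thesis by (simp add: path_def hd_conv_nth)
    next
      case (Suc j)
      with k that have "(p ! j, z) \<in> R" by (auto simp: path_def)
      with fgraphD(6)[OF G] show ?thesis by auto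
    qed
  qed
  then have "length p \<le> Suc (card V)" if "path R p" for p
    using that fgraphD(1)[OF G] card_mono[of "insert (hd p) V" "set p"] card_insert_le_m1[of "Suc (card V)" V "hd p"]
    by (auto simp: path_def distinct_card card_insert_if split: if_splits)
  moreover have "path R [x]" by (simp add: path_def)
  ultimately have "\<exists>p. path R p \<and> (\<forall>q. path R q \<longrightarrow> length q \<le> length p)"
    using ex_has_greatest_nat[of "path R" "[x]" length "Suc (Suc (card V))"]
    by (auto simp: less_Suc_eq_le)
  then show ?thesis by (auto simp: longest_path_def)
qed

lemma longest_path_nbr:
  assumes G: "fgraph V R" and p: "longest_path R p" and x: "(p ! 0, x) \<in> R"
  shows "\<exists>k. 0 < k \<and> k < length p \<and> x = p ! k"
proof -
  have "x \<in> set p"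
  proof (rule ccontr)
    assume "x \<notin> set p"
    moreover have "(x, p ! 0) \<in> R" using fgraphD(3)[OF G] x by blast
    ultimately have "path R (x # p)"
      using p by (auto simp: longest_path_def path_def nth_Cons split: nat.splits)
    with p show False by (fastforce simp: longest_path_def)
  qed
  then obtain k where "k < length p" "x = p ! k" by (auto simp: in_set_conv_nth)
  moreover have "k \<noteq> 0" using fgraphD(4)[OF G] x calculation by metis
  ultimately show ?thesis by auto
qed

text \<open>Posa's rotation: the chord from \<open>p ! 0\<close> to \<open>p ! i\<close> replaces
  the path edge that enters \<open>p ! i\<close>. The new end is \<open>p ! (i - 1)\<close>, and
  nothing changes from position \<open>i\<close> on.\<close>

lemma rotate_path:
  assumes G: "fgraph V R" and p: "longest_path R p" and i: "0 < i" "i < length p" "(p ! 0, p ! i) \<in> R"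
  shows "\<exists>q. longest_path R q \<and> length q = length p \<and> (\<forall>k<i. q ! k = p ! (i - Suc k)) \<and> (\<forall>k\<ge>i. k < length p \<longrightarrow> q ! k = p ! k)"
proof -
  define q where "q = rev (take i p) @ drop i p"
  have len: "length q = length p" using i by (simp add: q_def)
  have lo: "q ! k = p ! (i - Suc k)" if "k < i" for k
    using that i by (simp add: q_def nth_append rev_nth)
  have hi: "q ! k = p ! k" if "i \<le> k" "k < length p" for k
    using that i by (simp add: q_def nth_append)
  have step: "(p ! k, p ! Suc k) \<in> R" if "Suc k < length p" for k
    using that p by (simp add: longest_path_def path_def)
  have "distinct q" using p
    by (auto simp: q_def longest_path_def path_def set_take_disj_set_drop_if_distinct)
  moreover have "(q ! k, q ! Suc k) \<in> R" if k: "Suc k < length q" for k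
  proof -
    consider "Suc k < i" | "Suc k = i" | "i \<le> k" by linarith
    then show ?thesis
    proof cases
      case 1
      then have "Suc (i - Suc (Suc k)) = i - Suc k" by simp
      with step[of "i - Suc (Suc k)"] 1 i have "(p ! (i - Suc (Suc k)), p ! (i - Suc k)) \<in> R" by auto
      with 1 lo[of k] lo[of "Suc k"] fgraphD(3)[OF G] show ?thesis by auto
    next
      case 2
      with lo[of k] hi[of i] i show ?thesis by auto
    next
      case 3
      with hi[of k] hi[of "Suc k"] step[of k] k len show ?thesis by auto
    qed
  qed
  moreover have "q \<noteq> []" using len i by auto
  ultimately have "path R q" by (simp add: path_def)
  with p len have "longest_path R q" by (simp add: longest_path_def)
  with len lo hi show ?thesis by blast
qed

lemma conn_segment:
  assumes "sym R" "path R p" "a \<le> b" "b < length p"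
  shows "conn R ((!) p ` {a..b})"
proof -
  let ?S = "(!) p ` {a..b}" and ?T = "R \<inter> (!) p ` {a..b} \<times> (!) p ` {a..b}"
  have "sym ?T" using assms(1) by (auto simp: sym_def)
  have "(p ! a, p ! k) \<in> ?T\<^sup>*" if "a \<le> k" "k \<le> b" for k
    using that
  proof (induction k rule: dec_induct)
    case (step k)
    then have "(p ! k, p ! Suc k) \<in> ?T" using assms by (auto simp: path_def)
    with step show ?case by (meson Suc_leD rtrancl.rtrancl_into_rtrancl)
  qed auto
  moreover from this have "(p ! k, p ! a) \<in> ?T\<^sup>*" if "a \<le> k" "k \<le> b" for k
    using that sym_rtrancl[OF \<open>sym ?T\<close>] by (auto simp: sym_def)
  ultimately have "(p ! k, p ! l) \<in> ?T\<^sup>*" if "k \<in> {a..b}" "l \<in> {a..b}" for k l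
    using that rtrancl_trans[of "p ! k" "p ! a" ?T "p ! l"] by auto
  then show ?thesis using assms(3) by (simp add: conn_def)
qed

text \<open>All minors found on longest paths have intervals of the path as branch sets, which
  reduces everything to disjoint index intervals and six edges. Intervals 0 and 1 are the side of
  size two.\<close>

lemma has_K23_segments:
  assumes G: "fgraph V R" and p: "path R p"
    and le: "a0 \<le> b0" "a1 \<le> b1" "a2 \<le> b2" "a3 \<le> b3" "a4 \<le> b4"
    and len: "b0 < length p" "b1 < length p" "b2 < length p" "b3 < length p" "b4 < length p"
    and dj: "{a0..b0} \<inter> {a1..b1} = {}" "{a0..b0} \<inter> {a2..b2} = {}" "{a0..b0} \<inter> {a3..b3} = {}"
      "{a0..b0} \<inter> {a4..b4} = {}" "{a1..b1} \<inter> {a2..b2} = {}" "{a1..b1} \<inter> {a3..b3} = {}"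
      "{a1..b1} \<inter> {a4..b4} = {}" "{a2..b2} \<inter> {a3..b3} = {}" "{a2..b2} \<inter> {a4..b4} = {}"
      "{a3..b3} \<inter> {a4..b4} = {}"
    and edges: "\<exists>u\<in>{a0..b0}. \<exists>v\<in>{a2..b2}. (p ! u, p ! v) \<in> R"
      "\<exists>u\<in>{a0..b0}. \<exists>v\<in>{a3..b3}. (p ! u, p ! v) \<in> R"
      "\<exists>u\<in>{a0..b0}. \<exists>v\<in>{a4..b4}. (p ! u, p ! v) \<in> R"
      "\<exists>u\<in>{a1..b1}. \<exists>v\<in>{a2..b2}. (p ! u, p ! v) \<in> R"
      "\<exists>u\<in>{a1..b1}. \<exists>v\<in>{a3..b3}. (p ! u, p ! v) \<in> R"
      "\<exists>u\<in>{a1..b1}. \<exists>v\<in>{a4..b4}. (p ! u, p ! v) \<in> R"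
  shows "has_K23 R"
proof -
  define I where "I = (!) [{a0..b0}, {a1..b1}, {a2..b2}, {a3..b3}, {a4..b4}]"
  have I: "I 0 = {a0..b0}" "I (Suc 0) = {a1..b1}" "I 2 = {a2..b2}" "I 3 = {a3..b3}" "I 4 = {a4..b4}"
    by (simp_all add: I_def)
  have five: "i \<in> {0, 1, 2, 3, 4}" if "i < 5" for i :: nat using that by auto
  have symR: "sym R" using G by (simp add: fgraph_def)
  have inj: "inj_on ((!) p) {..<length p}" using p by (auto simp: path_def inj_on_nth)
  have sub: "I i \<subseteq> {..<length p}" if "i < 5" for i
    using five[OF that] len by (elim insertE emptyE) (auto simp: I)
  note dj_I = dj[folded I]
  have dj': "I i \<inter> I j = {}" if "i < 5" "j < 5" "i \<noteq> j" for i j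
    using five[OF that(1)] five[OF that(2)] that(3)
    by (elim insertE emptyE) (simp_all add: dj_I dj_I[THEN trans[OF Int_commute]])
  have "conn R ((!) p ` I i)" if "i < 5" for i
    using five[OF that] conn_segment[OF symR p] le len by (elim insertE emptyE) (simp_all add: I)
  moreover have "((!) p ` I i) \<inter> ((!) p ` I j) = {}" if "i < 5" "j < 5" "i \<noteq> j" for i j
    using inj_on_image_Int[OF inj sub[OF that(1)] sub[OF that(2)]] dj'[OF that] by simp
  moreover have "\<exists>u\<in>(!) p ` I i. \<exists>v\<in>(!) p ` I j. (u, v) \<in> R" if "i \<in> {0, 1}" "j \<in> {2, 3, 4}" for i j
    using that edges by (elim insertE emptyE) (simp_all add: I)
  ultimately have "K23_model R (\<lambda>i. (!) p ` I i)" by (simp add: K23_model_def)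
  then show ?thesis by (auto simp: has_K23_def)
qed

section \<open>Chords at the ends of longest paths\<close>

text \<open>The neighbours of the end lie on the path. Apart from \<open>p ! 1\<close> and possibly
  \<open>p ! i\<close> there is a third one, and by minimality of \<open>i\<close> it comes
  later.\<close>

lemma longest_path_later_nbr:
  assumes G: "fgraph V R" and p: "longest_path R p" and deg: "card (R `` {p ! 0}) \<ge> 3"
    and least: "\<And>k. 2 \<le> k \<Longrightarrow> k < length p \<Longrightarrow> (p ! 0, p ! k) \<in> R \<Longrightarrow> i \<le> k"
  shows "\<exists>j>i. j < length p \<and> (p ! 0, p ! j) \<in> R"
proof (rule ccontr)
  assume none: "\<not> ?thesis"
  have "R `` {p ! 0} \<subseteq> {p ! 1, p ! i}"
  proof
    fix x assume "x \<in> R `` {p ! 0}"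
    then obtain k where k: "0 < k" "k < length p" "x = p ! k" "(p ! 0, p ! k) \<in> R"
      using longest_path_nbr[OF G p] by auto
    have "k = 1 \<or> k = i"
    proof (cases "k = 1")
      case False
      with k have "i \<le> k" by (intro least) auto
      moreover have "\<not> i < k" using none k by auto
      ultimately show ?thesis by simp
    qed simp
    with k show "x \<in> {p ! 1, p ! i}" by auto
  qed
  then have "card (R `` {p ! 0}) \<le> card {p ! 1, p ! i}" by (intro card_mono) auto
  also have "\<dots> \<le> 2" by (simp add: card_insert_if)
  finally show False using deg by simp
qed

text \<open>Rotating at the chord makes \<open>p ! 1\<close> an end as well, so it has a neighbour
  \<open>p ! l\<close> with \<open>l > 2\<close>. Together with a neighbour of \<open>p ! 0\<close>
  beyond position 3 this would give a K_{2,3}.\<close>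

lemma longest_path_triangle:
  assumes G: "fgraph V R" and noK: "\<not> has_K23 R" and deg: "\<And>x. x \<in> V \<Longrightarrow> card (R `` {x}) \<ge> 3"
    and p: "longest_path R p" and len: "2 < length p" and chord: "(p ! 0, p ! 2) \<in> R"
  shows "3 < length p" "R `` {p ! 0} = {p ! 1, p ! 2, p ! 3}"
proof -
  note sym = fgraphD(3)[OF G]
  have step: "(p ! k, p ! Suc k) \<in> R" if "Suc k < length p" for k
    using that p by (simp add: longest_path_def path_def)
  have path: "path R p" using p by (simp add: longest_path_def)
  have deg0: "card (R `` {p ! 0}) \<ge> 3" using chord fgraphD(5)[OF G] deg by auto
  obtain q where q: "longest_path R q" "length q = length p" "\<forall>k<2. q ! k = p ! (2 - Suc k)"
      "\<forall>k\<ge>2. k < length p \<longrightarrow> q ! k = p ! k"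
    using rotate_path[OF G p _ len chord] by auto
  have q0: "q ! 0 = p ! 1" using q(3) by auto
  have deg1: "card (R `` {q ! 0}) \<ge> 3" using step[of 0] len fgraphD(6)[OF G] deg q0 by auto
  obtain l where l: "2 < l" "l < length p" "(p ! 1, p ! l) \<in> R"
    using longest_path_later_nbr[OF G q(1) deg1, of 2] q by auto
  have three: "j = 3" if j: "2 < j" "j < length p" "(p ! 0, p ! j) \<in> R" for j
  proof (rule ccontr)
    assume "j \<noteq> 3"
    with j have j3: "3 < j" by simp
    have s0: "(p ! 0, p ! 1) \<in> R" and s1: "(p ! 1, p ! 2) \<in> R" and s2: "(p ! 2, p ! 3) \<in> R"
      and s3: "(p ! 3, p ! 4) \<in> R"
      using step[of 0] step[of 1] step[of 2] step[of 3] j j3 by (auto simp: eval_nat_numeral)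
    have "has_K23 R"
    proof (cases "l = 3")
      case True
      \<comment> \<open>Here \<open>p ! 0\<close> and \<open>p ! 3\<close> have the three
        connections \<open>p ! 1\<close>, \<open>p ! 2\<close> and the segment from 4 to
        \<open>j\<close>.\<close>
      show ?thesis
        by (rule has_K23_segments[OF G path, of 0 0 3 3 1 1 2 2 4 j])
           (use j j3 l True chord s0 s1 s3 sym[OF s2] sym[OF l(3)] in \<open>auto simp: eval_nat_numeral\<close>)
    next
      case False
      with l have "3 < l" by simp
      \<comment> \<open>Here \<open>p ! 2\<close> and the whole segment from 4 on are both joined to
        \<open>p ! 0\<close>, \<open>p ! 1\<close> and \<open>p ! 3\<close>.\<close>
      show ?thesis
      proof (rule has_K23_segments[OF G path, of 2 2 4 "max j l" 0 0 1 1 3 3])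
        show "\<exists>u\<in>{4..max j l}. \<exists>v\<in>{0..0}. (p ! u, p ! v) \<in> R"
          using sym[OF j(3)] j3 by (simp, rule_tac bexI[of _ j], simp_all)
        show "\<exists>u\<in>{4..max j l}. \<exists>v\<in>{1..1}. (p ! u, p ! v) \<in> R"
          using sym[OF l(3)] \<open>3 < l\<close> by (simp, rule_tac bexI[of _ l], simp_all)
        show "\<exists>u\<in>{4..max j l}. \<exists>v\<in>{3..3}. (p ! u, p ! v) \<in> R"
          using sym[OF s3] j j3 by (simp, rule_tac bexI[of _ 4], simp_all)
      qed (use j j3 l \<open>3 < l\<close> s2 sym[OF chord] sym[OF s1] in \<open>auto simp: eval_nat_numeral\<close>)
    qed
    with noK show False ..
  qed
  obtain j where j: "2 < j" "j < length p" "(p ! 0, p ! j) \<in> R"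
    using longest_path_later_nbr[OF G p deg0, of 2] by auto
  with three have 3: "3 < length p" "(p ! 0, p ! 3) \<in> R" by auto
  then show "3 < length p" by simp
  have "x \<in> {p ! 1, p ! 2, p ! 3}" if x: "(p ! 0, x) \<in> R" for x
  proof -
    obtain k where k: "0 < k" "k < length p" "x = p ! k" using longest_path_nbr[OF G p x] by auto
    consider "k = 1" | "k = 2" | "2 < k" using k by linarith
    then show ?thesis using three[of k] k x by cases auto
  qed
  then show "R `` {p ! 0} = {p ! 1, p ! 2, p ! 3}"
    using chord 3 step[of 0] by auto
qed

lemma K23_free_cases:
  assumes G: "fgraph V R" and ne: "V \<noteq> {}" and noK: "\<not> has_K23 R"
  obtains (low) x where "x \<in> V" "card (R `` {x}) \<le> 2"
  | (leaf) a b c v where "distinct [a, b, c, v]" "{a, b, c, v} \<subseteq> V"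
      "R `` {a} = {b, c, v}" "R `` {b} = {a, c, v}" "R `` {c} = {a, b, v}"
proof (cases "\<forall>x\<in>V. card (R `` {x}) \<ge> 3")
  case False
  then obtain x where "x \<in> V" "card (R `` {x}) \<le> 2" by (auto simp: not_le)
  then show thesis by (rule low)
next
  case True
  then have deg: "card (R `` {x}) \<ge> 3" if "x \<in> V" for x using that by blast
  note sym = fgraphD(3)[OF G]
  from ne obtain x where "x \<in> V" by auto
  with deg[OF this] obtain y where xy: "(x, y) \<in> R" by (cases "R `` {x} = {}") auto
  \<comment> \<open>The least chord length is taken over all longest paths, not over one, so that
    minimality is also available after a rotation.\<close>
  define good where "good i \<longleftrightarrow> 2 \<le> i \<and> (\<exists>p. longest_path R p \<and> i < length p \<and> (p ! 0, p ! i) \<in> R)" for i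
  have "\<exists>i. good i"
  proof -
    obtain p where p: "longest_path R p" using longest_path_exists[OF G xy] by auto
    have pos: "p \<noteq> []" using p by (auto simp: longest_path_def path_def)
    have "\<exists>z. (p ! 0, z) \<in> R"
    proof (rule ccontr)
      assume "\<nexists>z. (p ! 0, z) \<in> R"
      then have "\<not> 1 < length p" using p by (auto simp: longest_path_def path_def)
      with pos have "length p = 1" by (cases p) auto
      moreover have "path R [x, y]" using xy fgraphD(7)[OF G xy] by (auto simp: path_def less_Suc_eq)
      ultimately show False using p by (fastforce simp: longest_path_def)
    qed
    then have "card (R `` {p ! 0}) \<ge> 3" using deg fgraphD(5)[OF G] by blast
    with longest_path_later_nbr[OF G p, of 1] obtain j where "1 < j" "j < length p" "(p ! 0, p ! j) \<in> R"
      by auto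
    with p show ?thesis unfolding good_def by (intro exI[of _ j]) auto
  qed
  then obtain i where i: "good i" and least: "\<And>k. good k \<Longrightarrow> i \<le> k"
    by (metis LeastI Least_le)
  then obtain p where i2: "2 \<le> i" and p: "longest_path R p" and il: "i < length p" and chord: "(p ! 0, p ! i) \<in> R"
    by (auto simp: good_def)
  have least_p: "i \<le> k" if "longest_path R q" "2 \<le> k" "k < length q" "(q ! 0, q ! k) \<in> R" for q k
    using that by (intro least) (auto simp: good_def)
  have path: "path R p" using p by (simp add: longest_path_def)
  have step: "(p ! k, p ! Suc k) \<in> R" if "Suc k < length p" for k
    using that path by (simp add: path_def)
  have two: "i = 2"
  proof (rule ccontr)
    assume "i \<noteq> 2"
    with i2 have i3: "3 \<le> i" by simp
    have "card (R `` {p ! 0}) \<ge> 3" using deg chord fgraphD(5)[OF G] by blast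
    then obtain j where j: "i < j" "j < length p" "(p ! 0, p ! j) \<in> R"
      using longest_path_later_nbr[OF G p _ least_p[OF p]] by blast
    obtain q where q: "longest_path R q" "length q = length p" "\<forall>k<i. q ! k = p ! (i - Suc k)"
        "\<forall>k\<ge>i. k < length p \<longrightarrow> q ! k = p ! k"
      using rotate_path[OF G p _ il chord] i2 by auto
    have q0: "q ! 0 = p ! (i - 1)" using q(3) i2 by auto
    have si: "(p ! (i - 1), p ! i) \<in> R" using step[of "i - 1"] i2 il by simp
    then have degq: "card (R `` {q ! 0}) \<ge> 3" using deg[OF fgraphD(5)[OF G si]] q0 by simp
    obtain l where "i < l" "l < length q" "(q ! 0, q ! l) \<in> R"
      using longest_path_later_nbr[OF G q(1) degq least_p[OF q(1)]] by blast
    with q(2,4) q0 have l: "i < l" "l < length p" "(p ! (i - 1), p ! l) \<in> R" by simp_all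
    have si': "(p ! (i - 1), p ! (i - 2)) \<in> R"
      using sym[OF step[of "i - 2"]] i2 il by (simp add: Suc_diff_Suc numeral_2_eq_2)
    have s0: "(p ! 0, p ! 1) \<in> R" using step[of 0] i2 il by simp
    \<comment> \<open>The ends \<open>p ! 0\<close> and \<open>p ! (i - 1)\<close> of the two paths
      are both joined to the segment between them, to \<open>p ! i\<close>, and to the segment
      behind it. For \<open>i = 2\<close> the first of these segments would be empty.\<close>
    have "has_K23 R"
    proof (rule has_K23_segments[OF G path, of 0 0 "i - 1" "i - 1" 1 "i - 2" i i "Suc i" "max j l"])
      show "\<exists>u\<in>{0..0}. \<exists>v\<in>{1..i - 2}. (p ! u, p ! v) \<in> R" using s0 i3 by (intro bexI[of _ 0] bexI[of _ 1]) auto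
      show "\<exists>u\<in>{i - 1..i - 1}. \<exists>v\<in>{1..i - 2}. (p ! u, p ! v) \<in> R"
        using si' i3 by (intro bexI[of _ "i - 1"] bexI[of _ "i - 2"]) auto
    qed (use i3 il j l chord si in \<open>auto simp: max_def\<close>)
    with noK show False ..
  qed
  have tri: "3 < length p \<and> R `` {p ! 0} = {p ! 1, p ! 2, p ! 3}"
    if "longest_path R p" "2 < length p" "(p ! 0, p ! 2) \<in> R" for p
    using longest_path_triangle[OF G noK _ that] deg by blast
  have len: "2 < length p" and ch: "(p ! 0, p ! 2) \<in> R" using il chord two by auto
  have l3: "3 < length p" and N0: "R `` {p ! 0} = {p ! 1, p ! 2, p ! 3}" using tri[OF p len ch] by auto
  \<comment> \<open>Reversing the first two or the first three vertices makes \<open>p ! 1\<close>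
    or \<open>p ! 2\<close> the end of a longest path whose first four vertices are the same, so the
    same conclusion holds for them.\<close>
  obtain q where q: "longest_path R q" "length q = length p" "\<forall>k<2. q ! k = p ! (2 - Suc k)"
      "\<forall>k\<ge>2. k < length p \<longrightarrow> q ! k = p ! k"
    using rotate_path[OF G p _ len ch] by auto
  have qs: "q ! 0 = p ! 1" "q ! 1 = p ! 0" "q ! 2 = p ! 2" "q ! 3 = p ! 3"
    using q(3,4) l3 by (auto simp: less_Suc_eq numeral_2_eq_2)
  have s1: "(p ! 1, p ! 2) \<in> R" using step[of 1] l3 by (simp add: numeral_2_eq_2)
  have N1: "R `` {p ! 1} = {p ! 0, p ! 2, p ! 3}"
    using tri[OF q(1), unfolded qs q(2)] len s1 by simp
  have "(p ! 0, p ! 3) \<in> R" using N0 by auto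
  then obtain r where r: "longest_path R r" "length r = length p" "\<forall>k<3. r ! k = p ! (3 - Suc k)"
      "\<forall>k\<ge>3. k < length p \<longrightarrow> r ! k = p ! k"
    using rotate_path[OF G p _ l3] by auto
  have rs: "r ! 0 = p ! 2" "r ! 1 = p ! 1" "r ! 2 = p ! 0" "r ! 3 = p ! 3"
    using r(3,4) l3 by (auto simp: less_Suc_eq eval_nat_numeral)
  have N2: "R `` {p ! 2} = {p ! 0, p ! 1, p ! 3}"
    using tri[OF r(1), unfolded rs r(2)] len sym[OF ch] by (simp add: insert_commute)
  have "distinct p" using path by (simp add: path_def)
  then have ne: "p ! i \<noteq> p ! j" if "i < j" "j < length p" for i j
    using that by (simp add: nth_eq_iff_index_eq)
  have d: "distinct [p ! 0, p ! 1, p ! 2, p ! 3]"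
    using ne[of 0 1] ne[of 0 2] ne[of 0 3] ne[of 1 2] ne[of 1 3] ne[of 2 3] l3 by auto
  have "{p ! 0, p ! 1, p ! 2, p ! 3} \<subseteq> V"
    using N0 N1 fgraphD(5,6)[OF G] by blast
  then show thesis using leaf[OF d] N0 N1 N2 by blast
qed

section \<open>Six colors\<close>

lemma avoid_color:
  assumes "finite P" "finite X" "card X < card P"
  obtains k where "k \<in> P" "k \<notin> X"
proof -
  have "\<not> P \<subseteq> X" using assms card_mono[of X P] by auto
  then show thesis using that by blast
qed

text \<open>A move of \<open>x\<close> before every block of \<open>k\<close> moves of its neighbours keeps \<open>x\<close> out of their way.\<close>

lemma dodge:
  assumes P: "finite P" "card N + k < card P" "finite N" "x \<notin> N"
    and ms: "fst ` set ms \<subseteq> N" "length ms \<le> k * j" and start: "\<And>y. y \<in> N \<Longrightarrow> c x \<noteq> c y"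
  shows "\<exists>T. fst ` set T \<subseteq> insert x N \<and> moves_of N T = ms \<and> (\<forall>y\<in>N. apart x y c T) \<and> num_moves T x \<le> j \<and>
    (\<forall>q. (x, q) \<in> set T \<longrightarrow> q \<in> P)"
  using ms start
proof (induction j arbitrary: ms c)
  case 0
  then show ?case by (intro exI[of _ "[]"]) auto
next
  case (Suc j)
  have "card (c ` N \<union> snd ` set (take k ms)) \<le> card N + k"
    by (intro order.trans[OF card_Un_le] add_mono card_image_le P order.trans[OF card_image_le] order.trans[OF card_length]) auto
  with P obtain q where q: "q \<in> P" "q \<notin> c ` N \<union> snd ` set (take k ms)"
    using avoid_color[of P "c ` N \<union> snd ` set (take k ms)"] by (metis finite_UnI finite_imageI finite_set le_less_trans)
  define A where "A = (x, q) # take k ms"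
  define d where "d = recolor A c"
  have fA: "fst ` set (take k ms) \<subseteq> N" using Suc.prems(1) set_take_subset[of k ms] by fastforce
  have xA: "x \<notin> fst ` set (take k ms)" using fA P by auto
  have apA: "apart x y c A" if y: "y \<in> N" for y
  proof -
    have "apart x y (c(x := q)) (take k ms)"
    proof (rule apart_const)
      show "(c(x := q)) y \<noteq> (c(x := q)) x" using q y P by auto
      show "r \<noteq> (c(x := q)) x" if "(y, r) \<in> set (take k ms)" for r using q that by force
    qed (rule xA)
    then show ?thesis using Suc.prems(3)[OF y] by (simp add: A_def)
  qed
  have "fst ` set (drop k ms) \<subseteq> N" using Suc.prems(1) set_drop_subset[of k ms] by fastforce
  moreover have "length (drop k ms) \<le> k * j" using Suc.prems(2) by simp
  moreover have "d x \<noteq> d y" if "y \<in> N" for y using apart_end[OF apA[OF that]] by (simp add: d_def)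
  ultimately obtain T where T: "fst ` set T \<subseteq> insert x N" "moves_of N T = drop k ms" "\<forall>y\<in>N. apart x y d T"
      "num_moves T x \<le> j" "\<forall>q. (x, q) \<in> set T \<longrightarrow> q \<in> P"
    using Suc.IH[of "drop k ms" d] by auto
  have "moves_of N A = take k ms" using P fA by (simp add: A_def moves_of_all)
  moreover have "num_moves A x = 1" using num_moves_eq_0[OF xA] by (simp add: A_def)
  moreover have "r \<in> P" if "(x, r) \<in> set A" for r using that q xA by (force simp: A_def)
  ultimately show ?case using T apA fA
    by (intro exI[of _ "A @ T"]) (use P(4) in \<open>auto simp: apart_append d_def A_def\<close>)
qed

text \<open>Once the neighbours have come to rest, one more move brings \<open>x\<close> to its
  target; hence \<open>Suc j\<close>.\<close>

lemma extend_vertex: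
  assumes P: "finite P" "card N + k < card P" "finite N" "x \<notin> N"
    and ms: "fst ` set ms \<subseteq> N" "length ms \<le> k * j" and start: "\<And>y. y \<in> N \<Longrightarrow> c x \<noteq> c y"
    and stop: "\<And>y. y \<in> N \<Longrightarrow> q \<noteq> recolor ms c y" "q \<in> P"
  shows "\<exists>T. fst ` set T \<subseteq> insert x N \<and> moves_of N T = ms \<and> (\<forall>y\<in>N. apart x y c T) \<and> num_moves T x \<le> Suc j \<and>
    (\<forall>q. (x, q) \<in> set T \<longrightarrow> q \<in> P) \<and> recolor T c x = q"
proof -
  obtain T where T: "fst ` set T \<subseteq> insert x N" "moves_of N T = ms" "\<forall>y\<in>N. apart x y c T" "num_moves T x \<le> j"
      "\<forall>q. (x, q) \<in> set T \<longrightarrow> q \<in> P"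
    using dodge[OF P ms, of c] start by auto
  have "apart x y c (T @ [(x, q)])" if y: "y \<in> N" for y
    using T stop(1)[OF y] y P(4) recolor_moves_of[OF y, of T c] apart_end[of x y c T] by (auto simp: apart_append)
  with T stop(2) P(4) show ?thesis by (intro exI[of _ "T @ [(x, q)]"]) auto
qed

text \<open>Two of five colors are not in use. If \<open>x'\<close> is in use, \<open>y\<close> and
  \<open>z\<close> first step aside to these two; otherwise \<open>x\<close> can move at once and
  only \<open>y\<close> has to step aside. The budget is uneven because in the application
  \<open>x\<close> has already moved once to evade the fourth vertex of the K4.\<close>

lemma rearrange_triangle:
  assumes P: "finite P" "5 \<le> card P" and d: "distinct [x, y, z]"
    and c: "c x \<in> P" "c y \<in> P" "c z \<in> P" "distinct [c x, c y, c z]"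
    and e: "x' \<in> P" "y' \<in> P" "z' \<in> P" "distinct [x', y', z']"
  shows "\<exists>T. set T \<subseteq> {x, y, z} \<times> P \<and> apart x y c T \<and> apart x z c T \<and> apart y z c T \<and>
    recolor T c x = x' \<and> recolor T c y = y' \<and> recolor T c z = z' \<and>
    num_moves T x \<le> 1 \<and> num_moves T y \<le> 2 \<and> num_moves T z \<le> 2"
proof (cases "x' \<in> {c x, c y, c z}")
  case True
  have "card {c x, c y, c z} < card P" using P by (simp add: card_insert_if)
  from avoid_color[OF P(1) _ this] obtain f where f: "f \<in> P" "f \<notin> {c x, c y, c z}" by blast
  have "card {c x, c y, c z, f} < card P" using P by (simp add: card_insert_if)
  from avoid_color[OF P(1) _ this] obtain g where g: "g \<in> P" "g \<notin> {c x, c y, c z, f}" by blast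
  \<comment> \<open>\<open>z\<close> waits on \<open>i\<close> while \<open>y\<close> already takes
    its final color, hence \<open>y' \<noteq> i\<close>.\<close>
  obtain h i where hi: "{h, i} = {f, g}" "h \<noteq> i" "y' \<noteq> i"
    using g by (cases "y' = f") fastforce+
  from hi f g have hi': "h \<in> P" "i \<in> P" "h \<notin> {c x, c y, c z}" "i \<notin> {c x, c y, c z}" by (auto simp: doubleton_eq_iff)
  show ?thesis
    by (intro exI[of _ "[(y, h), (z, i), (x, x'), (y, y'), (z, z')]"]) (use True hi hi' c d e in auto)
next
  case False
  have "card {x', c y, c z, z'} < card P" using P by (simp add: card_insert_if)
  from avoid_color[OF P(1) _ this] obtain f where f: "f \<in> P" "f \<notin> {x', c y, c z, z'}" by blast
  show ?thesis
    by (intro exI[of _ "[(x, x'), (y, f), (z, z'), (y, y')]"]) (use False f c d e in auto)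
qed

section \<open>Six colors: extending schedules to deleted vertices\<close>

text \<open>All neighbours of \<open>X\<close> lie in \<open>N \<union> X\<close>, so every edge is
  controlled either by the schedule \<open>ms\<close> of the rest or by the local schedule
  \<open>T\<close>. The amalgam projects to both.\<close>

lemma extend_schedule:
  assumes G: "fgraph V R" and X: "X \<subseteq> V" "N \<subseteq> V - X"
    and ms: "fst ` set ms \<subseteq> V - X" "\<forall>(x, y)\<in>R. x \<notin> X \<longrightarrow> y \<notin> X \<longrightarrow> apart x y c ms"
    and T: "fst ` set T \<subseteq> N \<union> X" "moves_of N T = moves_of N ms"
      "\<forall>(x, y)\<in>R. x \<in> X \<longrightarrow> y \<in> N \<union> X \<and> apart x y c T"
  shows "\<exists>zs. set zs \<subseteq> set ms \<union> set T \<and> (\<forall>(x, y)\<in>R. apart x y c zs) \<and>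
    (\<forall>x\<in>V - X. recolor zs c x = recolor ms c x \<and> num_moves zs x = num_moves ms x) \<and>
    (\<forall>x\<in>X. recolor zs c x = recolor T c x \<and> num_moves zs x = num_moves T x)"
proof -
  \<comment> \<open>The two domains overlap exactly in \<open>N\<close>, where the lists agree by
    assumption.\<close>
  have "moves_of (N \<union> X) ms = moves_of (N \<inter> (V - X)) ms"
    using ms(1) X by (auto simp: moves_of_def intro!: filter_cong)
  also have "N \<inter> (V - X) = N" using X by blast
  also have "moves_of N ms = moves_of N T" by (simp add: T(2))
  also have "\<dots> = moves_of (V - X) T"
    using T(1) X by (auto simp: moves_of_def intro!: filter_cong)
  finally obtain zs where zs: "moves_of (V - X) zs = ms" "moves_of (N \<union> X) zs = T" "fst ` set zs \<subseteq> (V - X) \<union> (N \<union> X)"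
    using amalgamate[of "N \<union> X" ms "V - X" T] ms(1) T(1) by auto
  have set: "set ms = {m \<in> set zs. fst m \<in> V - X}" "set T = {m \<in> set zs. fst m \<in> N \<union> X}"
    unfolding zs(1,2)[symmetric] by simp_all
  have "set zs \<subseteq> set ms \<union> set T"
    unfolding set using zs(3) by auto
  moreover have "apart x y c zs" if xy: "(x, y) \<in> R" for x y
  proof -
    consider "x \<in> X" | "y \<in> X" | "x \<notin> X" "y \<notin> X" by blast
    then show ?thesis
    proof cases
      case 1
      with bspec[OF T(3) xy] show ?thesis using apart_moves_of[of x "N \<union> X" y c zs] zs(2) by auto
    next
      case 2
      with bspec[OF T(3) fgraphD(3)[OF G xy]] have "apart y x c zs"
        using apart_moves_of[of y "N \<union> X" x c zs] zs(2) by auto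
      then show ?thesis by (simp add: apart_sym)
    next
      case 3
      with bspec[OF ms(2) xy] show ?thesis
        using apart_moves_of[of x "V - X" y c zs] zs(1) fgraphD(5,6)[OF G xy] by auto
    qed
  qed
  moreover have "recolor zs c x = recolor ms c x \<and> num_moves zs x = num_moves ms x" if "x \<in> V - X" for x
    using recolor_moves_of[OF that, of zs c] num_moves_simps(4)[of "V - X" zs x] that unfolding zs(1) by simp
  moreover have "recolor zs c x = recolor T c x \<and> num_moves zs x = num_moves T x" if "x \<in> X" for x
    using recolor_moves_of[of x "N \<union> X" zs c] num_moves_simps(4)[of "N \<union> X" zs x] that unfolding zs(2) by simp
  ultimately show ?thesis by blast
qed

definition proper :: "'a set \<Rightarrow> ('a \<times> 'a) set \<Rightarrow> 'c set \<Rightarrow> ('a \<Rightarrow> 'c) \<Rightarrow> bool" where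
  "proper V R P c \<longleftrightarrow> c ` V \<subseteq> P \<and> (\<forall>(x, y)\<in>R. c x \<noteq> c y)"

lemma length_moves_of_le:
  assumes "card N \<le> n" "finite N" "\<And>x. x \<in> N \<Longrightarrow> num_moves ms x \<le> b"
  shows "length (moves_of N ms) \<le> b * n"
proof -
  have "length (moves_of N ms) = (\<Sum>x\<in>N. num_moves ms x)"
    using assms(2)
  proof (induction N)
    case (insert x N)
    have "length (moves_of (insert x N) ms) = num_moves ms x + length (moves_of N ms)"
      using insert.hyps by (induction ms) (auto simp: num_moves_def)
    with insert show ?case by simp
  qed (simp add: moves_of_def)
  also have "\<dots> \<le> (\<Sum>x\<in>N. b)" by (intro sum_mono assms)
  also have "\<dots> \<le> b * n" using assms(1) by simp
  finally show ?thesis .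
qed

text \<open>Before the third move of \<open>v\<close> the other three vertices avoid all colors that \<open>v\<close> has had so
  far; they are rearranged once \<open>v\<close> has come to rest.\<close>

lemma extend_K4_six_colors:
  assumes P: "finite P" "6 \<le> card P" and d: "distinct [a, b, x, v]"
    and ms: "set ms \<subseteq> {v} \<times> P" "length ms \<le> 3"
    and c: "c a \<in> P" "c b \<in> P" "c x \<in> P" "c v \<in> P" "distinct [c a, c b, c x, c v]"
    and e: "a' \<in> P" "b' \<in> P" "x' \<in> P" "distinct [a', b', x', recolor ms c v]"
  shows "\<exists>T. set T \<subseteq> {a, b, x, v} \<times> P \<and> moves_of {v} T = ms \<and>
    apart a b c T \<and> apart a x c T \<and> apart b x c T \<and> apart v a c T \<and> apart v b c T \<and> apart v x c T \<and>
    recolor T c a = a' \<and> recolor T c b = b' \<and> recolor T c x = x' \<and>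
    num_moves T a \<le> 3 \<and> num_moves T b \<le> 3 \<and> num_moves T x \<le> 3"
proof -
  define m1 where "m1 = take 2 ms"
  define m2 where "m2 = drop 2 ms"
  have msm: "ms = m1 @ m2" by (simp add: m1_def m2_def)
  \<comment> \<open>The start and the first two moves of \<open>v\<close> take at most three colors,
    so at least three of six are left.\<close>
  define D where "D = P - insert (c v) (snd ` set m1)"
  have "card (insert (c v) (snd ` set m1)) \<le> Suc (card (snd ` set m1))" by (simp add: card_insert_if)
  also have "card (snd ` set m1) \<le> 2"
    using card_image_le[of "set m1" snd] card_length[of m1] by (simp add: m1_def)
  finally have "card (insert (c v) (snd ` set m1)) \<le> 3" by simp
  with P diff_card_le_card_Diff[of "insert (c v) (snd ` set m1)" P] have D: "finite D" "3 \<le> card D"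
    by (auto simp: D_def)
  \<comment> \<open>Inside \<open>D\<close> there is no conflict with \<open>v\<close>, so a moving
    vertex has to avoid only the current colors of the other two.\<close>
  have pick: "\<exists>k\<in>D. k \<noteq> s \<and> k \<noteq> t" for s t
  proof -
    have "card {s, t} < card D" using D by (simp add: card_insert_if)
    from avoid_color[OF D(1) _ this] show ?thesis by auto
  qed
  obtain a1 where a1: "a1 \<in> D" "a1 \<noteq> c b" "a1 \<noteq> c x" using pick by blast
  obtain b1 where b1: "b1 \<in> D" "b1 \<noteq> a1" "b1 \<noteq> c x" using pick by blast
  obtain x1 where x1: "x1 \<in> D" "x1 \<noteq> a1" "x1 \<noteq> b1" using pick by blast
  define A where "A = [(a, a1), (b, b1), (x, x1)]"
  define c1 where "c1 = recolor (A @ m1) c"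
  have fm1: "fst ` set m1 \<subseteq> {v}" "fst ` set m2 \<subseteq> {v}"
    using ms(1) set_take_subset[of 2 ms] set_drop_subset[of 2 ms] unfolding m1_def m2_def by fastforce+
  have nm: "y \<notin> fst ` set m1" "y \<notin> fst ` set m2" if "y \<noteq> v" for y
    using fm1 that by auto
  have c1: "c1 a = a1" "c1 b = b1" "c1 x = x1"
    using d by (simp_all add: c1_def A_def recolor_notin nm)
  have c1v: "c1 v = recolor m1 c v" using d by (auto simp: c1_def A_def intro!: recolor_cong)
  have c1vD: "c1 v \<in> P" "c1 v \<notin> D"
  proof -
    from recolor_in[of m1 c v] have "c1 v \<in> insert (c v) (snd ` set m1)" using c1v by force
    moreover have "snd ` set m1 \<subseteq> P" using ms(1) set_take_subset[of 2 ms] unfolding m1_def by fastforce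
    ultimately show "c1 v \<in> P" "c1 v \<notin> D" using c by (auto simp: D_def)
  qed
  have DP: "D \<subseteq> P" by (auto simp: D_def)
  have apA: "apart a b c (A @ m1)" "apart a x c (A @ m1)" "apart b x c (A @ m1)"
    using c d a1 b1 x1 by (auto simp: apart_append A_def apart_notin nm)
  have apv: "apart v y c (A @ m1)" if y: "y \<in> {a, b, x}" for y
  proof -
    have "apart v y c A" using y c d a1 b1 x1 by (auto simp: A_def D_def)
    moreover have "apart y v (recolor A c) m1"
    proof (rule apart_const)
      show "y \<notin> fst ` set m1" using y d by (intro nm) auto
      have yD: "recolor A c y \<in> D" using y d a1 b1 x1 by (auto simp: A_def)
      moreover have "recolor A c v = c v" using d by (auto simp: A_def)
      ultimately show "recolor A c v \<noteq> recolor A c y" by (auto simp: D_def)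
      show "k \<noteq> recolor A c y" if "(v, k) \<in> set m1" for k using yD that by (force simp: D_def)
    qed
    ultimately show ?thesis by (simp add: apart_append apart_sym)
  qed
  have nA: "num_moves (A @ m1) y \<le> 1" if "y \<in> {a, b, x}" for y
    using that d by (auto simp: A_def num_moves_eq_0 nm)
  have fin: "recolor ms c v = recolor m2 c1 v"
    using recolor_cong[of c1 v "recolor m1 c" m2] c1v by (simp add: msm)
  \<comment> \<open>\<open>p\<close> is the vertex whose color may be hit by the remaining move of
    \<open>v\<close>; \<open>q\<close> and \<open>r\<close> are out of its way. The case distinction
    below decides which of \<open>a\<close>, \<open>b\<close>, \<open>x\<close> takes the part of
    \<open>p\<close>.\<close>
  have finish: "\<exists>T. set T \<subseteq> {a, b, x, v} \<times> P \<and> moves_of {v} T = m2 \<and>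
      (\<forall>s\<in>{a, b, x, v}. \<forall>t\<in>{a, b, x, v}. s \<noteq> t \<longrightarrow> apart s t c1 T) \<and>
      recolor T c1 p = p' \<and> recolor T c1 q = q' \<and> recolor T c1 r = r' \<and> (\<forall>s\<in>{a, b, x}. num_moves T s \<le> 2)"
    if pqr: "{p, q, r} = {a, b, x}" "distinct [p, q, r]" and e: "p' \<in> P" "q' \<in> P" "r' \<in> P" "distinct [p', q', r', recolor m2 c1 v]"
      and qr: "\<And>k. (v, k) \<in> set m2 \<Longrightarrow> k \<noteq> c1 q \<and> k \<noteq> c1 r" for p q r p' q' r'
  proof -
    have v: "v \<notin> {p, q, r}" "v \<noteq> p" "v \<noteq> q" "v \<noteq> r" using pqr d by auto
    have c1D: "c1 p \<in> D" "c1 q \<in> D" "c1 r \<in> D" "distinct [c1 p, c1 q, c1 r]"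
    proof -
      have inj: "inj_on c1 {a, b, x}" and D1: "\<And>y. y \<in> {a, b, x} \<Longrightarrow> c1 y \<in> D"
        using a1 b1 x1 c1 by auto
      have mem: "p \<in> {a, b, x}" "q \<in> {a, b, x}" "r \<in> {a, b, x}" using pqr(1) by blast+
      show "c1 p \<in> D" "c1 q \<in> D" "c1 r \<in> D" using mem[THEN D1] .
      show "distinct [c1 p, c1 q, c1 r]"
        using pqr(2) inj_on_eq_iff[OF inj mem(1,2)] inj_on_eq_iff[OF inj mem(1,3)] inj_on_eq_iff[OF inj mem(2,3)]
        by simp
    qed
    \<comment> \<open>At most four colors are excluded: those of \<open>q\<close>, \<open>r\<close>
      and \<open>v\<close>, and the one that \<open>v\<close> is about to take.\<close>
    obtain B where B: "set B \<subseteq> {p} \<times> P" "length B \<le> 1" "\<And>k. (v, k) \<in> set m2 \<Longrightarrow> k \<noteq> recolor B c1 p"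
        "recolor B c1 p \<in> P" "recolor B c1 p \<notin> {c1 q, c1 r, c1 v}" "apart p q c1 B" "apart p r c1 B" "apart p v c1 B"
    proof -
      have "card (insert (c1 v) (snd ` set m2 \<union> {c1 q, c1 r})) \<le> Suc (card (snd ` set m2) + card {c1 q, c1 r})"
        using card_Un_le[of "snd ` set m2" "{c1 q, c1 r}"] by (simp add: card_insert_if)
      also have "card (snd ` set m2) \<le> 1"
        using card_image_le[of "set m2" snd] card_length[of m2] ms(2) by (simp add: m2_def)
      also have "card {c1 q, c1 r} \<le> 2" by (simp add: card_insert_if)
      finally have "card (insert (c1 v) (snd ` set m2 \<union> {c1 q, c1 r})) < card P" using P by simp
      from avoid_color[OF P(1) _ this] obtain k where k: "k \<in> P" "k \<notin> insert (c1 v) (snd ` set m2 \<union> {c1 q, c1 r})"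
        by auto
      show thesis
        by (rule that[of "[(p, k)]"]) (use k c1D v c1vD pqr(2) in \<open>force+\<close>)
    qed
    define c2 where "c2 = recolor (B @ m2) c1"
    have fB: "fst ` set B \<subseteq> {p}" using B(1) by auto
    have nB: "y \<notin> fst ` set B" if "y \<noteq> p" for y using fB that by auto
    have Bv: "recolor B c1 v = c1 v" "recolor B c1 q = c1 q" "recolor B c1 r = c1 r"
      using v pqr(2) by (auto simp: recolor_notin nB)
    have c2: "c2 p = recolor B c1 p" "c2 q = c1 q" "c2 r = c1 r" "c2 v = recolor m2 c1 v"
      using Bv v recolor_cong[of "recolor B c1" v c1 m2] by (simp_all add: c2_def recolor_notin nm)
    have ap1: "apart p q c1 (B @ m2)" "apart p r c1 (B @ m2)" "apart q r c1 (B @ m2)"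
      using B(5-7) v c1D pqr(2) Bv by (auto simp: apart_append apart_notin nm nB)
    have ap2: "apart v y c1 (B @ m2)" if y: "y \<in> {p, q, r}" for y
    proof -
      have "apart y v c1 B" using B(8) y v c1D c1vD pqr(2) by (auto simp: apart_notin nB)
      moreover have "apart y v (recolor B c1) m2"
      proof (rule apart_const)
        show "y \<notin> fst ` set m2" using y v by (intro nm) auto
        show "recolor B c1 v \<noteq> recolor B c1 y" using Bv B(5) y c1D c1vD by auto
        show "k \<noteq> recolor B c1 y" if "(v, k) \<in> set m2" for k using that B(3) qr[OF that] Bv y by auto
      qed
      ultimately show ?thesis by (simp add: apart_append apart_sym)
    qed
    have c2v: "c2 v \<in> P"
    proof -
      have "set m2 \<subseteq> {v} \<times> P" using ms(1) set_drop_subset[of 2 ms] unfolding m2_def by blast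
      then show ?thesis using recolor_in[of m2 c1 v] c1vD by (auto simp: c2)
    qed
    have vne: "c2 v \<noteq> c2 y" if "y \<in> {p, q, r}" for y
      using apart_end[OF ap2[OF that]] by (simp add: c2_def)
    \<comment> \<open>With \<open>v\<close> at rest its color is set aside, which leaves the five
      colors needed to rearrange the triangle. \<open>p\<close> has just moved and takes the place
      that is limited to one move.\<close>
    define Q where "Q = P - {c2 v}"
    have Q: "finite Q" "5 \<le> card Q" using P c2v by (auto simp: Q_def)
    have c2Q: "c2 p \<in> Q" "c2 q \<in> Q" "c2 r \<in> Q" "distinct [c2 p, c2 q, c2 r]"
      using vne[of p] vne[of q] vne[of r] B(4,5) c1D DP by (auto simp: Q_def c2)
    have eQ: "p' \<in> Q" "q' \<in> Q" "r' \<in> Q" "distinct [p', q', r']" using e by (auto simp: Q_def c2)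
    obtain C where C: "set C \<subseteq> {p, q, r} \<times> Q" "apart p q c2 C" "apart p r c2 C" "apart q r c2 C"
        "recolor C c2 p = p'" "recolor C c2 q = q'" "recolor C c2 r = r'"
        "num_moves C p \<le> 1" "num_moves C q \<le> 2" "num_moves C r \<le> 2"
      using rearrange_triangle[OF Q pqr(2) c2Q eQ] by auto
    have apC: "apart v y c2 C" if "y \<in> {p, q, r}" for y
    proof (rule apart_const)
      show "v \<notin> fst ` set C" using C(1) v by auto
      show "c2 y \<noteq> c2 v" using that c2Q by (auto simp: Q_def)
      show "k \<noteq> c2 v" if "(y, k) \<in> set C" for k using C(1) that by (auto simp: Q_def)
    qed
    have "moves_of {v} (B @ m2 @ C) = m2"
    proof -
      have "moves_of {v} B = []" using fB v(2) by (intro moves_of_none) auto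
      moreover have "moves_of {v} C = []" using C(1) v by (intro moves_of_none) auto
      ultimately show ?thesis using fm1 by (simp add: moves_of_all)
    qed
    moreover have nBm: "num_moves (B @ m2) p \<le> 1" "num_moves (B @ m2) q = 0" "num_moves (B @ m2) r = 0"
      using v pqr(2) B(2) num_moves_le_length[of B p] by (auto simp: num_moves_eq_0 nm nB)
    moreover have "set (B @ m2 @ C) \<subseteq> {a, b, x, v} \<times> P"
    proof -
      have "set m2 \<subseteq> {v} \<times> P" using ms(1) set_drop_subset[of 2 ms] unfolding m2_def by blast
      moreover have "{a, b, x, v} = {p, q, r, v}" using pqr(1) by blast
      ultimately show ?thesis using B(1) C(1) by (auto simp: Q_def)
    qed
    moreover have ap: "apart s t c1 (B @ m2 @ C) \<longleftrightarrow> apart s t c1 (B @ m2) \<and> apart s t c2 C" for s t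
      by (simp add: apart_append c2_def)
    moreover have "recolor (B @ m2 @ C) c1 = recolor C c2" by (simp add: c2_def)
    moreover have "apart s t c1 (B @ m2 @ C)" if "s \<in> {a, b, x, v}" "t \<in> {a, b, x, v}" "s \<noteq> t" for s t
    proof -
      let ?T = "B @ m2 @ C"
      have base: "apart p q c1 ?T" "apart p r c1 ?T" "apart q r c1 ?T" "apart v p c1 ?T" "apart v q c1 ?T" "apart v r c1 ?T"
        using C(2-4) apC[of p] apC[of q] apC[of r] ap1 ap2[of p] ap2[of q] ap2[of r] by (simp_all add: ap)
      note base' = base[THEN iffD1[OF apart_sym]]
      have "s \<in> {p, q, r, v}" "t \<in> {p, q, r, v}" using that(1,2) pqr(1) by blast+
      with that(3) show ?thesis using base base' by (elim insertE emptyE) simp_all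
    qed
    moreover have "num_moves (B @ m2 @ C) s \<le> 2" if "s \<in> {a, b, x}" for s
    proof -
      have "s \<in> {p, q, r}" using that pqr(1) by simp
      then show ?thesis using C(8-10) nBm by (elim insertE emptyE) simp_all
    qed
    ultimately show ?thesis
      using C(5-7) by (intro exI[of _ "B @ m2 @ C"]) simp
  qed
  \<comment> \<open>At most one move of \<open>v\<close> remains, so at most one of three distinct
    colors is hit. If no move remains, \<open>k0\<close> is arbitrary and any choice of
    \<open>p\<close> works.\<close>
  have "length m2 \<le> 1" using ms(2) by (simp add: m2_def)
  then obtain k0 where k0: "\<And>k. (v, k) \<in> set m2 \<Longrightarrow> k = k0"
    by (cases m2) auto
  note e' = e(4)[unfolded fin]
  have d1: "a1 \<noteq> b1" "a1 \<noteq> x1" "b1 \<noteq> x1" using a1 b1 x1 by auto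
  have "\<exists>T. set T \<subseteq> {a, b, x, v} \<times> P \<and> moves_of {v} T = m2 \<and>
      (\<forall>s\<in>{a, b, x, v}. \<forall>t\<in>{a, b, x, v}. s \<noteq> t \<longrightarrow> apart s t c1 T) \<and>
      recolor T c1 a = a' \<and> recolor T c1 b = b' \<and> recolor T c1 x = x' \<and> (\<forall>s\<in>{a, b, x}. num_moves T s \<le> 2)"
  proof (cases "k0 = b1")
    case True
    have *: "{b, a, x} = {a, b, x}" "distinct [b, a, x]" "distinct [b', a', x', recolor m2 c1 v]"
      "\<And>k. (v, k) \<in> set m2 \<Longrightarrow> k \<noteq> c1 a \<and> k \<noteq> c1 x"
      using d e' d1 k0 True by (auto simp: c1)
    from finish[OF *(1,2) e(2,1,3) *(3,4)] show ?thesis by blast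
  next
    case nb: False
    show ?thesis
    proof (cases "k0 = x1")
      case True
      have *: "{x, a, b} = {a, b, x}" "distinct [x, a, b]" "distinct [x', a', b', recolor m2 c1 v]"
        "\<And>k. (v, k) \<in> set m2 \<Longrightarrow> k \<noteq> c1 a \<and> k \<noteq> c1 b"
        using d e' d1 k0 True by (auto simp: c1)
      from finish[OF *(1,2) e(3,1,2) *(3,4)] show ?thesis by blast
    next
      case False
      have *: "distinct [a, b, x]" "\<And>k. (v, k) \<in> set m2 \<Longrightarrow> k \<noteq> c1 b \<and> k \<noteq> c1 x"
        using d k0 False nb by (auto simp: c1)
      from finish[OF refl *(1) e(1,2,3) e' *(2)] show ?thesis .
    qed
  qed
  then obtain T where T: "set T \<subseteq> {a, b, x, v} \<times> P" "moves_of {v} T = m2"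
      "\<And>s t. s \<in> {a, b, x, v} \<Longrightarrow> t \<in> {a, b, x, v} \<Longrightarrow> s \<noteq> t \<Longrightarrow> apart s t c1 T"
      "recolor T c1 a = a'" "recolor T c1 b = b'" "recolor T c1 x = x'"
      "\<And>s. s \<in> {a, b, x} \<Longrightarrow> num_moves T s \<le> 2"
    by blast
  have "set m1 \<subseteq> {v} \<times> P" using ms(1) set_take_subset[of 2 ms] unfolding m1_def by blast
  then have "set ((A @ m1) @ T) \<subseteq> {a, b, x, v} \<times> P"
    using T(1) a1 b1 x1 DP by (auto simp: A_def)
  moreover have "moves_of {v} ((A @ m1) @ T) = ms"
    using d T(2) fm1 by (auto simp: A_def moves_of_all msm)
  moreover have "apart s t c ((A @ m1) @ T) \<longleftrightarrow> apart s t c (A @ m1) \<and> apart s t c1 T" for s t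
    unfolding apart_append c1_def by blast
  moreover have "recolor ((A @ m1) @ T) c = recolor T c1" by (simp add: c1_def)
  moreover have "v \<noteq> a" "v \<noteq> b" "v \<noteq> x" using d by auto
  ultimately show ?thesis
    using apA apv[of a] apv[of b] apv[of x] nA[of a] nA[of b] nA[of x] T(3)[of a b] T(3)[of a x] T(3)[of b x]
      T(3)[of v a] T(3)[of v b] T(3)[of v x] T(4-6) T(7)[of a] T(7)[of b] T(7)[of x] d
    by (intro exI[of _ "(A @ m1) @ T"]) simp
qed

section \<open>The induction for six colors\<close>

lemma proper_restrict:
  "proper V R P c \<Longrightarrow> proper (V - X) (R \<inter> (V - X) \<times> (V - X)) P c"
  by (auto simp: proper_def)

lemma moves_of_subset: "set (moves_of X ms) \<subseteq> set ms"
  by (auto simp: moves_of_def)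

lemma recolor_six_colors:
  assumes P: "finite P" "6 \<le> card P"
  shows "fgraph V R \<Longrightarrow> \<not> has_K23 R \<Longrightarrow> proper V R P \<alpha> \<Longrightarrow> proper V R P \<beta> \<Longrightarrow>
    \<exists>ms. set ms \<subseteq> V \<times> P \<and> (\<forall>(x, y)\<in>R. apart x y \<alpha> ms) \<and>
      (\<forall>x\<in>V. recolor ms \<alpha> x = \<beta> x \<and> num_moves ms x \<le> 3)"
proof (induction "card V" arbitrary: V R rule: less_induct)
  case less
  note G = less.prems(1) and \<alpha> = less.prems(3) and \<beta> = less.prems(4)
  have IH: "\<exists>ms. set ms \<subseteq> (V - X) \<times> P \<and> (\<forall>(x, y)\<in>R. x \<notin> X \<longrightarrow> y \<notin> X \<longrightarrow> apart x y \<alpha> ms) \<and>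
      (\<forall>x\<in>V - X. recolor ms \<alpha> x = \<beta> x \<and> num_moves ms x \<le> 3)" if X: "X \<subseteq> V" "X \<noteq> {}" for X
  proof -
    let ?R = "R \<inter> (V - X) \<times> (V - X)"
    have "card (V - X) < card V" using X fgraphD(1)[OF G] by (intro psubset_card_mono) auto
    moreover have "\<not> has_K23 ?R" using less.prems(2) has_K23_mono[of ?R R] by blast
    ultimately obtain ms where "set ms \<subseteq> (V - X) \<times> P" "\<forall>(x, y)\<in>?R. apart x y \<alpha> ms"
        "\<forall>x\<in>V - X. recolor ms \<alpha> x = \<beta> x \<and> num_moves ms x \<le> 3"
      using less.hyps[of "V - X" ?R] fgraph_restrict[OF G] proper_restrict[OF \<alpha>] proper_restrict[OF \<beta>] by blast
    then show ?thesis using fgraphD(2)[OF G] by (intro exI[of _ ms]) auto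
  qed
  show ?case
  proof (cases "V = {}")
    case True
    with fgraphD(2)[OF G] show ?thesis by (intro exI[of _ "[]"]) auto
  next
    case False
    from G False less.prems(2) show ?thesis
    proof (cases rule: K23_free_cases)
      case (low x)
      let ?N = "R `` {x}"
      have N: "?N \<subseteq> V - {x}" "finite ?N" "x \<notin> ?N"
        using fgraphD[OF G] by (auto intro: rev_finite_subset[of V])
      obtain ms where ms: "set ms \<subseteq> (V - {x}) \<times> P" "\<forall>(y, z)\<in>R. y \<notin> {x} \<longrightarrow> z \<notin> {x} \<longrightarrow> apart y z \<alpha> ms"
          "\<forall>y\<in>V - {x}. recolor ms \<alpha> y = \<beta> y \<and> num_moves ms y \<le> 3"
        using IH[of "{x}"] low by blast
      \<comment> \<open>Two blocks of three moves: two neighbours and three upcoming colors exclude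
        five of six colors, and two evasions plus the final move make three.\<close>
      have "length (moves_of ?N ms) \<le> 3 * 2"
        using length_moves_of_le[OF low(2) N(2), of ms 3] N(1) ms(3) by auto
      moreover have "\<beta> x \<noteq> recolor (moves_of ?N ms) \<alpha> y" if y: "y \<in> ?N" for y
      proof -
        have "recolor (moves_of ?N ms) \<alpha> y = \<beta> y" using ms(3) N(1) y by (auto simp: recolor_moves_of[OF y])
        then show ?thesis using y \<beta> by (auto simp: proper_def)
      qed
      moreover have "\<alpha> x \<noteq> \<alpha> y" if "y \<in> ?N" for y using that \<alpha> by (auto simp: proper_def)
      moreover have "\<beta> x \<in> P" using \<beta> low(1) by (auto simp: proper_def)
      moreover have "card ?N + 3 < card P" using low P by simp
      ultimately obtain T where T: "fst ` set T \<subseteq> insert x ?N" "moves_of ?N T = moves_of ?N ms"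
          "\<forall>y\<in>?N. apart x y \<alpha> T" "num_moves T x \<le> Suc 2" "\<forall>q. (x, q) \<in> set T \<longrightarrow> q \<in> P" "recolor T \<alpha> x = \<beta> x"
        using extend_vertex[OF P(1) _ N(2,3) moves_of_simps(5), of 3 ms 2 \<alpha> "\<beta> x"] by auto
      obtain zs where zs: "set zs \<subseteq> set ms \<union> set T" "\<forall>(x, y)\<in>R. apart x y \<alpha> zs"
          "\<forall>y\<in>V - {x}. recolor zs \<alpha> y = recolor ms \<alpha> y \<and> num_moves zs y = num_moves ms y"
          "\<forall>y\<in>{x}. recolor zs \<alpha> y = recolor T \<alpha> y \<and> num_moves zs y = num_moves T y"
      proof -
        have f: "fst ` set ms \<subseteq> V - {x}" "fst ` set T \<subseteq> ?N \<union> {x}" using ms(1) T(1) by auto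
        have h: "\<forall>(y, z)\<in>R. y \<in> {x} \<longrightarrow> z \<in> ?N \<union> {x} \<and> apart y z \<alpha> T" using T(3) by auto
        have "{x} \<subseteq> V" using low(1) by simp
        from extend_schedule[OF G this N(1) f(1) ms(2) f(2) T(2) h] show thesis
          by (elim exE conjE) (rule that; assumption)
      qed
      have "set T \<subseteq> V \<times> P"
      proof
        fix m assume m: "m \<in> set T"
        then have "fst m = x \<or> m \<in> set (moves_of ?N T)" using T(1) by auto
        then show "m \<in> V \<times> P"
          using m T(2,5) ms(1) moves_of_subset[of ?N ms] low(1) by (cases m) auto
      qed
      with zs(1) ms(1) have "set zs \<subseteq> V \<times> P" by auto
      moreover have "recolor zs \<alpha> y = \<beta> y \<and> num_moves zs y \<le> 3" if "y \<in> V" for y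
        using that zs(3,4) ms(3) T(4,6) by (cases "y = x") auto
      ultimately show ?thesis using zs(2) by (intro exI[of _ zs]) simp
    next
      case (leaf a b x v)
      let ?X = "{a, b, x}"
      have X: "?X \<subseteq> V" "{v} \<subseteq> V - ?X" using leaf by auto
      obtain ms where ms: "set ms \<subseteq> (V - ?X) \<times> P" "\<forall>(y, z)\<in>R. y \<notin> ?X \<longrightarrow> z \<notin> ?X \<longrightarrow> apart y z \<alpha> ms"
          "\<forall>y\<in>V - ?X. recolor ms \<alpha> y = \<beta> y \<and> num_moves ms y \<le> 3"
        using IH[of ?X] X by blast
      have E: "(a, b) \<in> R" "(a, x) \<in> R" "(a, v) \<in> R" "(b, x) \<in> R" "(b, v) \<in> R" "(x, v) \<in> R"
        using leaf(3-5) by blast+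
      have c: "\<alpha> a \<in> P" "\<alpha> b \<in> P" "\<alpha> x \<in> P" "\<alpha> v \<in> P" "distinct [\<alpha> a, \<alpha> b, \<alpha> x, \<alpha> v]"
        using \<alpha> E X by (auto simp: proper_def)
      have "\<beta> v = recolor (moves_of {v} ms) \<alpha> v" using ms(3) X by (auto simp: recolor_moves_of)
      then have e: "\<beta> a \<in> P" "\<beta> b \<in> P" "\<beta> x \<in> P" "distinct [\<beta> a, \<beta> b, \<beta> x, recolor (moves_of {v} ms) \<alpha> v]"
        using \<beta> E X by (auto simp: proper_def)
      have len: "length (moves_of {v} ms) \<le> 3" using ms(3) X by (auto simp: num_moves_def)
      have sub: "set (moves_of {v} ms) \<subseteq> {v} \<times> P" using ms(1) by auto
      obtain T where T: "set T \<subseteq> {a, b, x, v} \<times> P" "moves_of {v} T = moves_of {v} ms"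
          "apart a b \<alpha> T" "apart a x \<alpha> T" "apart b x \<alpha> T" "apart v a \<alpha> T" "apart v b \<alpha> T" "apart v x \<alpha> T"
          "recolor T \<alpha> a = \<beta> a" "recolor T \<alpha> b = \<beta> b" "recolor T \<alpha> x = \<beta> x"
          "num_moves T a \<le> 3" "num_moves T b \<le> 3" "num_moves T x \<le> 3"
        using extend_K4_six_colors[OF P leaf(1) sub len c e] by (elim exE conjE) (rule that; assumption)
      have T3: "\<forall>(y, z)\<in>R. y \<in> ?X \<longrightarrow> z \<in> {v} \<union> ?X \<and> apart y z \<alpha> T"
      proof (intro ballI case_prodI2 impI)
        fix p y z assume p: "p \<in> R" "p = (y, z)" "y \<in> ?X"
        then have z: "z \<in> R `` {y}" by auto
        note T' = T(3-8) T(3-8)[THEN iffD1[OF apart_sym]]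
        from p(3) show "z \<in> {v} \<union> ?X \<and> apart y z \<alpha> T"
        proof (elim insertE emptyE)
          assume "y = a" with z leaf(3) T' show ?thesis by auto
        next
          assume "y = b" with z leaf(4) T' show ?thesis by auto
        next
          assume "y = x" with z leaf(5) T' show ?thesis by auto
        qed
      qed
      obtain zs where zs: "set zs \<subseteq> set ms \<union> set T" "\<forall>(x, y)\<in>R. apart x y \<alpha> zs"
          "\<forall>y\<in>V - ?X. recolor zs \<alpha> y = recolor ms \<alpha> y \<and> num_moves zs y = num_moves ms y"
          "\<forall>y\<in>?X. recolor zs \<alpha> y = recolor T \<alpha> y \<and> num_moves zs y = num_moves T y"
      proof -
        have f: "fst ` set ms \<subseteq> V - ?X" "fst ` set T \<subseteq> {v} \<union> ?X" using ms(1) T(1) by auto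
        from extend_schedule[OF G X f(1) ms(2) f(2) T(2) T3] show thesis
          by (elim exE conjE) (rule that; assumption)
      qed
      have "set T \<subseteq> V \<times> P" using T(1) X by auto
      with zs(1) ms(1) have "set zs \<subseteq> V \<times> P" by auto
      moreover have "recolor zs \<alpha> y = \<beta> y \<and> num_moves zs y \<le> 3" if "y \<in> V" for y
        using that zs(3,4) ms(3) T by (cases "y \<in> ?X") auto
      ultimately show ?thesis using zs(2) by (intro exI[of _ zs]) simp
    qed
  qed
qed

section \<open>Four colors and a spare one\<close>

text \<open>Colors as a finite datatype, on which searches and tables can be evaluated. Actual
  colors are matched with hues locally, by renamings that may differ from place to place.\<close>

datatype hue = h1 | h2 | h3 | h4 | h5

definition fours :: "hue list" where
  "fours = [h1, h2, h3, h4]"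

definition spare :: "hue \<Rightarrow> hue \<Rightarrow> hue \<Rightarrow> hue" where
  "spare x y z = hd (filter (\<lambda>k. k \<noteq> x \<and> k \<noteq> y \<and> k \<noteq> z) fours)"

lemma spare: "spare x y z \<noteq> x" "spare x y z \<noteq> y" "spare x y z \<noteq> z" "spare x y z \<in> set fours"
  by (cases x; cases y; cases z; simp add: spare_def fours_def)+

text \<open>In a triangle with four colors only one color is free, so a search for moves of the vertices
  colored \<open>q\<close> and \<open>r\<close> has two branches besides following the next prescribed color of the third vertex.\<close>

fun triangle_search :: "nat \<Rightarrow> nat \<Rightarrow> hue \<Rightarrow> hue \<Rightarrow> hue \<Rightarrow> hue list \<Rightarrow> hue \<Rightarrow> hue \<Rightarrow> bool" where
  "triangle_search i j p q r es q' r' \<longleftrightarrow>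
     (case es of [] \<Rightarrow> q = q' \<and> r = r'
      | e # es' \<Rightarrow> if e = q \<or> e = r then False else triangle_search i j e q r es' q' r') \<or>
     (case i of 0 \<Rightarrow> False | Suc i' \<Rightarrow> triangle_search i' j p (spare p q r) r es q' r') \<or>
     (case j of 0 \<Rightarrow> False | Suc j' \<Rightarrow> triangle_search i j' p q (spare p q r) es q' r')"

declare triangle_search.simps [simp del]

text \<open>By symmetry the triangle starts with \<open>h1\<close>, \<open>h2\<close>,
  \<open>h3\<close>. The list \<open>es\<close> of hues that the third vertex is going to take runs
  over all lists of length at most 3, repetitions included, and both targets are arbitrary.\<close>

lemma triangle_search_all:
  "list_all (\<lambda>es. list_all (\<lambda>q. list_all (\<lambda>r. q = r \<or> last (h1 # es) = q \<or> last (h1 # es) = r \<or>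
     triangle_search (Suc (Suc (Suc 0))) (Suc (Suc (Suc 0))) h1 h2 h3 es q r) fours) fours)
     (concat (map (\<lambda>n. List.n_lists n fours) [0, Suc 0, Suc (Suc 0), Suc (Suc (Suc 0))]))"
  by code_simp

lemma triangle_search_sound:
  assumes "triangle_search i j (c v) (c b) (c x) es q' r'" "distinct [v, b, x]" "distinct [c v, c b, c x]"
  shows "\<exists>T. set T \<subseteq> {v} \<times> set es \<union> {b, x} \<times> set fours \<and> moves_of {v} T = map (Pair v) es \<and>
    apart v b c T \<and> apart v x c T \<and> apart b x c T \<and> recolor T c b = q' \<and> recolor T c x = r' \<and>
    num_moves T b \<le> i \<and> num_moves T x \<le> j"
  using assms(1,3)
proof (induction "i + j + length es" arbitrary: i j es c rule: less_induct)
  case less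
  note d = \<open>distinct [v, b, x]\<close>
  from less.prems(1)[THEN triangle_search.simps[THEN iffD1]] consider
    (stop) "es = []" "c b = q'" "c x = r'"
  | (event) e es' where "es = e # es'" "e \<noteq> c b" "e \<noteq> c x" "triangle_search i j e (c b) (c x) es' q' r'"
  | (left) i' where "i = Suc i'" "triangle_search i' j (c v) (spare (c v) (c b) (c x)) (c x) es q' r'"
  | (right) j' where "j = Suc j'" "triangle_search i j' (c v) (c b) (spare (c v) (c b) (c x)) es q' r'"
    by (auto split: list.splits nat.splits if_splits)
  then show ?case
  proof cases
    case stop
    with less.prems(2) show ?thesis by (intro exI[of _ "[]"]) auto
  next
    case event
    let ?c = "c(v := e)"
    have "triangle_search i j (?c v) (?c b) (?c x) es' q' r'" using event d by auto
    with less.hyps[of i j es' ?c] event d less.prems(2) obtain T where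
      "set T \<subseteq> {v} \<times> set es' \<union> {b, x} \<times> set fours" "moves_of {v} T = map (Pair v) es'"
      "apart v b ?c T" "apart v x ?c T" "apart b x ?c T" "recolor T ?c b = q'" "recolor T ?c x = r'"
      "num_moves T b \<le> i" "num_moves T x \<le> j" by auto
    with event d less.prems(2) show ?thesis by (intro exI[of _ "(v, e) # T"]) auto
  next
    case left
    let ?s = "spare (c v) (c b) (c x)"
    let ?c = "c(b := ?s)"
    have "triangle_search i' j (?c v) (?c b) (?c x) es q' r'" using left d by auto
    with less.hyps[of i' j es ?c] left d less.prems(2) spare[of "c v" "c b" "c x"] obtain T where
      "set T \<subseteq> {v} \<times> set es \<union> {b, x} \<times> set fours" "moves_of {v} T = map (Pair v) es"
      "apart v b ?c T" "apart v x ?c T" "apart b x ?c T" "recolor T ?c b = q'" "recolor T ?c x = r'"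
      "num_moves T b \<le> i'" "num_moves T x \<le> j" by auto
    with left d less.prems(2) spare[of "c v" "c b" "c x"] show ?thesis
      by (intro exI[of _ "(b, ?s) # T"]) auto
  next
    case right
    let ?s = "spare (c v) (c b) (c x)"
    let ?c = "c(x := ?s)"
    have "triangle_search i j' (?c v) (?c b) (?c x) es q' r'" using right d by auto
    with less.hyps[of i j' es ?c] right d less.prems(2) spare[of "c v" "c b" "c x"] obtain T where
      "set T \<subseteq> {v} \<times> set es \<union> {b, x} \<times> set fours" "moves_of {v} T = map (Pair v) es"
      "apart v b ?c T" "apart v x ?c T" "apart b x ?c T" "recolor T ?c b = q'" "recolor T ?c x = r'"
      "num_moves T b \<le> i" "num_moves T x \<le> j'" by auto
    with right d less.prems(2) spare[of "c v" "c b" "c x"] show ?thesis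
      by (intro exI[of _ "(x, ?s) # T"]) auto
  qed
qed

lemma recolor_last: "fst ` set ms \<subseteq> {v} \<Longrightarrow> recolor ms c v = last (c v # map snd ms)"
  by (induction ms arbitrary: c) auto

text \<open>Colors are renamed so that \<open>v\<close>, \<open>b\<close>, \<open>x\<close> start
  with \<open>h1\<close>, \<open>h2\<close>, \<open>h3\<close>; the exhaustive search applies, and
  the schedule it finds is renamed back. The bound 3 for \<open>v\<close> is reproduced for
  \<open>b\<close> and \<open>x\<close>.\<close>

lemma extend_triangle_four_colors:
  assumes P: "finite P" "card P = 4" and d: "distinct [b, x, v]"
    and ms: "set ms \<subseteq> {v} \<times> P" "length ms \<le> 3"
    and c: "c b \<in> P" "c x \<in> P" "c v \<in> P" "distinct [c b, c x, c v]"
    and e: "b' \<in> P" "x' \<in> P" "distinct [b', x', recolor ms c v]"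
  shows "\<exists>T. set T \<subseteq> {b, x, v} \<times> P \<and> moves_of {v} T = ms \<and>
    apart b x c T \<and> apart v b c T \<and> apart v x c T \<and>
    recolor T c b = b' \<and> recolor T c x = x' \<and> num_moves T b \<le> 3 \<and> num_moves T x \<le> 3"
proof -
  have "card {c b, c x, c v} < card P" using P c(4) by simp
  from avoid_color[OF P(1) _ this] obtain k where k: "k \<in> P" "k \<notin> {c b, c x, c v}" by auto
  have PE: "{c v, c b, c x, k} = P"
    using P c k by (intro card_seteq) auto
  \<comment> \<open>\<open>h4\<close> stands for the one color absent from the triangle. The same
    value at \<open>h5\<close> is a mere default; injectivity is claimed on \<open>fours\<close>
    only.\<close>
  define s where "s h = (case h of h1 \<Rightarrow> c v | h2 \<Rightarrow> c b | h3 \<Rightarrow> c x | _ \<Rightarrow> k)" for h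
  have inj: "inj_on s (set fours)" using c(4) k by (auto simp: s_def fours_def)
  have img: "s ` set fours = P" using PE by (auto simp: s_def fours_def)
  define t where "t = inv_into (set fours) s"
  have t: "t p \<in> set fours" "s (t p) = p" if "p \<in> P" for p
    using that img by (auto simp: t_def inv_into_into f_inv_into_f)
  have st: "t (s h) = h" if "h \<in> set fours" for h using inj that by (simp add: t_def)
  have t123: "t (c v) = h1" "t (c b) = h2" "t (c x) = h3"
    using st[of h1] st[of h2] st[of h3] by (simp_all add: s_def fours_def)
  define es where "es = map (t \<circ> snd) ms"
  have Pms: "snd ` set ms \<subseteq> P" using ms(1) by auto
  have es4: "set es \<subseteq> set fours" using Pms t by (auto simp: es_def)
  let ?N = "[0, Suc 0, Suc (Suc 0), Suc (Suc (Suc 0))]"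
  have "length es \<in> set ?N"
  proof -
    have "length es \<le> 3" using ms(2) by (simp add: es_def)
    then show ?thesis by (auto simp: le_Suc_eq numeral_3_eq_3)
  qed
  moreover have "es \<in> set (List.n_lists (length es) fours)" using es4 by (simp only: set_n_lists) simp
  ultimately have "es \<in> set (concat (map (\<lambda>n. List.n_lists n fours) ?N))"
    unfolding set_concat set_map by blast
  with triangle_search_all have all: "\<forall>q\<in>set fours. \<forall>r\<in>set fours. q = r \<or> last (h1 # es) = q \<or> last (h1 # es) = r \<or>
      triangle_search (Suc (Suc (Suc 0))) (Suc (Suc (Suc 0))) h1 h2 h3 es q r"
    unfolding list_all_iff by (rule bspec)
  have "last (h1 # es) = t (recolor ms c v)"
  proof -
    have "recolor ms c v = last (c v # map snd ms)" using ms(1) by (intro recolor_last) auto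
    moreover have "t (last (c v # map snd ms)) = last (map t (c v # map snd ms))" by (simp add: last_map)
    ultimately show ?thesis by (simp add: es_def t123 comp_def)
  qed
  moreover have "recolor ms c v \<in> P" using recolor_in[of ms c v] c(3) Pms by force
  moreover have "t p \<noteq> t q" if "p \<in> P" "q \<in> P" "p \<noteq> q" for p q
    using t(2)[OF that(1)] t(2)[OF that(2)] that(3) by metis
  ultimately have "t b' \<noteq> t x'" "last (h1 # es) \<noteq> t b'" "last (h1 # es) \<noteq> t x'"
    using e by auto
  with bspec[OF bspec[OF all t(1)[OF e(1)]] t(1)[OF e(2)]]
  have search: "triangle_search 3 3 h1 h2 h3 es (t b') (t x')"
    by (simp add: numeral_3_eq_3)
  define \<kappa> where "\<kappa> y = t (c y)" for y
  have "triangle_search 3 3 (\<kappa> v) (\<kappa> b) (\<kappa> x) es (t b') (t x')"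
    using search by (simp add: \<kappa>_def t123)
  moreover have "distinct [v, b, x]" using d by auto
  moreover have "distinct [\<kappa> v, \<kappa> b, \<kappa> x]" by (simp add: \<kappa>_def t123)
  ultimately obtain T where T: "set T \<subseteq> {v} \<times> set es \<union> {b, x} \<times> set fours" "moves_of {v} T = map (Pair v) es"
      "apart v b \<kappa> T" "apart v x \<kappa> T" "apart b x \<kappa> T" "recolor T \<kappa> b = t b'" "recolor T \<kappa> x = t x'"
      "num_moves T b \<le> 3" "num_moves T x \<le> 3"
    using triangle_search_sound[of 3 3 \<kappa> v b x es "t b'" "t x'"] by auto
  let ?T = "map (map_prod (\<lambda>y. y) s) T"
  have TB: "set T \<subseteq> {b, x, v} \<times> set fours" using T(1) es4 by blast
  have Tf: "fst ` set T \<subseteq> {v, b, x}" "snd ` set T \<subseteq> set fours" using TB by auto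
  have sk: "c y = s (\<kappa> y)" "\<kappa> y \<in> set fours" if "y \<in> {v, b, x}" for y
    using that c by (auto simp: \<kappa>_def t)
  have ap: "apart y z c ?T \<longleftrightarrow> apart y z \<kappa> T" if "y \<in> {v, b, x}" "z \<in> {v, b, x}" for y z
    by (rule apart_map[OF _ inj, where f = "\<lambda>y. y"]) (use that Tf sk in auto)
  have rc: "recolor ?T c y = s (recolor T \<kappa> y)" if "y \<in> {v, b, x}" for y
    by (rule recolor_map[where f = "\<lambda>y. y"]) (use that Tf sk in auto)
  have "moves_of {v} ?T = map (map_prod (\<lambda>y. y) s) (moves_of {v} T)"
    using moves_of_map[of "\<lambda>y. y" "{v, b, x}" T "{v}" s] Tf by simp
  also have "\<dots> = map (\<lambda>m. (v, s (t (snd m)))) ms" by (simp add: T(2) es_def)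
  also have "\<dots> = ms" using ms(1) t(2) by (intro map_idI) auto
  finally have "moves_of {v} ?T = ms" .
  moreover have "num_moves ?T y = num_moves T y" if "y \<in> {v, b, x}" for y
    using num_moves_map[of "\<lambda>y. y" "{v, b, x}" T y s] Tf that by simp
  moreover have "set ?T \<subseteq> {b, x, v} \<times> P"
    using TB img by auto
  ultimately show ?thesis
    using T ap rc e t(2) by (intro exI[of _ ?T]) simp
qed

section \<open>Schedules outside an independent set\<close>

text \<open>Amalgamation in the graph without \<open>I\<close>: edges into \<open>I\<close> impose
  no condition at this stage, so neighbours of \<open>X\<close> in \<open>I\<close> are
  permitted.\<close>

lemma extend_schedule_outside:
  assumes G: "fgraph V R" and I: "I \<subseteq> V" and X: "X \<subseteq> V - I" "N \<subseteq> V - I - X"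
    and nbrs: "\<forall>(y, z)\<in>R. y \<in> X \<longrightarrow> z \<in> N \<union> X \<union> I"
    and ms: "set ms \<subseteq> (V - I - X) \<times> P" "\<forall>(y, z)\<in>R. y \<notin> I \<union> X \<longrightarrow> z \<notin> I \<union> X \<longrightarrow> apart y z c ms"
      "\<forall>y\<in>V - I - X. recolor ms c y = d y \<and> num_moves ms y \<le> b"
    and T: "set T \<subseteq> (N \<union> X) \<times> P" "moves_of N T = moves_of N ms"
      "\<forall>y\<in>X. \<forall>z\<in>N \<union> X. (y, z) \<in> R \<longrightarrow> apart y z c T"
      "\<forall>y\<in>X. recolor T c y = d y \<and> num_moves T y \<le> b"
  shows "\<exists>ms. set ms \<subseteq> (V - I) \<times> P \<and> (\<forall>(y, z)\<in>R. y \<notin> I \<longrightarrow> z \<notin> I \<longrightarrow> apart y z c ms) \<and>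
    (\<forall>y\<in>V - I. recolor ms c y = d y \<and> num_moves ms y \<le> b)"
proof -
  let ?R = "R \<inter> (V - I) \<times> (V - I)"
  have f: "fst ` set ms \<subseteq> V - I - X" "fst ` set T \<subseteq> N \<union> X" using ms(1) T(1) by auto
  have g: "\<forall>(y, z)\<in>?R. y \<notin> X \<longrightarrow> z \<notin> X \<longrightarrow> apart y z c ms" using ms(2) by auto
  have h: "\<forall>(y, z)\<in>?R. y \<in> X \<longrightarrow> z \<in> N \<union> X \<and> apart y z c T" using T(3) nbrs by blast
  obtain zs where zs: "set zs \<subseteq> set ms \<union> set T" "\<forall>(y, z)\<in>?R. apart y z c zs"
      "\<forall>y\<in>V - I - X. recolor zs c y = recolor ms c y \<and> num_moves zs y = num_moves ms y"
      "\<forall>y\<in>X. recolor zs c y = recolor T c y \<and> num_moves zs y = num_moves T y"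
    using extend_schedule[OF fgraph_restrict[OF G] X f(1) g f(2) T(2) h] by (elim exE conjE) (rule that; assumption)
  have "set zs \<subseteq> (V - I) \<times> P" using zs(1) ms(1) T(1) X by blast
  moreover have "\<forall>(y, z)\<in>R. y \<notin> I \<longrightarrow> z \<notin> I \<longrightarrow> apart y z c zs"
    using zs(2) fgraphD(5,6)[OF G] by blast
  moreover have "recolor zs c y = d y \<and> num_moves zs y \<le> b" if "y \<in> V - I" for y
    using that zs(3,4) ms(3) T(4) by (cases "y \<in> X") auto
  ultimately show ?thesis by (intro exI[of _ zs]) simp
qed

text \<open>\<open>I\<close> is chosen along the reductions. A vertex of degree at most 2 joins
  \<open>I\<close> if it has no neighbour there; otherwise at most one neighbour remains outside
  \<open>I\<close>. From a K4 with three private vertices, \<open>I\<close> contains exactly one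
  vertex: \<open>v\<close> if it is already chosen, else \<open>a\<close>. What remains is a
  triangle, either free or hanging at \<open>v\<close>.\<close>

lemma recolor_around_independent:
  assumes P: "finite P" "card P = 4"
  shows "fgraph V R \<Longrightarrow> \<not> has_K23 R \<Longrightarrow> proper V R P c \<Longrightarrow> proper V R P d \<Longrightarrow>
    \<exists>I ms. I \<subseteq> V \<and> (\<forall>(y, z)\<in>R. \<not> (y \<in> I \<and> z \<in> I)) \<and> set ms \<subseteq> (V - I) \<times> P \<and>
      (\<forall>(y, z)\<in>R. y \<notin> I \<longrightarrow> z \<notin> I \<longrightarrow> apart y z c ms) \<and>
      (\<forall>y\<in>V - I. recolor ms c y = d y \<and> num_moves ms y \<le> 3)"
proof (induction "card V" arbitrary: V R rule: less_induct)
  case less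
  note G = less.prems(1) and pc = less.prems(3) and pd = less.prems(4)
  have IH: "\<exists>I ms. I \<subseteq> V - X \<and> (\<forall>(y, z)\<in>R. \<not> (y \<in> I \<and> z \<in> I)) \<and> set ms \<subseteq> (V - I - X) \<times> P \<and>
      (\<forall>(y, z)\<in>R. y \<notin> I \<union> X \<longrightarrow> z \<notin> I \<union> X \<longrightarrow> apart y z c ms) \<and>
      (\<forall>y\<in>V - I - X. recolor ms c y = d y \<and> num_moves ms y \<le> 3)" if X: "X \<subseteq> V" "X \<noteq> {}" for X
  proof -
    let ?R = "R \<inter> (V - X) \<times> (V - X)"
    have "card (V - X) < card V" using X fgraphD(1)[OF G] by (intro psubset_card_mono) auto
    moreover have "\<not> has_K23 ?R" using less.prems(2) has_K23_mono[of ?R R] by blast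
    ultimately obtain I ms where I: "I \<subseteq> V - X" "\<forall>(y, z)\<in>?R. \<not> (y \<in> I \<and> z \<in> I)"
        and ms: "set ms \<subseteq> (V - X - I) \<times> P" "\<forall>(y, z)\<in>?R. y \<notin> I \<longrightarrow> z \<notin> I \<longrightarrow> apart y z c ms"
        "\<forall>y\<in>V - X - I. recolor ms c y = d y \<and> num_moves ms y \<le> 3"
      using less.hyps[of "V - X" ?R] fgraph_restrict[OF G, of X] proper_restrict[OF pc, of X] proper_restrict[OF pd, of X]
      by (elim meta_impE) auto
    have "\<forall>(y, z)\<in>R. \<not> (y \<in> I \<and> z \<in> I)" using I by blast
    moreover have "\<forall>(y, z)\<in>R. y \<notin> I \<union> X \<longrightarrow> z \<notin> I \<union> X \<longrightarrow> apart y z c ms"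
      using ms(2) fgraphD(5,6)[OF G] by blast
    moreover have "V - X - I = V - I - X" by blast
    ultimately show ?thesis using I(1) ms(1,3) by (intro exI[of _ I] exI[of _ ms]) simp
  qed
  show ?case
  proof (cases "V = {}")
    case True
    with fgraphD(2)[OF G] show ?thesis by (intro exI[of _ "{}"] exI[of _ "[]"]) auto
  next
    case False
    from G False less.prems(2) show ?thesis
    proof (cases rule: K23_free_cases)
      case (low x)
      have irr: "(x, x) \<notin> R" by (rule fgraphD(4)[OF G])
      have "{x} \<subseteq> V" using low by simp
      from IH[OF this] obtain I ms where I: "I \<subseteq> V - {x}" "\<forall>(y, z)\<in>R. \<not> (y \<in> I \<and> z \<in> I)"
        and ms: "set ms \<subseteq> (V - I - {x}) \<times> P" "\<forall>(y, z)\<in>R. y \<notin> I \<union> {x} \<longrightarrow> z \<notin> I \<union> {x} \<longrightarrow> apart y z c ms"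
          "\<forall>y\<in>V - I - {x}. recolor ms c y = d y \<and> num_moves ms y \<le> 3"
        by (elim meta_impE exE conjE) auto
      show ?thesis
      proof (cases "R `` {x} \<inter> I = {}")
        case True
        have "\<forall>(y, z)\<in>R. \<not> (y \<in> insert x I \<and> z \<in> insert x I)"
          using I(2) True irr fgraphD(3)[OF G] by blast
        moreover have "V - insert x I = V - I - {x}" by blast
        ultimately show ?thesis using I(1) low(1) ms by (intro exI[of _ "insert x I"] exI[of _ ms]) auto
      next
        case False
        let ?N = "R `` {x} - I"
        have N: "finite ?N" "x \<notin> ?N" "?N \<subseteq> V - I - {x}"
          using fgraphD[OF G] irr by (auto intro: rev_finite_subset[of V])
        have "finite (R `` {x})" using fgraphD[OF G] by (auto intro: rev_finite_subset[of V])
        then have "card ?N < card (R `` {x})" using False by (intro psubset_card_mono) auto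
        then have cN: "card ?N \<le> 1" using low(2) by simp
        have num: "num_moves ms y \<le> 3" if "y \<in> ?N" for y using that N(3) ms(3) by blast
        \<comment> \<open>Two blocks of two moves suffice for the at most three moves of a single
          neighbour. One neighbour and two upcoming colors exclude three of four colors, and the
          final move is the third.\<close>
        have "length (moves_of ?N ms) \<le> 2 * 2"
          using length_moves_of_le[OF cN N(1) num] by simp
        moreover have "d x \<noteq> recolor (moves_of ?N ms) c y" if y: "y \<in> ?N" for y
        proof -
          have "recolor (moves_of ?N ms) c y = d y" using ms(3) N(3) y by (auto simp: recolor_moves_of[OF y])
          then show ?thesis using y pd by (auto simp: proper_def)
        qed
        moreover have "c x \<noteq> c y" if "y \<in> ?N" for y using that pc by (auto simp: proper_def)
        moreover have "d x \<in> P" using pd low(1) by (auto simp: proper_def)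
        moreover have "card ?N + 2 < card P" using cN P by simp
        ultimately obtain T where T: "fst ` set T \<subseteq> insert x ?N" "moves_of ?N T = moves_of ?N ms"
            "\<forall>y\<in>?N. apart x y c T" "num_moves T x \<le> Suc 2" "\<forall>q. (x, q) \<in> set T \<longrightarrow> q \<in> P" "recolor T c x = d x"
          using extend_vertex[OF P(1) _ N(1,2) moves_of_simps(5), of 2 ms 2 c "d x"]
          by (elim meta_impE exE conjE) auto
        have TP: "set T \<subseteq> (?N \<union> {x}) \<times> P"
        proof
          fix m assume m: "m \<in> set T"
          then have "fst m = x \<or> m \<in> set (moves_of ?N T)" using T(1) by auto
          then have "snd m \<in> P"
            using m T(2,5) ms(1) moves_of_subset[of ?N ms] by (cases m) auto
          moreover have "fst m \<in> ?N \<union> {x}" using T(1) m by auto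
          ultimately show "m \<in> (?N \<union> {x}) \<times> P" by (simp add: mem_Times_iff)
        qed
        have IV: "I \<subseteq> V" "{x} \<subseteq> V - I" using I(1) low(1) by auto
        have nb: "\<forall>(y, z)\<in>R. y \<in> {x} \<longrightarrow> z \<in> ?N \<union> {x} \<union> I" by auto
        have ap: "\<forall>y\<in>{x}. \<forall>z\<in>?N \<union> {x}. (y, z) \<in> R \<longrightarrow> apart y z c T" using T(3) irr by auto
        have "\<forall>y\<in>{x}. recolor T c y = d y \<and> num_moves T y \<le> 3" using T(4,6) by simp
        from extend_schedule_outside[OF G IV N(3) nb ms TP T(2) ap this] IV(1) I(2) show ?thesis
          by (intro exI[of _ I]) (elim exE, intro exI conjI; (elim conjE)?; assumption)
      qed
    next
      case (leaf a b x v)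
      have E: "(a, b) \<in> R" "(a, x) \<in> R" "(a, v) \<in> R" "(b, x) \<in> R" "(b, v) \<in> R" "(x, v) \<in> R"
        using leaf(3-5) by blast+
      note irr = fgraphD(4)[OF G]
      have X: "{a, b, x} \<subseteq> V" "{a, b, x} \<noteq> {}" using leaf(2) by auto
      from IH[OF X] obtain I ms where I: "I \<subseteq> V - {a, b, x}" "\<forall>(y, z)\<in>R. \<not> (y \<in> I \<and> z \<in> I)"
        and ms: "set ms \<subseteq> (V - I - {a, b, x}) \<times> P"
          "\<forall>(y, z)\<in>R. y \<notin> I \<union> {a, b, x} \<longrightarrow> z \<notin> I \<union> {a, b, x} \<longrightarrow> apart y z c ms"
          "\<forall>y\<in>V - I - {a, b, x}. recolor ms c y = d y \<and> num_moves ms y \<le> 3"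
        by (elim exE conjE) (rule that; assumption)
      have cP: "c a \<in> P" "c b \<in> P" "c x \<in> P" "c v \<in> P" "distinct [c a, c b, c x, c v]"
        using pc E leaf(2) by (auto simp: proper_def)
      have dP: "d a \<in> P" "d b \<in> P" "d x \<in> P" "d v \<in> P" "distinct [d a, d b, d x, d v]"
        using pd E leaf(2) by (auto simp: proper_def)
      show ?thesis
      proof (cases "v \<in> I")
        case True
        \<comment> \<open>With \<open>v\<close> set aside, the triangle has no scheduled neighbours.
          Its vertex \<open>a\<close> is given the single move to its target and takes the part of
          the third vertex, around which \<open>b\<close> and \<open>x\<close> are
          scheduled.\<close>
        have "distinct [b, x, a]" "set [(a, d a)] \<subseteq> {a} \<times> P" "length [(a, d a)] \<le> 3"
          "distinct [c b, c x, c a]" "distinct [d b, d x, recolor [(a, d a)] c a]"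
          using leaf(1) cP dP by auto
        from extend_triangle_four_colors[OF P this(1,2,3) cP(2,3,1) this(4) dP(2,3) this(5)]
        obtain T where T: "set T \<subseteq> {b, x, a} \<times> P" "moves_of {a} T = [(a, d a)]"
            "apart b x c T" "apart a b c T" "apart a x c T" "recolor T c b = d b" "recolor T c x = d x"
            "num_moves T b \<le> 3" "num_moves T x \<le> 3"
          by (elim exE conjE) (rule that; assumption)
        note T' = T(3-5) T(3-5)[THEN iffD1[OF apart_sym]]
        have "recolor T c a = d a" using recolor_moves_of[of a "{a}" T c] T(2) by simp
        moreover have "num_moves T a \<le> 3" using T(2) by (simp add: num_moves_def)
        ultimately have fin: "\<forall>y\<in>{a, b, x}. recolor T c y = d y \<and> num_moves T y \<le> 3"
          using T by simp
        have ap: "\<forall>y\<in>{a, b, x}. \<forall>z\<in>{} \<union> {a, b, x}. (y, z) \<in> R \<longrightarrow> apart y z c T"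
          using T' irr by simp
        have nb: "\<forall>(y, z)\<in>R. y \<in> {a, b, x} \<longrightarrow> z \<in> {} \<union> {a, b, x} \<union> I"
          using leaf(3-5) True by blast
        have IV: "I \<subseteq> V" "{a, b, x} \<subseteq> V - I" "{} \<subseteq> V - I - {a, b, x}" using I(1) leaf(2) by auto
        have TP: "set T \<subseteq> ({} \<union> {a, b, x}) \<times> P" using T(1) by auto
        have "moves_of {} T = moves_of {} ms" by (simp add: moves_of_def)
        from extend_schedule_outside[OF G IV nb ms TP this ap fin] IV(1) I(2) show ?thesis
          by (intro exI[of _ I]) (elim exE, intro exI conjI; (elim conjE)?; assumption)
      next
        case False
        let ?I = "insert a I" and ?X = "{b, x}"
        have v: "v \<in> V - I - {a, b, x}" using leaf(1,2) False by auto
        have "set (moves_of {v} ms) \<subseteq> {v} \<times> P" using ms(1) by auto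
        moreover have "length (moves_of {v} ms) \<le> 3" using bspec[OF ms(3) v] by (simp add: num_moves_def)
        moreover have "recolor (moves_of {v} ms) c v = d v" using bspec[OF ms(3) v] by (simp add: recolor_moves_of)
        moreover have "distinct [b, x, v]" "distinct [c b, c x, c v]" "distinct [d b, d x, d v]"
          using leaf(1) cP dP by auto
        ultimately obtain T where T: "set T \<subseteq> {b, x, v} \<times> P" "moves_of {v} T = moves_of {v} ms"
            "apart b x c T" "apart v b c T" "apart v x c T" "recolor T c b = d b" "recolor T c x = d x"
            "num_moves T b \<le> 3" "num_moves T x \<le> 3"
          using extend_triangle_four_colors[OF P, of b x v "moves_of {v} ms" c "d b" "d x"] cP dP
          by (elim meta_impE exE conjE) simp_all
        note T' = T(3-5) T(3-5)[THEN iffD1[OF apart_sym]]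
        have eq: "V - I - {a, b, x} = V - ?I - ?X" "I \<union> {a, b, x} = ?I \<union> ?X" by auto
        have fin: "\<forall>y\<in>?X. recolor T c y = d y \<and> num_moves T y \<le> 3" using T by simp
        have ap: "\<forall>y\<in>?X. \<forall>z\<in>{v} \<union> ?X. (y, z) \<in> R \<longrightarrow> apart y z c T"
          using T' irr by simp
        have nb: "\<forall>(y, z)\<in>R. y \<in> ?X \<longrightarrow> z \<in> {v} \<union> ?X \<union> ?I" using leaf(4,5) by blast
        have IV: "?I \<subseteq> V" "?X \<subseteq> V - ?I" "{v} \<subseteq> V - ?I - ?X" using I(1) leaf(1,2) False by auto
        have TP: "set T \<subseteq> ({v} \<union> ?X) \<times> P" using T(1) by auto
        have ind: "\<forall>(y, z)\<in>R. \<not> (y \<in> ?I \<and> z \<in> ?I)"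
        proof -
          have "z \<notin> I" if "(a, z) \<in> R" for z using that leaf(3) False I(1) by blast
          then show ?thesis using I(2) irr fgraphD(3)[OF G] by blast
        qed
        from extend_schedule_outside[OF G IV nb ms[unfolded eq] TP T(2) ap fin] IV(1) ind show ?thesis
          by (intro exI[of _ ?I]) (elim exE, intro exI conjI; (elim conjE)?; assumption)
      qed
    qed
  qed
qed

section \<open>From five colors to four\<close>

text \<open>
  A table of schedules with at most two moves per vertex, none of which ends with the fifth color
  \<open>h5\<close>.  Vertices are named by the hue they start with.  An entry \<open>(p, q, M, Ts)\<close> is a schedule \<open>M\<close> for
  an edge whose ends start with \<open>p\<close> and \<open>q\<close>; for each of the three other hues, \<open>Ts\<close> contains an extension
  of \<open>M\<close> to a common neighbour that starts with that hue.  An entry \<open>(p, M, Ts)\<close> of \<open>traces\<close> is a schedule of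
  a single vertex, with extensions to the $K_4$s in which one of the other hues is absent.  Every edge
  of an extension is again in the table, up to a permutation of the hues other than \<open>h5\<close>, so that
  schedules can be extended forever.  The table was found by computing a greatest fixed point.
\<close>

definition views :: "(hue \<times> hue \<times> (hue \<times> hue) list \<times> (hue \<times> hue) list list) list" where
  "views = [
   (h1, h2, [(h1,h3),(h1,h4),(h2,h1)],
      [[(h3,h5),(h1,h3),(h1,h4),(h2,h1),(h3,h2)],
      [(h1,h3),(h4,h1),(h1,h4),(h4,h3),(h2,h1)],
      [(h1,h3),(h1,h4),(h5,h3),(h2,h1)]]),
   (h1, h2, [(h1,h3),(h1,h4),(h2,h3)],
      [[(h3,h4),(h1,h3),(h3,h1),(h1,h4),(h2,h3)],
      [(h1,h3),(h4,h5),(h1,h4),(h2,h3),(h4,h2)],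
      [(h1,h3),(h5,h1),(h1,h4),(h2,h3)]]),
   (h1, h2, [(h1,h3),(h2,h1),(h1,h2),(h2,h3)],
      [[(h3,h4),(h1,h3),(h2,h1),(h1,h2),(h2,h3),(h3,h1)],
      [(h1,h3),(h2,h1),(h1,h2),(h2,h3),(h4,h1)],
      [(h1,h3),(h2,h1),(h1,h2),(h2,h3),(h5,h4)]]),
   (h1, h2, [(h1,h3),(h2,h1),(h1,h4),(h2,h3)],
      [[(h3,h4),(h1,h3),(h2,h1),(h3,h2),(h1,h4),(h2,h3)],
      [(h1,h3),(h2,h1),(h4,h2),(h1,h4),(h2,h3),(h4,h1)],
      [(h1,h3),(h2,h1),(h1,h4),(h5,h2),(h2,h3)]]),
   (h1, h2, [(h1,h3),(h2,h1),(h2,h4),(h1,h2)],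
      [[(h3,h5),(h1,h3),(h2,h1),(h2,h4),(h3,h1),(h1,h2)],
      [(h1,h3),(h2,h1),(h4,h2),(h2,h4),(h4,h1),(h1,h2)],
      [(h1,h3),(h2,h1),(h2,h4),(h1,h2),(h5,h3)]]),
   (h1, h2, [(h1,h3),(h2,h4),(h1,h2)],
      [[(h3,h5),(h1,h3),(h3,h1),(h2,h4),(h1,h2)],
      [(h1,h3),(h4,h5),(h2,h4),(h1,h2),(h4,h3)],
      [(h1,h3),(h5,h1),(h2,h4),(h1,h2)]]),
   (h1, h2, [(h1,h3),(h2,h4),(h1,h2),(h2,h1)],
      [[(h3,h5),(h1,h3),(h2,h4),(h1,h2),(h2,h1),(h3,h4)],
      [(h1,h3),(h4,h1),(h2,h4),(h1,h2),(h4,h3),(h2,h1)],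
      [(h1,h3),(h2,h4),(h1,h2),(h2,h1),(h5,h3)]]),
   (h1, h2, [(h1,h3),(h2,h4),(h2,h1),(h1,h4)],
      [[(h3,h5),(h1,h3),(h2,h4),(h2,h1),(h1,h4),(h3,h2)],
      [(h1,h3),(h4,h1),(h2,h4),(h4,h2),(h2,h1),(h1,h4)],
      [(h1,h3),(h2,h4),(h2,h1),(h1,h4),(h5,h3)]]),
   (h1, h2, [(h1,h3),(h2,h5),(h1,h2),(h2,h3)],
      [[(h3,h5),(h1,h3),(h3,h1),(h2,h5),(h1,h2),(h2,h3)],
      [(h1,h3),(h2,h5),(h1,h2),(h2,h3),(h4,h1)],
      [(h1,h3),(h5,h1),(h2,h5),(h1,h2),(h2,h3)]]),
   (h1, h2, [(h1,h3),(h2,h5),(h1,h2),(h2,h4)],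
      [[(h3,h4),(h1,h3),(h2,h5),(h1,h2),(h3,h1),(h2,h4)],
      [(h1,h3),(h2,h5),(h1,h2),(h4,h1),(h2,h4)],
      [(h1,h3),(h5,h1),(h2,h5),(h1,h2),(h2,h4)]]),
   (h1, h2, [(h1,h3),(h2,h5),(h1,h4),(h2,h3)],
      [[(h3,h5),(h1,h3),(h3,h1),(h2,h5),(h1,h4),(h2,h3)],
      [(h1,h3),(h2,h5),(h4,h2),(h1,h4),(h2,h3)],
      [(h1,h3),(h5,h1),(h2,h5),(h1,h4),(h2,h3)]]),
   (h1, h2, [(h1,h5),(h1,h3),(h2,h4)],
      [[(h1,h5),(h3,h1),(h1,h3),(h2,h4),(h3,h2)],
      [(h1,h5),(h1,h3),(h4,h5),(h2,h4),(h4,h1)],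
      [(h5,h4),(h1,h5),(h5,h1),(h1,h3),(h2,h4)]]),
   (h1, h2, [(h1,h5),(h1,h3),(h2,h5),(h2,h1)],
      [[(h1,h5),(h3,h1),(h1,h3),(h2,h5),(h3,h2),(h2,h1)],
      [(h1,h5),(h1,h3),(h2,h5),(h4,h2),(h2,h1)],
      [(h5,h4),(h1,h5),(h1,h3),(h2,h5),(h2,h1)]]),
   (h1, h2, [(h1,h5),(h2,h1),(h1,h2),(h2,h3)],
      [[(h1,h5),(h2,h1),(h1,h2),(h3,h4),(h2,h3)],
      [(h1,h5),(h2,h1),(h1,h2),(h4,h5),(h2,h3),(h4,h1)],
      [(h5,h3),(h1,h5),(h2,h1),(h1,h2),(h5,h4),(h2,h3)]]),
   (h1, h2, [(h1,h5),(h2,h1),(h1,h3)],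
      [[(h1,h5),(h3,h4),(h2,h1),(h3,h2),(h1,h3)],
      [(h1,h5),(h4,h3),(h2,h1),(h4,h2),(h1,h3)],
      [(h5,h4),(h1,h5),(h2,h1),(h1,h3)]]),
   (h1, h2, [(h1,h5),(h2,h1),(h2,h3),(h1,h4)],
      [[(h1,h5),(h2,h1),(h3,h4),(h2,h3),(h3,h2),(h1,h4)],
      [(h1,h5),(h2,h1),(h2,h3),(h4,h2),(h1,h4)],
      [(h5,h3),(h1,h5),(h2,h1),(h5,h2),(h2,h3),(h1,h4)]]),
   (h1, h2, [(h1,h5),(h2,h3),(h1,h2)],
      [[(h3,h4),(h1,h5),(h3,h1),(h2,h3),(h1,h2)],
      [(h4,h3),(h1,h5),(h4,h1),(h2,h3),(h1,h2)],
      [(h5,h4),(h1,h5),(h2,h3),(h1,h2)]]),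
   (h1, h2, [(h1,h5),(h2,h3),(h2,h4),(h1,h2)],
      [[(h3,h4),(h1,h5),(h2,h3),(h3,h1),(h2,h4),(h1,h2)],
      [(h1,h5),(h2,h3),(h4,h1),(h2,h4),(h1,h2)],
      [(h5,h4),(h1,h5),(h2,h3),(h5,h1),(h2,h4),(h1,h2)]]),
   (h1, h2, [(h1,h5),(h2,h3),(h2,h4),(h1,h3)],
      [[(h1,h5),(h3,h1),(h2,h3),(h2,h4),(h1,h3),(h3,h2)],
      [(h1,h5),(h2,h3),(h4,h1),(h2,h4),(h1,h3)],
      [(h5,h4),(h1,h5),(h2,h3),(h5,h1),(h2,h4),(h1,h3)]]),
   (h1, h5, [(h1,h2),(h1,h3),(h5,h2)],
      [[(h2,h4),(h1,h2),(h1,h3),(h5,h2),(h2,h1)],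
      [(h1,h2),(h3,h4),(h1,h3),(h3,h1),(h5,h2)],
      [(h1,h2),(h1,h3),(h5,h2),(h4,h1)]]),
   (h1, h5, [(h1,h2),(h1,h3),(h5,h2),(h5,h4)],
      [[(h2,h4),(h1,h2),(h1,h3),(h5,h2),(h2,h1),(h5,h4)],
      [(h1,h2),(h3,h1),(h1,h3),(h5,h2),(h5,h4),(h3,h2)],
      [(h1,h2),(h4,h1),(h1,h3),(h5,h2),(h5,h4),(h4,h2)]]),
   (h1, h5, [(h1,h2),(h1,h3),(h5,h4)],
      [[(h2,h3),(h1,h2),(h2,h1),(h1,h3),(h5,h4)],
      [(h1,h2),(h3,h1),(h1,h3),(h3,h2),(h5,h4)],
      [(h1,h2),(h4,h1),(h1,h3),(h5,h4),(h4,h2)]]),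
   (h1, h5, [(h1,h2),(h5,h1),(h1,h3)],
      [[(h2,h3),(h1,h2),(h2,h4),(h5,h1),(h1,h3)],
      [(h1,h2),(h5,h1),(h3,h4),(h1,h3)],
      [(h1,h2),(h5,h1),(h1,h3),(h4,h2)]]),
   (h1, h5, [(h1,h2),(h5,h1),(h1,h3),(h5,h2)],
      [[(h2,h4),(h1,h2),(h5,h1),(h1,h3),(h5,h2),(h2,h1)],
      [(h1,h2),(h5,h1),(h3,h4),(h1,h3),(h5,h2),(h3,h1)],
      [(h1,h2),(h5,h1),(h1,h3),(h5,h2),(h4,h1)]]),
   (h1, h5, [(h1,h2),(h5,h1),(h5,h3),(h1,h4)],
      [[(h2,h4),(h1,h2),(h5,h1),(h5,h3),(h2,h1),(h1,h4)],
      [(h1,h2),(h5,h1),(h3,h4),(h5,h3),(h3,h1),(h1,h4)],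
      [(h1,h2),(h5,h1),(h4,h5),(h5,h3),(h1,h4),(h4,h2)]]),
   (h1, h5, [(h1,h2),(h5,h3),(h5,h1),(h1,h3)],
      [[(h2,h3),(h1,h2),(h2,h4),(h5,h3),(h5,h1),(h1,h3)],
      [(h1,h2),(h3,h1),(h5,h3),(h3,h4),(h5,h1),(h1,h3)],
      [(h1,h2),(h5,h3),(h4,h5),(h5,h1),(h1,h3),(h4,h2)]]),
   (h1, h5, [(h1,h2),(h5,h3),(h5,h4),(h1,h3)],
      [[(h2,h3),(h1,h2),(h2,h1),(h5,h3),(h5,h4),(h1,h3)],
      [(h1,h2),(h3,h1),(h5,h3),(h5,h4),(h1,h3),(h3,h2)],
      [(h1,h2),(h5,h3),(h4,h5),(h5,h4),(h1,h3),(h4,h2)]]),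
   (h1, h5, [(h5,h2),(h1,h3)],
      [[(h2,h3),(h5,h2),(h2,h4),(h1,h3)],
      [(h5,h2),(h3,h5),(h1,h3),(h3,h4)],
      [(h5,h2),(h4,h5),(h1,h3),(h4,h1)]]),
   (h1, h5, [(h5,h2),(h1,h3),(h5,h1),(h1,h2)],
      [[(h2,h4),(h5,h2),(h1,h3),(h5,h1),(h1,h2),(h2,h3)],
      [(h5,h2),(h3,h5),(h1,h3),(h5,h1),(h1,h2),(h3,h4)],
      [(h5,h2),(h1,h3),(h4,h5),(h5,h1),(h1,h2),(h4,h3)]]),
   (h1, h5, [(h5,h2),(h1,h3),(h5,h4),(h1,h2)],
      [[(h2,h4),(h5,h2),(h1,h3),(h2,h1),(h5,h4),(h1,h2)],
      [(h5,h2),(h3,h5),(h1,h3),(h5,h4),(h3,h1),(h1,h2)],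
      [(h5,h2),(h1,h3),(h4,h5),(h5,h4),(h1,h2),(h4,h3)]]),
   (h1, h5, [(h5,h2),(h1,h5),(h1,h3)],
      [[(h2,h3),(h5,h2),(h1,h5),(h2,h1),(h1,h3)],
      [(h5,h2),(h1,h5),(h3,h4),(h1,h3)],
      [(h5,h2),(h1,h5),(h4,h1),(h1,h3)]]),
   (h1, h5, [(h5,h2),(h1,h5),(h1,h3),(h5,h4)],
      [[(h2,h4),(h5,h2),(h1,h5),(h2,h1),(h1,h3),(h5,h4)],
      [(h5,h2),(h1,h5),(h3,h1),(h1,h3),(h5,h4),(h3,h2)],
      [(h5,h2),(h1,h5),(h1,h3),(h4,h5),(h5,h4),(h4,h1)]]),
   (h1, h5, [(h5,h2),(h1,h5),(h5,h1),(h1,h3)],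
      [[(h2,h3),(h5,h2),(h1,h5),(h5,h1),(h2,h4),(h1,h3)],
      [(h5,h2),(h1,h5),(h5,h1),(h3,h2),(h1,h3)],
      [(h5,h2),(h1,h5),(h5,h1),(h1,h3),(h4,h2)]]),
   (h1, h5, [(h5,h2),(h1,h5),(h5,h3),(h1,h4)],
      [[(h2,h3),(h5,h2),(h1,h5),(h2,h1),(h5,h3),(h1,h4)],
      [(h5,h2),(h1,h5),(h3,h1),(h5,h3),(h3,h2),(h1,h4)],
      [(h5,h2),(h1,h5),(h5,h3),(h4,h2),(h1,h4)]]),
   (h1, h5, [(h5,h2),(h5,h3),(h1,h2)],
      [[(h2,h3),(h5,h2),(h2,h4),(h5,h3),(h1,h2)],
      [(h5,h2),(h3,h5),(h5,h3),(h1,h2),(h3,h1)],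
      [(h5,h2),(h4,h5),(h5,h3),(h1,h2),(h4,h1)]])]"

definition traces :: "(hue \<times> (hue \<times> hue) list \<times> (hue \<times> hue) list list) list" where
  "traces = [
   (h1, [(h1,h2)],
      [[(h3,h2),(h5,h3),(h4,h5),(h3,h4),(h1,h2),(h4,h1)],
      [(h4,h3),(h5,h4),(h2,h5),(h1,h2),(h4,h1),(h2,h3)],
      [(h3,h4),(h5,h3),(h2,h5),(h1,h2),(h3,h1),(h2,h4)],
      [(h3,h5),(h4,h3),(h3,h4),(h2,h5),(h1,h2),(h4,h1),(h2,h3)]]),
   (h1, [(h1,h2),(h1,h3)],
      [[(h1,h2),(h5,h1),(h3,h5),(h1,h3),(h4,h2),(h3,h4)],
      [(h5,h3),(h2,h5),(h1,h2),(h2,h1),(h4,h5),(h5,h4),(h1,h3),(h4,h2)],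
      [(h2,h4),(h1,h2),(h3,h1),(h1,h3),(h3,h2),(h2,h1),(h5,h4)],
      [(h2,h5),(h1,h2),(h2,h1),(h4,h5),(h3,h4),(h1,h3),(h4,h2)]]),
   (h1, [(h1,h5),(h1,h2)],
      [[(h3,h2),(h5,h3),(h1,h5),(h4,h1),(h3,h4),(h1,h2)],
      [(h4,h3),(h5,h4),(h1,h5),(h4,h1),(h2,h3),(h1,h2)],
      [(h3,h4),(h5,h3),(h1,h5),(h3,h1),(h2,h4),(h1,h2)],
      [(h1,h5),(h2,h1),(h1,h2),(h3,h5),(h4,h3),(h2,h4),(h3,h1)]]),
   (h5, [(h5,h1)],
      [[(h2,h1),(h3,h2),(h4,h3),(h3,h4),(h4,h2),(h2,h3),(h5,h1)],
      [(h1,h2),(h5,h1),(h3,h5),(h1,h3),(h4,h2),(h3,h4)],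
      [(h1,h3),(h5,h1),(h2,h5),(h1,h2),(h4,h3),(h2,h4)],
      [(h1,h4),(h5,h1),(h2,h5),(h1,h2),(h3,h4),(h2,h3)]]),
   (h5, [(h5,h1),(h5,h2)],
      [[(h5,h1),(h3,h5),(h4,h3),(h3,h4),(h2,h5),(h5,h2),(h4,h1),(h2,h3)],
      [(h1,h2),(h5,h1),(h3,h5),(h1,h3),(h5,h2),(h4,h1),(h3,h4)],
      [(h1,h3),(h5,h1),(h4,h5),(h2,h4),(h5,h2),(h2,h1),(h1,h4),(h4,h3)],
      [(h1,h4),(h5,h1),(h3,h5),(h2,h3),(h5,h2),(h2,h1),(h1,h3),(h3,h4)]])]"

section \<open>Lookup in the table up to permutations of hues\<close>

definition hues :: "hue list" where
  "hues = [h1, h2, h3, h4, h5]"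

text \<open>A hue that is not listed stays as it is; this is how \<open>normalize\<close> fixes
  \<open>h5\<close>.\<close>

fun rank :: "hue list \<Rightarrow> hue list \<Rightarrow> hue \<Rightarrow> hue" where
  "rank (d # ds) (n # ns) h = (if h = d then n else rank ds ns h)"
| "rank _ _ h = h"

text \<open>Numbers the hues other than \<open>h5\<close> by their first occurrence.\<close>

definition normalize :: "hue list \<Rightarrow> hue \<Rightarrow> hue" where
  "normalize xs = rank (rev (remdups (rev (filter (\<lambda>h. h \<noteq> h5) xs @ fours)))) fours"

text \<open>Tested at every lookup, so that no property of \<open>normalize\<close> has to be
  proved.\<close>

definition permutes_hues :: "(hue \<Rightarrow> hue) \<Rightarrow> bool" where
  "permutes_hues r \<longleftrightarrow> distinct (map r hues) \<and> r h5 = h5"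

definition is_view :: "hue \<Rightarrow> hue \<Rightarrow> (hue \<times> hue) list \<Rightarrow> bool" where
  "is_view p q M \<longleftrightarrow> (let r = normalize (p # q # map snd M) in permutes_hues r \<and>
     list_ex (\<lambda>(p', q', M', _). p' = r p \<and> q' = r q \<and> M' = map (map_prod r r) M) views)"

definition is_trace :: "hue \<Rightarrow> (hue \<times> hue) list \<Rightarrow> bool" where
  "is_trace p M \<longleftrightarrow> (let r = normalize (p # map snd M) in permutes_hues r \<and>
     list_ex (\<lambda>(p', M', _). p' = r p \<and> M' = map (map_prod r r) M) traces)"

text \<open>A form of \<open>moves_of {p, q}\<close> for evaluation; \<open>p = q\<close> gives the
  moves of one vertex.\<close>

definition pair_moves :: "hue \<Rightarrow> hue \<Rightarrow> (hue \<times> hue) list \<Rightarrow> (hue \<times> hue) list" where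
  "pair_moves p q M = filter (\<lambda>m. fst m = p \<or> fst m = q) M"

definition good_pair :: "(hue \<times> hue) list \<Rightarrow> hue \<Rightarrow> hue \<Rightarrow> bool" where
  "good_pair T p q \<longleftrightarrow> is_view p q (pair_moves p q T) \<or> is_view q p (pair_moves p q T)"

definition good_single :: "(hue \<times> hue) list \<Rightarrow> hue \<Rightarrow> bool" where
  "good_single T p \<longleftrightarrow> is_trace p (pair_moves p p T)"

text \<open>Vertices are named by their starting hues, so the starting coloring is the identity. The
  check is the inductive step for a common neighbour of the ends of an edge, done by evaluation for
  all entries at once.\<close>

lemma views_closed:
  "list_all (\<lambda>(p, q, M, Ts). p \<noteq> q \<and> list_all (\<lambda>m. fst m = p \<or> fst m = q) M \<and> apart p q (\<lambda>h. h) M \<and>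
     list_all (\<lambda>a. a = p \<or> a = q \<or> list_ex (\<lambda>T. list_all (\<lambda>m. fst m = p \<or> fst m = q \<or> fst m = a) T \<and>
       pair_moves p q T = M \<and> good_pair T p a \<and> good_pair T q a \<and> good_single T a) Ts) hues) views"
  by code_simp

text \<open>The hue \<open>o'\<close> is the one absent from the K4. The limits on the number of
  moves and on the final hue concern single vertices, so they are checked on traces; extensions of
  views inherit them because the new vertex must be a trace again.\<close>

lemma traces_closed:
  "list_all (\<lambda>(p, M, Ts). list_all (\<lambda>m. fst m = p) M \<and> length M \<le> 2 \<and> recolor M (\<lambda>h. h) p \<noteq> h5 \<and>
     list_all (\<lambda>o'. o' = p \<or> list_ex (\<lambda>T. list_all (\<lambda>m. fst m \<noteq> o') T \<and> pair_moves p p T = M \<and>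
       list_all (\<lambda>a. a = o' \<or> good_single T a \<and> list_all (\<lambda>b. b = o' \<or> b = a \<or> good_pair T a b) hues) hues) Ts) hues) traces"
  by code_simp

section \<open>Codings of colors by hues\<close>

text \<open>Color 5 is the one to be eliminated and must become \<open>h5\<close>; the other four
  are interchangeable. Each edge and each vertex may use a coding of its own.\<close>

definition coding :: "(nat \<Rightarrow> hue) \<Rightarrow> bool" where
  "coding \<tau> \<longleftrightarrow> bij_betw \<tau> {1..5} UNIV \<and> \<tau> 5 = h5"

definition encode :: "(nat \<Rightarrow> hue) \<Rightarrow> ('a \<Rightarrow> nat) \<Rightarrow> ('a \<times> nat) list \<Rightarrow> (hue \<times> hue) list" where
  "encode \<tau> c ms = map (\<lambda>m. (\<tau> (c (fst m)), \<tau> (snd m))) ms"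

definition linked :: "('a \<Rightarrow> nat) \<Rightarrow> ('a \<times> nat) list \<Rightarrow> 'a \<Rightarrow> 'a \<Rightarrow> bool" where
  "linked c ms s t \<longleftrightarrow> (\<exists>\<tau> p q M Ts. coding \<tau> \<and> (p, q, M, Ts) \<in> set views \<and> {\<tau> (c s), \<tau> (c t)} = {p, q} \<and>
     encode \<tau> c (moves_of {s, t} ms) = M)"

definition tracked :: "('a \<Rightarrow> nat) \<Rightarrow> ('a \<times> nat) list \<Rightarrow> 'a \<Rightarrow> bool" where
  "tracked c ms s \<longleftrightarrow> (\<exists>\<tau> p M Ts. coding \<tau> \<and> (p, M, Ts) \<in> set traces \<and> \<tau> (c s) = p \<and>
     encode \<tau> c (moves_of {s} ms) = M)"

lemma hue_UNIV: "UNIV = set hues"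
  using hue.exhaust by (auto simp: hues_def)

lemma in_hues [simp]: "h \<in> set hues"
  using hue_UNIV by auto

lemma coding_inj: "coding \<tau> \<Longrightarrow> inj_on \<tau> {1..5}"
  by (simp add: coding_def bij_betw_def)

lemma coding_compose:
  assumes "coding \<tau>" "permutes_hues r"
  shows "coding (r \<circ> \<tau>)"
proof -
  have "inj r" using assms(2) by (simp add: permutes_hues_def distinct_map hue_UNIV[symmetric])
  moreover have "finite (UNIV :: hue set)" by (simp add: hue_UNIV)
  ultimately have "bij r" by (simp add: finite_UNIV_inj_surj bij_def)
  with assms show ?thesis by (auto simp: coding_def permutes_hues_def intro: bij_betw_trans)
qed

text \<open>The permutations in use fix \<open>h5\<close>, so \<open>h1\<close> and
  \<open>h5\<close> represent all possible starts of a trace.\<close>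

lemma coding_exists:
  assumes "k \<in> {1..5}"
  shows "\<exists>\<tau>. coding \<tau> \<and> \<tau> k \<in> {h1, h5}"
proof -
  let ?t = "\<lambda>n. hues ! (n - 1)"
  have "bij_betw ?t {1..5} UNIV"
    by (rule bij_betw_byWitness[where f' = "\<lambda>h. case h of h1 \<Rightarrow> 1 | h2 \<Rightarrow> 2 | h3 \<Rightarrow> 3 | h4 \<Rightarrow> 4 | h5 \<Rightarrow> 5"])
       (auto simp: hues_def eval_nat_numeral le_Suc_eq split: hue.splits)
  then have t: "coding ?t" by (simp add: coding_def hues_def)
  show ?thesis
  proof (cases "k = 5")
    case True
    with t show ?thesis by (intro exI[of _ ?t]) (simp add: hues_def)
  next
    case False
    let ?r = "id(h1 := ?t k, ?t k := h1)"
    have "?t k \<noteq> h5" using False assms by (auto simp: hues_def eval_nat_numeral le_Suc_eq)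
    then have "permutes_hues ?r" by (cases "?t k") (auto simp: permutes_hues_def hues_def)
    with t have "coding (?r \<circ> ?t)" by (intro coding_compose)
    moreover have "(?r \<circ> ?t) k = h1" by simp
    ultimately show ?thesis by blast
  qed
qed

lemma encode_compose: "map (map_prod r r) (encode \<tau> c ms) = encode (r \<circ> \<tau>) c ms"
  by (simp add: encode_def)

text \<open>The normalizing permutation is absorbed into the coding, which is why
  \<open>linked\<close> can ask for a literal entry of the table.\<close>

lemma is_view_linked:
  assumes "coding \<tau>" "is_view (\<tau> (c s)) (\<tau> (c t)) (encode \<tau> c (moves_of {s, t} ms)) \<or>
    is_view (\<tau> (c t)) (\<tau> (c s)) (encode \<tau> c (moves_of {s, t} ms))"
  shows "linked c ms s t"
proof -
  have main: "linked c ms s t" if v: "is_view p q (encode \<tau> c (moves_of {s, t} ms))"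
      and pq: "{p, q} = {\<tau> (c s), \<tau> (c t)}" for p q
  proof -
    from v obtain r Ts where r: "permutes_hues r"
        "(r p, r q, map (map_prod r r) (encode \<tau> c (moves_of {s, t} ms)), Ts) \<in> set views"
      unfolding is_view_def Let_def list_ex_iff by auto
    have "{(r \<circ> \<tau>) (c s), (r \<circ> \<tau>) (c t)} = r ` {\<tau> (c s), \<tau> (c t)}" by simp
    also have "\<dots> = {r p, r q}" unfolding pq[symmetric] by simp
    finally show ?thesis
      using coding_compose[OF assms(1) r(1)] r(2) unfolding linked_def encode_compose by blast
  qed
  from assms(2) main show ?thesis by blast
qed

lemma is_trace_tracked:
  assumes "coding \<tau>" "is_trace (\<tau> (c s)) (encode \<tau> c (moves_of {s} ms))"
  shows "tracked c ms s"
proof -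
  from assms(2) obtain r Ts where r: "permutes_hues r"
      "(r (\<tau> (c s)), map (map_prod r r) (encode \<tau> c (moves_of {s} ms)), Ts) \<in> set traces"
    unfolding is_trace_def Let_def list_ex_iff by auto
  then show ?thesis
    using coding_compose[OF assms(1) r(1)] unfolding tracked_def encode_compose
    by (intro exI[of _ "r \<circ> \<tau>"]) auto
qed

lemma linked_sym: "linked c ms s t \<Longrightarrow> linked c ms t s"
  by (simp add: linked_def insert_commute)

lemma linked_moves_of: "s \<in> X \<Longrightarrow> t \<in> X \<Longrightarrow> linked c (moves_of X ms) s t \<longleftrightarrow> linked c ms s t"
  by (simp add: linked_def Int_absorb2)

lemma tracked_moves_of: "s \<in> X \<Longrightarrow> tracked c (moves_of X ms) s \<longleftrightarrow> tracked c ms s"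
  by (simp add: tracked_def Int_absorb2)

text \<open>The vertices of a clique have distinct colors, so \<open>g\<close> can recover a vertex
  from its starting hue and no information is lost in the encoding.\<close>

lemma decode_encode:
  assumes \<tau>: "coding \<tau>" and g: "\<And>h. h \<in> H \<Longrightarrow> c (g h) \<in> {1..5} \<and> \<tau> (c (g h)) = h"
    and ms: "set ms \<subseteq> g ` H \<times> {1..5}"
  shows "map (map_prod g (inv_into {1..5} \<tau>)) (encode \<tau> c ms) = ms"
    "set (encode \<tau> c ms) \<subseteq> H \<times> UNIV"
proof -
  have "map_prod g (inv_into {1..5} \<tau>) (\<tau> (c (fst m)), \<tau> (snd m)) = m" if "m \<in> set ms" for m
  proof -
    from that ms obtain h k where m: "m = (g h, k)" "h \<in> H" "k \<in> {1..5}" by (cases m) auto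
    with g[OF m(2)] coding_inj[OF \<tau>] show ?thesis by simp
  qed
  then show "map (map_prod g (inv_into {1..5} \<tau>)) (encode \<tau> c ms) = ms"
    unfolding encode_def map_map comp_def by (intro map_idI) auto
  show "set (encode \<tau> c ms) \<subseteq> H \<times> UNIV"
    using ms g by (fastforce simp: encode_def)
qed

lemma encode_decode:
  assumes \<tau>: "coding \<tau>" and g: "\<And>h. h \<in> H \<Longrightarrow> c (g h) \<in> {1..5} \<and> \<tau> (c (g h)) = h"
    and M: "fst ` set M \<subseteq> H"
  shows "encode \<tau> c (map (map_prod g (inv_into {1..5} \<tau>)) M) = M"
proof -
  have "\<tau> ` {1..5} = UNIV" using \<tau> by (simp add: coding_def bij_betw_def)
  then have "\<tau> (inv_into {1..5} \<tau> h) = h" for h by (intro f_inv_into_f) auto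
  then have "(\<tau> (c (fst (map_prod g (inv_into {1..5} \<tau>) m))), \<tau> (snd (map_prod g (inv_into {1..5} \<tau>) m))) = m"
    if "m \<in> set M" for m using g[of "fst m"] M that by (cases m) auto
  then show ?thesis unfolding encode_def map_map comp_def by (intro map_idI) auto
qed

lemma linked_apart:
  assumes l: "linked c ms s t" and c: "c s \<in> {1..5}" "c t \<in> {1..5}" and ms: "snd ` set ms \<subseteq> {1..5}"
  shows "s \<noteq> t \<and> apart s t c ms"
proof -
  from l obtain \<tau> p q M Ts where \<tau>: "coding \<tau>" and v: "(p, q, M, Ts) \<in> set views"
      and pq: "{\<tau> (c s), \<tau> (c t)} = {p, q}" and M: "encode \<tau> c (moves_of {s, t} ms) = M"
    by (auto simp: linked_def)
  from v views_closed have V: "p \<noteq> q" "apart p q (\<lambda>h. h) M" "fst ` set M \<subseteq> {p, q}"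
    by (auto simp: list_all_iff)
  let ?s = "\<tau> (c s)" and ?t = "\<tau> (c t)"
  have d: "?s \<noteq> ?t" using pq V(1) by (auto simp: doubleton_eq_iff)
  define g where "g h = (if h = ?s then s else t)" for h
  have gst: "g ?s = s" "g ?t = t" using d by (auto simp: g_def)
  have g: "c (g h) \<in> {1..5} \<and> \<tau> (c (g h)) = h" if "h \<in> {?s, ?t}" for h
    using that c by (auto simp: g_def)
  have im: "g ` {?s, ?t} = {s, t}" using gst by simp
  have st: "s \<noteq> t" using d by auto
  have sub: "set (moves_of {s, t} ms) \<subseteq> g ` {?s, ?t} \<times> {1..5}" unfolding im using ms by force
  let ?\<sigma> = "inv_into {1..5} \<tau>"
  have dec: "map (map_prod g ?\<sigma>) M = moves_of {s, t} ms" "fst ` set M \<subseteq> {?s, ?t}"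
    using decode_encode[OF \<tau> g sub] unfolding M by auto
  have "apart ?s ?t (\<lambda>h. h) M"
    using V(2) pq apart_sym[of p q] by (auto simp: doubleton_eq_iff)
  moreover have "inj_on ?\<sigma> UNIV"
    using \<tau> bij_betw_inv_into[of \<tau> "{1..5}" UNIV] by (simp add: coding_def bij_betw_def)
  moreover have "inj_on g {?s, ?t}" using gst st by (auto simp: inj_on_def)
  moreover have "c (g ?s) = ?\<sigma> ?s" "c (g ?t) = ?\<sigma> ?t"
    using c coding_inj[OF \<tau>] by (simp_all add: gst)
  ultimately have "apart (g ?s) (g ?t) c (map (map_prod g ?\<sigma>) M)"
    by (subst apart_map[where X = "{?s, ?t}" and K = UNIV and c = "\<lambda>h. h"]) (use dec(2) in auto)
  then show ?thesis using st unfolding gst dec(1) by (simp add: apart_moves_of)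
qed

lemma tracked_bounds:
  assumes t: "tracked c ms s" and c: "c s \<in> {1..5}" and ms: "snd ` set ms \<subseteq> {1..5}"
  shows "num_moves ms s \<le> 2" "recolor ms c s \<in> {1..4}"
proof -
  from t obtain \<tau> p M Ts where \<tau>: "coding \<tau>" and v: "(p, M, Ts) \<in> set traces"
      and p: "\<tau> (c s) = p" and M: "encode \<tau> c (moves_of {s} ms) = M"
    by (auto simp: tracked_def)
  from v traces_closed have V: "length M \<le> 2" "recolor M (\<lambda>h. h) p \<noteq> h5" "fst ` set M \<subseteq> {p}"
    by (auto simp: list_all_iff)
  have "length M = num_moves ms s" by (simp add: M[symmetric] encode_def num_moves_def)
  with V(1) show "num_moves ms s \<le> 2" by simp
  have "recolor M (\<lambda>h. h) p = last (p # map snd M)" by (rule recolor_last[OF V(3)])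
  also have "p # map snd M = map \<tau> (c s # map snd (moves_of {s} ms))"
    by (simp add: p M[symmetric] encode_def)
  also have "last \<dots> = \<tau> (last (c s # map snd (moves_of {s} ms)))" by (rule last_map) simp
  also have "last (c s # map snd (moves_of {s} ms)) = recolor (moves_of {s} ms) c s"
    by (rule recolor_last[symmetric]) (rule moves_of_simps(5))
  also have "\<dots> = recolor ms c s" by (rule recolor_moves_of) simp
  finally have "recolor ms c s \<noteq> 5" using V(2) \<tau> by (auto simp: coding_def)
  moreover have "recolor ms c s \<in> {1..5}" using recolor_in[of ms c s] c ms by force
  ultimately show "recolor ms c s \<in> {1..4}" by auto
qed

section \<open>Attaching new vertices according to the table\<close>

text \<open>\<open>H1\<close> holds the starting hues of vertices already scheduled,
  \<open>H2\<close> those of the new ones. The extension \<open>T\<close> from the table is decoded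
  and amalgamated with \<open>ms\<close>. The last clause lets the view of each edge and the trace
  of each vertex be read off from \<open>T\<close> under the same coding.\<close>

lemma attach:
  assumes \<tau>: "coding \<tau>" and g: "\<And>h. h \<in> H1 \<union> H2 \<Longrightarrow> c (g h) \<in> {1..5} \<and> \<tau> (c (g h)) = h"
    and H: "H1 \<inter> H2 = {}" and ms: "snd ` set ms \<subseteq> {1..5}" "fst ` set ms \<inter> g ` H2 = {}"
    and T: "fst ` set T \<subseteq> H1 \<union> H2" "moves_of H1 T = encode \<tau> c (moves_of (g ` H1) ms)"
  shows "\<exists>zs. moves_of (- g ` H2) zs = ms \<and> fst ` set zs \<subseteq> fst ` set ms \<union> g ` (H1 \<union> H2) \<and> snd ` set zs \<subseteq> {1..5} \<and>
    (\<forall>K\<subseteq>H1 \<union> H2. encode \<tau> c (moves_of (g ` K) zs) = moves_of K T)"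
proof -
  let ?H = "H1 \<union> H2" and ?\<sigma> = "inv_into {1..5} \<tau>"
  have inj: "inj_on g ?H" using g by (metis (no_types, lifting) inj_onI)
  define U where "U = map (map_prod g ?\<sigma>) T"
  have U: "moves_of (g ` K) U = map (map_prod g ?\<sigma>) (moves_of K T)" if "K \<subseteq> ?H" for K
    unfolding U_def by (rule moves_of_map[OF inj T(1) that])
  have fU: "fst ` set U \<subseteq> g ` ?H" using T(1) by (fastforce simp: U_def)
  have "?\<sigma> h \<in> {1..5}" for h
    by (rule inv_into_into) (use \<tau> in \<open>auto simp: coding_def bij_betw_def\<close>)
  then have sU: "snd ` set U \<subseteq> {1..5}" by (fastforce simp: U_def)
  have disj: "g ` H1 \<inter> g ` H2 = {}" using inj_on_image_Int[OF inj, of H1 H2] H by simp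
  have "moves_of (g ` ?H) ms = moves_of (g ` H1) ms"
    using ms(2) by (auto simp: moves_of_def intro!: filter_cong)
  also have "\<dots> = map (map_prod g ?\<sigma>) (encode \<tau> c (moves_of (g ` H1) ms))"
    by (rule decode_encode(1)[OF \<tau>, symmetric, where H = H1]) (use g ms(1) in force)+
  also have "\<dots> = moves_of (g ` H1) U" using U[of H1] T(2) by simp
  also have "\<dots> = moves_of (- g ` H2) U"
    using fU disj by (auto simp: moves_of_def intro!: filter_cong)
  finally obtain zs where zs: "moves_of (- g ` H2) zs = ms" "moves_of (g ` ?H) zs = U"
    using amalgamate[of "g ` ?H" ms "- g ` H2" U] ms(2) fU by blast
  have "m \<in> set ms \<or> m \<in> set U" if "m \<in> set zs" for m
    using that zs(1)[symmetric] zs(2)[symmetric] by auto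
  then have "fst ` set zs \<subseteq> fst ` set ms \<union> g ` ?H" "snd ` set zs \<subseteq> {1..5}"
    using fU sU ms(1) by blast+
  moreover have "encode \<tau> c (moves_of (g ` K) zs) = moves_of K T" if K: "K \<subseteq> ?H" for K
  proof -
    have "g ` K \<inter> g ` ?H = g ` K" using K by blast
    then have "moves_of (g ` K) zs = moves_of (g ` K) U" using zs(2) moves_of_simps(4)[of "g ` K" "g ` ?H" zs] by simp
    also have "\<dots> = map (map_prod g ?\<sigma>) (moves_of K T)" by (rule U[OF K])
    finally show ?thesis
      using encode_decode[OF \<tau>, of ?H c g "moves_of K T"] g K by auto
  qed
  ultimately show ?thesis using zs(1) by blast
qed

lemma pair_moves_eq: "pair_moves p q T = moves_of {p, q} T"
  by (simp add: pair_moves_def moves_of_def)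

lemma traces_extend:
  assumes "(p, M, Ts) \<in> set traces" "k \<noteq> p"
  shows "\<exists>T\<in>set Ts. pair_moves p p T = M \<and>
    (\<forall>a. a \<noteq> k \<longrightarrow> good_single T a \<and> (\<forall>b. b \<noteq> k \<longrightarrow> b \<noteq> a \<longrightarrow> good_pair T a b))"
proof -
  from bspec[OF traces_closed[unfolded list_all_iff[of _ traces]] assms(1)]
  have "\<forall>k\<in>set hues. k = p \<or> (\<exists>T\<in>set Ts. (\<forall>m\<in>set T. fst m \<noteq> k) \<and> pair_moves p p T = M \<and>
      (\<forall>a\<in>set hues. a = k \<or> good_single T a \<and> (\<forall>b\<in>set hues. b = k \<or> b = a \<or> good_pair T a b)))"
    unfolding list_all_iff list_ex_iff prod.case by (elim conjE)
  from bspec[OF this in_hues[of k]] assms(2)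
  obtain T where "T \<in> set Ts" "pair_moves p p T = M"
      "\<forall>a\<in>set hues. a = k \<or> good_single T a \<and> (\<forall>b\<in>set hues. b = k \<or> b = a \<or> good_pair T a b)"
    by blast
  then show ?thesis unfolding hue_UNIV[symmetric] by blast
qed

lemma views_extend:
  assumes "(p, q, M, Ts) \<in> set views" "a \<noteq> p" "a \<noteq> q"
  shows "\<exists>T\<in>set Ts. (\<forall>m\<in>set T. fst m = p \<or> fst m = q \<or> fst m = a) \<and> pair_moves p q T = M \<and>
    good_pair T p a \<and> good_pair T q a \<and> good_single T a"
proof -
  from bspec[OF views_closed[unfolded list_all_iff[of _ views]] assms(1)]
  have "\<forall>a\<in>set hues. a = p \<or> a = q \<or> (\<exists>T\<in>set Ts. (\<forall>m\<in>set T. fst m = p \<or> fst m = q \<or> fst m = a) \<and>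
      pair_moves p q T = M \<and> good_pair T p a \<and> good_pair T q a \<and> good_single T a)"
    unfolding list_all_iff list_ex_iff prod.case by (elim conjE)
  from bspec[OF this in_hues[of a]] assms(2,3) show ?thesis by blast
qed

lemma traces_start:
  assumes "p \<in> {h1, h5}"
  obtains M Ts where "(p, M, Ts) \<in> set traces" "fst ` set M \<subseteq> {p}"
proof -
  have "list_all (\<lambda>p. list_ex (\<lambda>(p', M, _). p' = p \<and> list_all (\<lambda>m. fst m = p) M) traces) [h1, h5]"
    by code_simp
  with assms have "list_ex (\<lambda>(p', M, _). p' = p \<and> list_all (\<lambda>m. fst m = p) M) traces"
    unfolding list_all_iff by auto
  then obtain y where y: "y \<in> set traces" "case y of (p', M, _) \<Rightarrow> p' = p \<and> list_all (\<lambda>m. fst m = p) M"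
    unfolding list_ex_iff by blast
  obtain p' M Ts where "y = (p', M, Ts)" by (cases y)
  with y that[of M Ts] show thesis by (auto simp: list_all_iff)
qed

lemma attach_isolated:
  assumes "c x \<in> {1..5}" "x \<notin> fst ` set ms" "snd ` set ms \<subseteq> {1..5}"
  shows "\<exists>zs. moves_of (- {x}) zs = ms \<and> fst ` set zs \<subseteq> insert x (fst ` set ms) \<and> snd ` set zs \<subseteq> {1..5} \<and>
    tracked c zs x"
proof -
  obtain \<tau> where \<tau>: "coding \<tau>" "\<tau> (c x) \<in> {h1, h5}" using coding_exists[OF assms(1)] by auto
  obtain M Ts where M: "(\<tau> (c x), M, Ts) \<in> set traces" "fst ` set M \<subseteq> {\<tau> (c x)}"
    by (rule traces_start[OF \<tau>(2)])
  then obtain zs where zs: "moves_of (- {x}) zs = ms" "fst ` set zs \<subseteq> insert x (fst ` set ms)" "snd ` set zs \<subseteq> {1..5}"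
      "encode \<tau> c (moves_of {x} zs) = moves_of {\<tau> (c x)} M"
    using attach[OF \<tau>(1), of "{}" "{\<tau> (c x)}" c "\<lambda>_. x" ms M] assms
    by (auto simp: moves_of_def encode_def)
  have "encode \<tau> c (moves_of {x} zs) = M"
    using zs(4) M(2) by (simp add: moves_of_all)
  with \<tau>(1) M(1) have "tracked c zs x" unfolding tracked_def by blast
  with zs show ?thesis by blast
qed

lemma attach_clique:
  assumes t: "tracked c ms s" and N: "finite N" "card N \<le> 3" "s \<notin> N" "N \<inter> fst ` set ms = {}"
    and inj: "inj_on c (insert s N)" and c: "c ` insert s N \<subseteq> {1..5}" and ms: "snd ` set ms \<subseteq> {1..5}"
  shows "\<exists>zs. moves_of (- N) zs = ms \<and> fst ` set zs \<subseteq> fst ` set ms \<union> insert s N \<and> snd ` set zs \<subseteq> {1..5} \<and>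
    (\<forall>y\<in>N. tracked c zs y) \<and> (\<forall>y\<in>insert s N. \<forall>z\<in>insert s N. y \<noteq> z \<longrightarrow> linked c zs y z)"
proof -
  from t obtain \<tau> M Ts where \<tau>: "coding \<tau>" and M: "(\<tau> (c s), M, Ts) \<in> set traces"
      "encode \<tau> c (moves_of {s} ms) = M"
    by (auto simp: tracked_def)
  let ?h = "\<lambda>y. \<tau> (c y)"
  have ih: "inj_on ?h (insert s N)"
    using comp_inj_on[OF inj inj_on_subset[OF coding_inj[OF \<tau>] c]] by (simp add: comp_def)
  have "card (?h ` insert s N) \<le> card (insert s N)" using N(1) by (intro card_image_le) simp
  also have "\<dots> \<le> 4" using N by simp
  also have "\<dots> < card (set hues)" by (simp add: hues_def)
  finally obtain k where k: "k \<notin> ?h ` insert s N"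
    using N(1) avoid_color[of "set hues" "?h ` insert s N"] by auto
  then have "k \<noteq> ?h s" by auto
  from traces_extend[OF M(1) this] obtain T where T: "pair_moves (?h s) (?h s) T = M"
      "\<And>a. a \<noteq> k \<Longrightarrow> good_single T a" "\<And>a b. a \<noteq> k \<Longrightarrow> b \<noteq> k \<Longrightarrow> b \<noteq> a \<Longrightarrow> good_pair T a b"
    by blast
  let ?H = "?h ` insert s N"
  define g where "g = inv_into (insert s N) ?h"
  have g: "g (?h y) = y" if "y \<in> insert s N" for y unfolding g_def by (rule inv_into_f_f[OF ih that])
  have gN: "g ` ?h ` Y = Y" if "Y \<subseteq> insert s N" for Y
    using g that by (force simp: image_image)
  have split: "{?h s} \<union> ?h ` N = ?H" by auto
  \<comment> \<open>A clique with fewer than four vertices follows only its part of the K4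
    schedule.\<close>
  define U where "U = moves_of ?H T"
  have U: "moves_of K U = moves_of K T" if "K \<subseteq> ?H" for K
    using that by (simp add: U_def Int_absorb2)
  have "\<exists>zs. moves_of (- g ` ?h ` N) zs = ms \<and> fst ` set zs \<subseteq> fst ` set ms \<union> g ` ({?h s} \<union> ?h ` N) \<and>
      snd ` set zs \<subseteq> {1..5} \<and> (\<forall>K\<subseteq>{?h s} \<union> ?h ` N. encode \<tau> c (moves_of (g ` K) zs) = moves_of K U)"
  proof (rule attach[OF \<tau>])
    show "c (g h) \<in> {1..5} \<and> \<tau> (c (g h)) = h" if "h \<in> {?h s} \<union> ?h ` N" for h
      using that g c by (auto simp: image_iff)
    show "{?h s} \<inter> ?h ` N = {}" using ih N(3) by (auto simp: inj_on_def)
    show "snd ` set ms \<subseteq> {1..5}" by (rule ms)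
    show "fst ` set ms \<inter> g ` ?h ` N = {}" using N(4) gN[of N] by auto
    show "fst ` set U \<subseteq> {?h s} \<union> ?h ` N" unfolding split U_def by (rule moves_of_simps(5))
    have "g ` {?h s} = {s}" using gN[of "{s}"] by simp
    then show "moves_of {?h s} U = encode \<tau> c (moves_of (g ` {?h s}) ms)"
      using U[of "{?h s}"] T(1) M(2) by (simp add: pair_moves_eq)
  qed
  then obtain zs where zs: "moves_of (- N) zs = ms" "fst ` set zs \<subseteq> fst ` set ms \<union> insert s N" "snd ` set zs \<subseteq> {1..5}"
      "\<And>K. K \<subseteq> ?H \<Longrightarrow> encode \<tau> c (moves_of (g ` K) zs) = moves_of K T"
    unfolding split gN[OF subset_insertI] gN[OF subset_refl] using U by auto
  have "tracked c zs y" if y: "y \<in> N" for y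
  proof (rule is_trace_tracked[OF \<tau>])
    have "?h y \<noteq> k" using k y by auto
    then have "is_trace (?h y) (moves_of {?h y} T)"
      using T(2)[of "?h y"] by (simp add: good_single_def pair_moves_eq)
    also have "moves_of {?h y} T = encode \<tau> c (moves_of {y} zs)"
      using zs(4)[of "{?h y}"] gN[of "{y}"] y by simp
    finally show "is_trace (?h y) (encode \<tau> c (moves_of {y} zs))" .
  qed
  moreover have "linked c zs y z" if y: "y \<in> insert s N" "z \<in> insert s N" "y \<noteq> z" for y z
  proof (rule is_view_linked[OF \<tau>])
    have "?h y \<noteq> k" "?h z \<noteq> k" using k y by auto
    moreover have "?h y \<noteq> ?h z" using ih y by (auto simp: inj_on_def)
    ultimately have "good_pair T (?h y) (?h z)" using T(3)[of "?h y" "?h z"] by simp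
    moreover have "moves_of {?h y, ?h z} T = encode \<tau> c (moves_of {y, z} zs)"
      using zs(4)[of "{?h y, ?h z}"] gN[of "{y, z}"] y by auto
    ultimately show "is_view (?h y) (?h z) (encode \<tau> c (moves_of {y, z} zs)) \<or>
        is_view (?h z) (?h y) (encode \<tau> c (moves_of {y, z} zs))"
      by (simp add: good_pair_def pair_moves_eq)
  qed
  ultimately show ?thesis using zs(1-3) by blast
qed

text \<open>The coding of the edge determines the hue of \<open>x\<close>, and with it the extension
  of the view. The two new edges are views up to a permutation, so they are linked under codings of
  their own.\<close>

lemma attach_to_edge:
  assumes l: "linked c ms s t" and x: "x \<notin> fst ` set ms" "x \<noteq> s" "x \<noteq> t" "c x \<noteq> c s" "c x \<noteq> c t"
    and c: "c s \<in> {1..5}" "c t \<in> {1..5}" "c x \<in> {1..5}" and ms: "snd ` set ms \<subseteq> {1..5}"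
  shows "\<exists>zs. moves_of (- {x}) zs = ms \<and> fst ` set zs \<subseteq> fst ` set ms \<union> {s, t, x} \<and> snd ` set zs \<subseteq> {1..5} \<and>
    tracked c zs x \<and> linked c zs x s \<and> linked c zs x t"
proof -
  from l obtain \<tau> p q M Ts where \<tau>: "coding \<tau>" and v: "(p, q, M, Ts) \<in> set views"
      and pq: "{\<tau> (c s), \<tau> (c t)} = {p, q}" and M: "encode \<tau> c (moves_of {s, t} ms) = M"
    by (auto simp: linked_def)
  have st: "s \<noteq> t" "c s \<noteq> c t"
    using linked_apart[OF l c(1,2) ms] apart_start[of s t c ms] by auto
  let ?h = "\<lambda>y. \<tau> (c y)" and ?V = "{s, t, x}"
  have "inj_on c ?V" using st x by auto
  then have ih: "inj_on ?h ?V"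
    using comp_inj_on[OF _ inj_on_subset[OF coding_inj[OF \<tau>]], of c ?V] c by (simp add: comp_def)
  have hx: "?h x \<noteq> p" "?h x \<noteq> q" 
  proof -
    have "?h x \<notin> {?h s, ?h t}" using inj_onD[OF ih, of x] x(2,3) by auto
    then show "?h x \<noteq> p" "?h x \<noteq> q" unfolding pq by simp_all
  qed
  from views_extend[OF v hx] obtain T where T: "\<forall>m\<in>set T. fst m = p \<or> fst m = q \<or> fst m = ?h x"
      "pair_moves p q T = M" "good_pair T p (?h x)" "good_pair T q (?h x)" "good_single T (?h x)"
    by blast
  define g where "g = inv_into ?V ?h"
  have g: "g (?h y) = y" if "y \<in> ?V" for y unfolding g_def by (rule inv_into_f_f[OF ih that])
  have gpq: "g ` {p, q} = {s, t}" using g unfolding pq[symmetric] by simp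
  have split: "{p, q} \<union> {?h x} = ?h ` ?V" using pq by auto
  have gV: "g ` ({p, q} \<union> {?h x}) = ?V" unfolding split using g by simp
  have "\<exists>zs. moves_of (- g ` {?h x}) zs = ms \<and> fst ` set zs \<subseteq> fst ` set ms \<union> g ` ({p, q} \<union> {?h x}) \<and>
      snd ` set zs \<subseteq> {1..5} \<and> (\<forall>K\<subseteq>{p, q} \<union> {?h x}. encode \<tau> c (moves_of (g ` K) zs) = moves_of K T)"
  proof (rule attach[OF \<tau>])
    show "c (g h) \<in> {1..5} \<and> \<tau> (c (g h)) = h" if "h \<in> {p, q} \<union> {?h x}" for h
    proof -
      from that obtain y where "h = ?h y" "y \<in> ?V" unfolding split by blast
      with g[of y] c show ?thesis by (elim insertE emptyE) simp_all
    qed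
    show "{p, q} \<inter> {?h x} = {}" using hx by auto
    show "snd ` set ms \<subseteq> {1..5}" by (rule ms)
    show "fst ` set ms \<inter> g ` {?h x} = {}" using x(1) g by auto
    show "fst ` set T \<subseteq> {p, q} \<union> {?h x}" using T(1) by auto
    show "moves_of {p, q} T = encode \<tau> c (moves_of (g ` {p, q}) ms)"
      using T(2) M unfolding gpq by (simp add: pair_moves_eq)
  qed
  then obtain zs where zs: "moves_of (- {x}) zs = ms" "fst ` set zs \<subseteq> fst ` set ms \<union> ?V" "snd ` set zs \<subseteq> {1..5}"
      "\<And>K. K \<subseteq> ?h ` ?V \<Longrightarrow> encode \<tau> c (moves_of (g ` K) zs) = moves_of K T"
    unfolding gV split using g by auto
  have "tracked c zs x"
  proof (rule is_trace_tracked[OF \<tau>])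
    have "encode \<tau> c (moves_of {x} zs) = moves_of {?h x} T" using zs(4)[of "{?h x}"] g by simp
    then show "is_trace (?h x) (encode \<tau> c (moves_of {x} zs))"
      using T(5) by (simp add: good_single_def pair_moves_eq)
  qed
  moreover have "linked c zs y x" if y: "y \<in> {s, t}" for y
  proof (rule is_view_linked[OF \<tau>])
    have "?h y \<in> {p, q}" unfolding pq[symmetric] using y by blast
    then have "good_pair T (?h y) (?h x)" using T(3,4) by (elim insertE emptyE) simp_all
    moreover have "{?h y, ?h x} \<subseteq> ?h ` ?V" "g ` {?h y, ?h x} = {y, x}" using g[of y] g[of x] y by auto
    with zs(4)[of "{?h y, ?h x}"] have "encode \<tau> c (moves_of {y, x} zs) = moves_of {?h y, ?h x} T" by simp
    ultimately show "is_view (?h y) (?h x) (encode \<tau> c (moves_of {y, x} zs)) \<or>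
        is_view (?h x) (?h y) (encode \<tau> c (moves_of {y, x} zs))"
      by (simp add: good_pair_def pair_moves_eq)
  qed
  then have "linked c zs x s" "linked c zs x t" by (auto intro: linked_sym)
  ultimately show ?thesis using zs(1-3) by blast
qed

text \<open>
  Identifying two equally colored neighbours of a vertex of degree 2, or joining them by an edge if
  their colors differ, is a contraction.  So every vertex \<open>v\<close> is represented by a token \<open>f v\<close>, and only
  common neighbours of adjacent tokens have to be handled.
\<close>

definition merged :: "'a set \<Rightarrow> ('a \<times> 'a) set \<Rightarrow> ('a \<Rightarrow> nat) \<Rightarrow> ('a \<Rightarrow> 'a) \<Rightarrow> ('a \<times> nat) list \<Rightarrow> bool" where
  "merged V R c f ms \<longleftrightarrow> f ` V \<subseteq> V \<and> (\<forall>v\<in>V. c (f v) = c v) \<and> fst ` set ms \<subseteq> V \<and> snd ` set ms \<subseteq> {1..5} \<and>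
     (\<forall>v\<in>V. tracked c ms (f v)) \<and> (\<forall>(u, v)\<in>R. linked c ms (f u) (f v))"

text \<open>\<open>\<phi>\<close> leads to the smaller graph and is the identity unless two
  neighbours were identified; \<open>f\<close> then yields the token. The new vertices in
  \<open>X\<close> are their own tokens.\<close>

lemma merged_extend:
  assumes G: "fgraph V R" and X: "X \<subseteq> V" "V' \<subseteq> V - X"
    and m: "merged V' R' c f ms"
    and \<phi>: "\<And>y. y \<in> V - X \<Longrightarrow> \<phi> y \<in> V' \<and> c (\<phi> y) = c y"
      "\<And>y z. (y, z) \<in> R \<Longrightarrow> y \<notin> X \<Longrightarrow> z \<notin> X \<Longrightarrow> (\<phi> y, \<phi> z) \<in> R'"
    and zs: "moves_of (- X) zs = ms" "fst ` set zs \<subseteq> V" "snd ` set zs \<subseteq> {1..5}" "\<And>y. y \<in> X \<Longrightarrow> tracked c zs y"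
      "\<And>y z. (y, z) \<in> R \<Longrightarrow> y \<in> X \<Longrightarrow> linked c zs y (if z \<in> X then z else f (\<phi> z))"
  shows "merged V R c (\<lambda>y. if y \<in> X then y else f (\<phi> y)) zs"
proof -
  let ?f = "\<lambda>y. if y \<in> X then y else f (\<phi> y)"
  have f: "f (\<phi> y) \<in> V'" "f (\<phi> y) \<notin> X" "c (f (\<phi> y)) = c y" "tracked c ms (f (\<phi> y))" if "y \<in> V - X" for y
    using \<phi>(1)[OF that] m X(2) by (auto simp: merged_def)
  have "linked c zs (?f u) (?f v)" if uv: "(u, v) \<in> R" for u v
  proof -
    have V: "u \<in> V" "v \<in> V" using fgraphD(5,6)[OF G uv] by auto
    consider "u \<in> X" | "u \<notin> X" "v \<in> X" | "u \<notin> X" "v \<notin> X" by blast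
    then show ?thesis
    proof cases
      case 1
      with zs(5)[OF uv] show ?thesis by simp
    next
      case 2
      with zs(5)[OF fgraphD(3)[OF G uv]] show ?thesis by (simp add: linked_sym)
    next
      case 3
      with \<phi>(2)[OF uv] m have "linked c ms (f (\<phi> u)) (f (\<phi> v))" by (auto simp: merged_def)
      moreover have "f (\<phi> u) \<in> - X" "f (\<phi> v) \<in> - X" using f V 3 by auto
      ultimately show ?thesis using 3 linked_moves_of[of _ "- X" _ c zs] zs(1) by simp
    qed
  qed
  moreover have "tracked c zs (?f v)" if "v \<in> V" for v
    using that zs(4)[of v] f[of v] tracked_moves_of[of "f (\<phi> v)" "- X" c zs] zs(1) by auto
  moreover have "?f y \<in> V" if "y \<in> V" for y using that f(1)[of y] X by (cases "y \<in> X") auto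
  then have "?f ` V \<subseteq> V" by blast
  moreover have "c (?f v) = c v" if "v \<in> V" for v using that f by auto
  ultimately show ?thesis using zs(2,3) by (simp add: merged_def case_prod_unfold)
qed

section \<open>Merged schedules by reduction of the graph\<close>

lemma merged_schedule:
  "fgraph V R \<Longrightarrow> \<not> has_K23 R \<Longrightarrow> proper V R {1..5} c \<Longrightarrow> \<exists>f ms. merged V R c f ms"
proof (induction "card V" arbitrary: V R rule: less_induct)
  case less
  note G = less.prems(1) and noK = less.prems(2) and pc = less.prems(3)
  note IH = less.hyps
  have nbrV: "y \<in> V \<and> z \<in> V" if "(y, z) \<in> R" for y z
    using fgraphD(5,6)[OF G that] by simp
  have c5: "c y \<in> {1..5}" if "y \<in> V" for y using pc that by (auto simp: proper_def)
  have sub: "\<exists>f ms. merged (V - X) (R \<inter> (V - X) \<times> (V - X)) c f ms" if X: "X \<subseteq> V" "X \<noteq> {}" for X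
  proof (rule IH)
    show "card (V - X) < card V" using X fgraphD(1)[OF G] by (intro psubset_card_mono) auto
    show "\<not> has_K23 (R \<inter> (V - X) \<times> (V - X))" using noK has_K23_mono[of "R \<inter> (V - X) \<times> (V - X)" R] by blast
  qed (rule fgraph_restrict[OF G] proper_restrict[OF pc])+
  show ?case
  proof (cases "V = {}")
    case True
    with fgraphD(2)[OF G] have "merged V R c id []" by (auto simp: merged_def)
    then show ?thesis by blast
  next
    case False
    from G False noK show ?thesis
    proof (cases rule: K23_free_cases)
      case (low x)
      let ?N = "R `` {x}"
      note irr = fgraphD(4)[OF G]
      have Nf: "finite ?N" "?N \<subseteq> V - {x}"
        using fgraphD[OF G] by (auto intro: rev_finite_subset[of V])
      have xV: "{x} \<subseteq> V" "{x} \<noteq> {}" using low by auto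
      consider (none) "?N = {}" | (one) u where "?N = {u}"
        | (same) u w where "?N = {u, w}" "u \<noteq> w" "c u = c w" | (diff) u w where "?N = {u, w}" "c u \<noteq> c w"
      proof -
        have "card ?N = 0 \<or> card ?N = 1 \<or> card ?N = 2" using low(2) by linarith
        then show thesis
        proof (elim disjE)
          assume "card ?N = 0"
          then show thesis using none Nf(1) by simp
        next
          assume "card ?N = 1"
          then show thesis using one by (auto simp: card_1_singleton_iff)
        next
          assume "card ?N = 2"
          then obtain u w where "?N = {u, w}" "u \<noteq> w" by (auto simp: card_2_iff)
          then show thesis using same diff by blast
        qed
      qed
      then show ?thesis
      proof cases
        case none
        obtain f ms where m: "merged (V - {x}) (R \<inter> (V - {x}) \<times> (V - {x})) c f ms" using sub[OF xV] by auto
        have ms: "fst ` set ms \<subseteq> V - {x}" "snd ` set ms \<subseteq> {1..5}" using m by (auto simp: merged_def)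
        have msV: "fst ` set ms \<subseteq> V" by (rule order.trans[OF ms(1)]) auto
        from ms(1) have "x \<notin> fst ` set ms" by blast
        from attach_isolated[of c, OF c5[OF low(1)] this ms(2)]
        obtain zs where zs: "moves_of (- {x}) zs = ms" "fst ` set zs \<subseteq> insert x (fst ` set ms)"
            "snd ` set zs \<subseteq> {1..5}" "tracked c zs x"
          by (elim exE conjE) (rule that; assumption)
        have "merged V R c (\<lambda>y. if y \<in> {x} then y else f ((\<lambda>y. y) y)) zs"
        proof (rule merged_extend[OF G xV(1) subset_refl m])
          show "fst ` set zs \<subseteq> V" by (rule order.trans[OF zs(2)]) (use msV low(1) in simp)
          show "linked c zs y (if z \<in> {x} then z else f z)" if "(y, z) \<in> R" "y \<in> {x}" for y z
            using that none by auto
        qed (use zs(1,3,4) nbrV in auto)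
        then show ?thesis by blast
      next
        case (one u)
        have xu: "(x, u) \<in> R" using one by auto
        have u: "u \<in> V - {x}" "c u \<noteq> c x" using one Nf(2) pc xu by (auto simp: proper_def)
        obtain f ms where m: "merged (V - {x}) (R \<inter> (V - {x}) \<times> (V - {x})) c f ms" using sub[OF xV] by auto
        have ms: "fst ` set ms \<subseteq> V - {x}" "snd ` set ms \<subseteq> {1..5}" using m by (auto simp: merged_def)
        have msV: "fst ` set ms \<subseteq> V" by (rule order.trans[OF ms(1)]) auto
        have fu: "f u \<in> V - {x}" "c (f u) = c u" "tracked c ms (f u)" using m u by (auto simp: merged_def)
        have "\<exists>zs. moves_of (- {x}) zs = ms \<and> fst ` set zs \<subseteq> fst ` set ms \<union> insert (f u) {x} \<and> snd ` set zs \<subseteq> {1..5} \<and>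
            (\<forall>y\<in>{x}. tracked c zs y) \<and> (\<forall>y\<in>insert (f u) {x}. \<forall>z\<in>insert (f u) {x}. y \<noteq> z \<longrightarrow> linked c zs y z)"
          by (rule attach_clique[OF fu(3)]) (use ms fu u c5 low(1) in auto)
        then obtain zs where zs: "moves_of (- {x}) zs = ms" "fst ` set zs \<subseteq> fst ` set ms \<union> insert (f u) {x}"
            "snd ` set zs \<subseteq> {1..5}" "\<forall>y\<in>{x}. tracked c zs y"
            "\<forall>y\<in>insert (f u) {x}. \<forall>z\<in>insert (f u) {x}. y \<noteq> z \<longrightarrow> linked c zs y z"
          by (elim exE conjE) (rule that; assumption)
        have xfu: "linked c zs x (f u)" using zs(5) fu(1) by auto
        have "merged V R c (\<lambda>y. if y \<in> {x} then y else f ((\<lambda>y. y) y)) zs"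
        proof (rule merged_extend[OF G xV(1) subset_refl m])
          show "fst ` set zs \<subseteq> V" by (rule order.trans[OF zs(2)]) (use msV low(1) fu(1) in simp)
          show "linked c zs y (if z \<in> {x} then z else f z)" if "(y, z) \<in> R" "y \<in> {x}" for y z
          proof -
            have "z = u" using that one by auto
            then show ?thesis using that(2) xfu u by simp
          qed
        qed (use zs(1,3,4) nbrV in auto)
        then show ?thesis by blast
      next
        case (diff u w)
        have xu: "(x, u) \<in> R" "(x, w) \<in> R" using diff by auto
        have uw: "u \<in> V - {x}" "w \<in> V - {x}" "c u \<noteq> c x" "c w \<noteq> c x" using diff Nf(2) pc xu by (auto simp: proper_def)
        \<comment> \<open>The colors of \<open>u\<close> and \<open>w\<close> differ, so the edge
          can be added. It makes the tokens of \<open>u\<close> and \<open>w\<close> linked, and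
          \<open>x\<close> becomes a common neighbour of two linked tokens.\<close>
        let ?R = "R \<inter> (V - {x}) \<times> (V - {x}) \<union> {(u, w), (w, u)}"
        have "\<exists>f ms. merged (V - {x}) ?R c f ms"
        proof (rule IH)
          show "card (V - {x}) < card V" using low(1) fgraphD(1)[OF G] by (intro psubset_card_mono) auto
          show "fgraph (V - {x}) ?R"
          proof -
            have "sym (R \<inter> (V - {x}) \<times> (V - {x}))" using fgraph_restrict[OF G, of "{x}"] by (simp add: fgraph_def)
            moreover have "sym {(u, w), (w, u)}" by (auto simp: sym_def)
            ultimately have "sym ?R" by (rule sym_Un)
            moreover have "irrefl ?R" using irr diff(2) by (auto simp: irrefl_def)
            moreover have "?R \<subseteq> (V - {x}) \<times> (V - {x})" using uw by auto
            ultimately show ?thesis using fgraphD(1)[OF G] by (simp add: fgraph_def)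
          qed
          show "proper (V - {x}) ?R {1..5} c" using proper_restrict[OF pc, of "{x}"] diff(2) by (auto simp: proper_def)
          \<comment> \<open>Contracting \<open>x\<close> into \<open>u\<close> turns the edge from
            \<open>x\<close> to \<open>w\<close> into the added one.\<close>
          let ?\<phi> = "\<lambda>y. if y = x then u else y"
          show "\<not> has_K23 ?R"
          proof
            assume "has_K23 ?R"
            then have "has_K23 R"
            proof (rule has_K23_pullback[where D = UNIV and \<phi> = ?\<phi>])
              fix a b assume ab: "(a, b) \<in> ?R"
              show "\<exists>y\<in>UNIV. \<exists>z\<in>UNIV. ?\<phi> y = a \<and> ?\<phi> z = b \<and> (y, z) \<in> R"
              proof (cases "(a, b) \<in> R \<inter> (V - {x}) \<times> (V - {x})")
                case True
                then show ?thesis by (intro bexI[of _ a] bexI[of _ b]) auto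
              next
                case False
                with ab have "(a, b) = (u, w) \<or> (a, b) = (w, u)" by auto
                moreover have "(w, x) \<in> R" by (rule fgraphD(3)[OF G xu(2)])
                moreover have "?\<phi> x = u" "?\<phi> w = w" using uw by auto
                ultimately show ?thesis using xu(2) by (metis UNIV_I prod.inject)
              qed
            next
              fix a assume "a \<in> Field ?R"
              then have ax: "a \<noteq> x" using uw by (auto simp: Field_def)
              show "conn R {y \<in> UNIV. ?\<phi> y = a}"
              proof (cases "a = u")
                case True
                have S: "{y \<in> UNIV. ?\<phi> y = a} = {u, x}" using True by auto
                have "(u, x) \<in> R" by (rule fgraphD(3)[OF G xu(1)])
                with xu(1) show ?thesis unfolding S by (auto simp: conn_def)
              next
                case False
                then have "{y \<in> UNIV. ?\<phi> y = a} = {a}" using ax by auto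
                then show ?thesis by (simp add: conn_singleton)
              qed
            qed
            with noK show False ..
          qed
        qed
        then obtain f ms where m: "merged (V - {x}) ?R c f ms" by auto
        have ms: "fst ` set ms \<subseteq> V - {x}" "snd ` set ms \<subseteq> {1..5}" using m by (auto simp: merged_def)
        have msV: "fst ` set ms \<subseteq> V" by (rule order.trans[OF ms(1)]) auto
        have f: "f u \<in> V - {x}" "f w \<in> V - {x}" "c (f u) = c u" "c (f w) = c w" "linked c ms (f u) (f w)"
          using m uw by (auto simp: merged_def)
        have "\<exists>zs. moves_of (- {x}) zs = ms \<and> fst ` set zs \<subseteq> fst ` set ms \<union> {f u, f w, x} \<and> snd ` set zs \<subseteq> {1..5} \<and>
            tracked c zs x \<and> linked c zs x (f u) \<and> linked c zs x (f w)"
          by (rule attach_to_edge[OF f(5)]) (use ms f uw c5 low(1) in auto)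
        then obtain zs where zs: "moves_of (- {x}) zs = ms" "fst ` set zs \<subseteq> fst ` set ms \<union> {f u, f w, x}"
            "snd ` set zs \<subseteq> {1..5}" "tracked c zs x" "linked c zs x (f u)" "linked c zs x (f w)"
          by auto
        have "merged V R c (\<lambda>y. if y \<in> {x} then y else f ((\<lambda>y. y) y)) zs"
        proof (rule merged_extend[OF G xV(1) subset_refl m])
          show "fst ` set zs \<subseteq> V" by (rule order.trans[OF zs(2)]) (use msV low(1) f(1,2) in simp)
          show "linked c zs y (if z \<in> {x} then z else f z)" if "(y, z) \<in> R" "y \<in> {x}" for y z
          proof -
            have "z = u \<or> z = w" using that diff(1) by auto
            then show ?thesis using that(2) zs(5,6) uw by auto
          qed
        qed (use zs(1,3,4) nbrV in auto)
        then show ?thesis by blast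
      next
        case (same u w)
        have xu: "(x, u) \<in> R" "(x, w) \<in> R" "(u, x) \<in> R" "(w, x) \<in> R" using same fgraphD(3)[OF G] by auto
        have uw: "u \<in> V - {x}" "w \<in> V - {x}" "c u \<noteq> c x" using same Nf(2) pc xu by (auto simp: proper_def)
        have nuw: "(u, w) \<notin> R" "(w, u) \<notin> R" using pc same(3) by (auto simp: proper_def)
        \<comment> \<open>\<open>w\<close> is identified with \<open>u\<close>. Having the same
          color they are not adjacent, so no loop arises, and the coloring stays proper.\<close>
        let ?\<phi> = "\<lambda>y. if y = w then u else y"
        define R' where "R' = {(?\<phi> y, ?\<phi> z) | y z. (y, z) \<in> R \<and> y \<noteq> x \<and> z \<noteq> x}"
        let ?V = "V - {x, w}"
        have "\<exists>f ms. merged ?V R' c f ms"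
        proof (rule IH)
          show "card ?V < card V" using low(1) fgraphD(1)[OF G] by (intro psubset_card_mono) auto
          show "fgraph ?V R'"
          proof -
            have "R' \<subseteq> ?V \<times> ?V" using fgraphD(5,6)[OF G] uw same(2) by (auto simp: R'_def)
            moreover have "sym R'" using fgraphD(3)[OF G] by (auto simp: R'_def sym_def)
            moreover have "irrefl R'" using nuw irr by (auto simp: R'_def irrefl_def split: if_splits)
            ultimately show ?thesis using fgraphD(1)[OF G] by (simp add: fgraph_def)
          qed
          show "proper ?V R' {1..5} c"
            using pc same(3) by (fastforce simp: proper_def R'_def)
          \<comment> \<open>The identification arises by contracting both edges at \<open>x\<close>;
            the fiber of \<open>u\<close> is connected through \<open>x\<close>.\<close>
          let ?\<psi> = "\<lambda>y. if y = w \<or> y = x then u else y"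
          show "\<not> has_K23 R'"
          proof
            assume "has_K23 R'"
            then have "has_K23 R"
            proof (rule has_K23_pullback[where D = UNIV and \<phi> = ?\<psi>])
              fix a b assume "(a, b) \<in> R'"
              then obtain y z where "a = ?\<phi> y" "b = ?\<phi> z" "(y, z) \<in> R" "y \<noteq> x" "z \<noteq> x" by (auto simp: R'_def)
              then show "\<exists>y\<in>UNIV. \<exists>z\<in>UNIV. ?\<psi> y = a \<and> ?\<psi> z = b \<and> (y, z) \<in> R"
                by (intro bexI[of _ y] bexI[of _ z]) auto
            next
              fix a assume "a \<in> Field R'"
              then have ax: "a \<noteq> x" "a \<noteq> w" using uw same(2) by (auto simp: R'_def Field_def split: if_splits)
              show "conn R {y \<in> UNIV. ?\<psi> y = a}"
              proof (cases "a = u")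
                case True
                have S: "{y \<in> UNIV. ?\<psi> y = a} = {u, w, x}" using True by auto
                let ?S = "R \<inter> {u, w, x} \<times> {u, w, x}"
                have "(u, x) \<in> ?S" "(x, u) \<in> ?S" "(w, x) \<in> ?S" "(x, w) \<in> ?S" using xu by auto
                then have "(y, z) \<in> ?S\<^sup>*" if "y \<in> {u, w, x}" "z \<in> {u, w, x}" for y z
                  using that by (elim insertE emptyE) (auto intro: rtrancl_trans[OF r_into_rtrancl r_into_rtrancl])
                then show ?thesis unfolding S by (simp add: conn_def)
              next
                case False
                then have "{y \<in> UNIV. ?\<psi> y = a} = {a}" using ax by auto
                then show ?thesis by (simp add: conn_singleton)
              qed
            qed
            with noK show False ..
          qed
        qed
        then obtain f ms where m: "merged ?V R' c f ms" by auto
        have ms: "fst ` set ms \<subseteq> V - {x}" "snd ` set ms \<subseteq> {1..5}" using m by (auto simp: merged_def)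
        have msV: "fst ` set ms \<subseteq> V" by (rule order.trans[OF ms(1)]) auto
        have u: "u \<in> ?V" using uw same(2) by auto
        have fu: "f u \<in> V - {x}" "c (f u) = c u" "tracked c ms (f u)" using m u by (auto simp: merged_def)
        \<comment> \<open>Both neighbours of \<open>x\<close> now have the token \<open>f u\<close>,
          so \<open>x\<close> is attached like a pendant vertex.\<close>
        have "\<exists>zs. moves_of (- {x}) zs = ms \<and> fst ` set zs \<subseteq> fst ` set ms \<union> insert (f u) {x} \<and> snd ` set zs \<subseteq> {1..5} \<and>
            (\<forall>y\<in>{x}. tracked c zs y) \<and> (\<forall>y\<in>insert (f u) {x}. \<forall>z\<in>insert (f u) {x}. y \<noteq> z \<longrightarrow> linked c zs y z)"
          by (rule attach_clique[OF fu(3)]) (use ms fu uw c5 low(1) in auto)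
        then obtain zs where zs: "moves_of (- {x}) zs = ms" "fst ` set zs \<subseteq> fst ` set ms \<union> insert (f u) {x}"
            "snd ` set zs \<subseteq> {1..5}" "\<forall>y\<in>{x}. tracked c zs y"
            "\<forall>y\<in>insert (f u) {x}. \<forall>z\<in>insert (f u) {x}. y \<noteq> z \<longrightarrow> linked c zs y z"
          by (elim exE conjE) (rule that; assumption)
        have xfu: "linked c zs x (f u)" using zs(5) fu(1) by auto
        have VX: "?V \<subseteq> V - {x}" by auto
        have "merged V R c (\<lambda>y. if y \<in> {x} then y else f (?\<phi> y)) zs"
        proof (rule merged_extend[OF G xV(1) VX m])
          show "fst ` set zs \<subseteq> V" by (rule order.trans[OF zs(2)]) (use msV low(1) fu(1) in simp)
          show "?\<phi> y \<in> ?V \<and> c (?\<phi> y) = c y" if "y \<in> V - {x}" for y using that u same(3) by auto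
          show "(?\<phi> y, ?\<phi> z) \<in> R'" if "(y, z) \<in> R" "y \<notin> {x}" "z \<notin> {x}" for y z
            using that by (auto simp: R'_def)
          show "linked c zs y (if z \<in> {x} then z else f (?\<phi> z))" if "(y, z) \<in> R" "y \<in> {x}" for y z
          proof -
            have "z = u \<or> z = w" using that same(1) by auto
            then show ?thesis using that(2) xfu uw by auto
          qed
        qed (use zs(1,3,4) in auto)
        then show ?thesis by blast
      qed
    next
      case (leaf a b x v)
      let ?X = "{a, b, x}"
      have X: "?X \<subseteq> V" "?X \<noteq> {}" and v: "v \<in> V - ?X" using leaf(1,2) by auto
      have E: "(a, b) \<in> R" "(a, x) \<in> R" "(a, v) \<in> R" "(b, x) \<in> R" "(b, v) \<in> R" "(x, v) \<in> R"
        using leaf(3-5) by blast+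
      have cd: "distinct [c a, c b, c x, c v]" using pc E by (auto simp: proper_def)
      obtain f ms where m: "merged (V - ?X) (R \<inter> (V - ?X) \<times> (V - ?X)) c f ms" using sub[OF X] by auto
      have ms: "fst ` set ms \<subseteq> V - ?X" "snd ` set ms \<subseteq> {1..5}" using m by (auto simp: merged_def)
        have msV: "fst ` set ms \<subseteq> V" by (rule order.trans[OF ms(1)]) auto
      have fv: "f v \<in> V - ?X" "c (f v) = c v" "tracked c ms (f v)" using m v by (auto simp: merged_def)
      have "\<exists>zs. moves_of (- ?X) zs = ms \<and> fst ` set zs \<subseteq> fst ` set ms \<union> insert (f v) ?X \<and> snd ` set zs \<subseteq> {1..5} \<and>
          (\<forall>y\<in>?X. tracked c zs y) \<and> (\<forall>y\<in>insert (f v) ?X. \<forall>z\<in>insert (f v) ?X. y \<noteq> z \<longrightarrow> linked c zs y z)"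
      proof (rule attach_clique[OF fv(3)])
        show "card ?X \<le> 3" by (simp add: card_insert_if)
        show "inj_on c (insert (f v) ?X)" using cd fv(2) by auto
        show "c ` insert (f v) ?X \<subseteq> {1..5}" using c5 fv(1) X(1) by auto
      qed (use ms fv in auto)
      then obtain zs where zs: "moves_of (- ?X) zs = ms" "fst ` set zs \<subseteq> fst ` set ms \<union> insert (f v) ?X"
          "snd ` set zs \<subseteq> {1..5}" "\<forall>y\<in>?X. tracked c zs y"
          "\<forall>y\<in>insert (f v) ?X. \<forall>z\<in>insert (f v) ?X. y \<noteq> z \<longrightarrow> linked c zs y z"
        by (elim exE conjE) (rule that; assumption)
      have "merged V R c (\<lambda>y. if y \<in> ?X then y else f ((\<lambda>y. y) y)) zs"
      proof (rule merged_extend[OF G X(1) subset_refl m])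
        show "fst ` set zs \<subseteq> V" by (rule order.trans[OF zs(2)]) (use msV X(1) fv(1) in simp)
        show "linked c zs y (if z \<in> ?X then z else f z)" if yz: "(y, z) \<in> R" "y \<in> ?X" for y z
        proof -
          have "z \<in> R `` {y}" using yz by auto
          then have "z \<in> insert v ?X" using yz(2) leaf(3-5) by (elim insertE emptyE) auto
          then have z: "(if z \<in> ?X then z else f z) \<in> insert (f v) ?X" by auto
          have "y \<noteq> (if z \<in> ?X then z else f z)"
            using yz fgraphD(7)[OF G yz(1)] \<open>z \<in> insert v ?X\<close> fv(1) by (auto split: if_splits)
          with zs(5) yz(2) z show ?thesis by blast
        qed
        show "tracked c zs y" if "y \<in> ?X" for y using zs(4) that by blast
      qed (use zs(1,3) nbrV in auto)
      then show ?thesis by blast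
    qed
  qed
qed

text \<open>A move of a token is carried out by all vertices that it represents, one after the other.\<close>

definition spread :: "('a \<Rightarrow> 'a) \<Rightarrow> 'a list \<Rightarrow> ('a \<times> 'c) list \<Rightarrow> ('a \<times> 'c) list" where
  "spread f vs ms = concat (map (\<lambda>m. map (\<lambda>v. (v, snd m)) (filter (\<lambda>v. f v = fst m) vs)) ms)"

lemma set_spread: "m \<in> set (spread f vs ms) \<Longrightarrow> fst m \<in> set vs \<and> snd m \<in> snd ` set ms"
  by (force simp: spread_def)

lemma moves_of_spread_single:
  assumes "distinct vs" "u \<in> set vs"
  shows "moves_of {u} (spread f vs ms) = map (map_prod (\<lambda>_. u) id) (moves_of {f u} ms)"
proof (induction ms)
  case (Cons m ms)
  have "moves_of {u} (map (\<lambda>v. (v, snd m)) (filter (\<lambda>v. f v = fst m) vs)) =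
      map (\<lambda>v. (v, snd m)) (filter (\<lambda>v. v = u \<and> f v = fst m) vs)"
    by (simp add: moves_of_def filter_map comp_def conj_commute)
  also have "filter (\<lambda>v. v = u \<and> f v = fst m) vs = (if f u = fst m then [u] else [])"
    using assms by (induction vs) (auto simp: filter_empty_conv)
  finally show ?case using Cons by (cases m) (simp add: spread_def)
qed (simp add: spread_def)

text \<open>Adjacent vertices have linked, hence different tokens. A move of either token then
  becomes one move of the corresponding end, so the edge sees exactly the schedule of its
  tokens.\<close>

lemma moves_of_spread_pair:
  assumes "distinct vs" "u \<in> set vs" "v \<in> set vs" "f u \<noteq> f v"
  shows "moves_of {u, v} (spread f vs ms) =
    map (map_prod (\<lambda>s. if s = f u then u else v) id) (moves_of {f u, f v} ms)"
proof (induction ms)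
  case (Cons m ms)
  have "moves_of {u, v} (map (\<lambda>v. (v, snd m)) (filter (\<lambda>v. f v = fst m) vs)) =
      map (\<lambda>v. (v, snd m)) (filter (\<lambda>w. (w = u \<or> w = v) \<and> f w = fst m) vs)"
    by (simp add: moves_of_def filter_map comp_def conj_commute)
  also have "filter (\<lambda>w. (w = u \<or> w = v) \<and> f w = fst m) vs =
      (if f u = fst m then [u] else if f v = fst m then [v] else [])"
  proof -
    have one: "filter (\<lambda>w. w = y) vs = [y]" if "y \<in> set vs" for y
      using assms(1) that by (induction vs) (auto simp: filter_empty_conv)
    have "filter (\<lambda>w. (w = u \<or> w = v) \<and> f w = fst m) vs =
        (if f u = fst m then filter (\<lambda>w. w = u) vs else if f v = fst m then filter (\<lambda>w. w = v) vs else [])"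
      using assms(4) by (auto intro!: filter_cong simp: filter_empty_conv)
    then show ?thesis using one assms(2,3) by simp
  qed
  finally show ?case using Cons assms(4) by (cases m) (auto simp: spread_def)
qed (simp add: spread_def)

lemma apart_map_vertices:
  assumes "inj_on f {x, y}" "fst ` set ms \<subseteq> {x, y}" "d (f x) = c x" "d (f y) = c y"
  shows "apart (f x) (f y) d (map (map_prod f id) ms) \<longleftrightarrow> apart x y c ms"
  by (rule apart_map[where X = "{x, y}" and K = UNIV]) (use assms in auto)

section \<open>Assembling the transformation for five colors\<close>

lemma reduce_to_four_colors:
  assumes G: "fgraph V R" and "\<not> has_K23 R" and pc: "proper V R {1..5::nat} c"
  shows "\<exists>ms. set ms \<subseteq> V \<times> {1..5} \<and> (\<forall>(x, y)\<in>R. apart x y c ms) \<and>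
    (\<forall>x\<in>V. recolor ms c x \<in> {1..4} \<and> num_moves ms x \<le> 2)"
proof -
  obtain f ms where m: "merged V R c f ms" using merged_schedule[OF assms] by auto
  obtain vs where vs: "set vs = V" "distinct vs" using fgraphD(1)[OF G] finite_distinct_list by blast
  define zs where "zs = spread f vs ms"
  have ms5: "snd ` set ms \<subseteq> {1..5}" using m by (simp add: merged_def)
  have c5: "c y \<in> {1..5}" if "y \<in> V" for y using pc that by (auto simp: proper_def)
  have f: "f y \<in> V" "c (f y) = c y" "tracked c ms (f y)" if "y \<in> V" for y
    using m that by (auto simp: merged_def)
  have "set zs \<subseteq> V \<times> {1..5}"
  proof
    fix z assume "z \<in> set zs"
    then have "fst z \<in> V \<and> snd z \<in> snd ` set ms" using set_spread[of z f vs ms] vs by (simp add: zs_def)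
    then show "z \<in> V \<times> {1..5}" using ms5 by (cases z) auto
  qed
  moreover have "apart x y c zs" if xy: "(x, y) \<in> R" for x y
  proof -
    have V: "x \<in> V" "y \<in> V" using fgraphD(5,6)[OF G xy] by auto
    have l: "linked c ms (f x) (f y)" using m xy by (auto simp: merged_def)
    have st: "f x \<noteq> f y" "apart (f x) (f y) c ms"
      using linked_apart[OF l] c5[OF f(1)] V ms5 by auto
    let ?g = "\<lambda>s. if s = f x then x else y"
    have "apart (f x) (f y) c (moves_of {f x, f y} ms)" using st(2) by (simp add: apart_moves_of)
    moreover have "x \<noteq> y" using st(1) by auto
    moreover have "fst ` set (moves_of {f x, f y} ms) \<subseteq> {f x, f y}" by (rule moves_of_simps(5))
    ultimately have "apart (?g (f x)) (?g (f y)) c (map (map_prod ?g id) (moves_of {f x, f y} ms))"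
      using st(1) f(2)[OF V(1)] f(2)[OF V(2)]
      by (subst apart_map_vertices[where c = c and f = ?g]) (auto simp: inj_on_def)
    then have "apart x y c (map (map_prod ?g id) (moves_of {f x, f y} ms))" using st(1) by simp
    also have "map (map_prod ?g id) (moves_of {f x, f y} ms) = moves_of {x, y} zs"
      unfolding zs_def by (rule moves_of_spread_pair[symmetric]) (use vs V st in auto)
    finally show ?thesis by (simp add: apart_moves_of)
  qed
  moreover have "recolor zs c x \<in> {1..4} \<and> num_moves zs x \<le> 2" if x: "x \<in> V" for x
  proof -
    have mx: "moves_of {x} zs = map (map_prod (\<lambda>_. x) id) (moves_of {f x} ms)"
      unfolding zs_def by (rule moves_of_spread_single) (use vs x in auto)
    note b = tracked_bounds[OF f(3)[OF x] c5[OF f(1)[OF x]] ms5]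
    have "num_moves zs x = num_moves ms (f x)" by (simp add: num_moves_def mx)
    moreover have "recolor zs c x = recolor ms c (f x)"
    proof -
      have "recolor zs c x = recolor (moves_of {x} zs) c x" by (simp add: recolor_moves_of)
      also have "\<dots> = last (c x # map snd (moves_of {x} zs))" by (rule recolor_last) (rule moves_of_simps(5))
      also have "\<dots> = last (c (f x) # map snd (moves_of {f x} ms))" using f(2)[OF x] by (simp add: mx comp_def)
      also have "\<dots> = recolor (moves_of {f x} ms) c (f x)" by (rule recolor_last[symmetric]) (rule moves_of_simps(5))
      also have "\<dots> = recolor ms c (f x)" by (simp add: recolor_moves_of)
      finally show ?thesis .
    qed
    ultimately show ?thesis using b by simp
  qed
  ultimately show ?thesis by (intro exI[of _ zs]) auto
qed

lemma recolor_set: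
  assumes "distinct xs"
  shows "recolor (map (\<lambda>x. (x, h x)) xs) c = (\<lambda>x. if x \<in> set xs then h x else c x)"
    "num_moves (map (\<lambda>x. (x, h x)) xs) x = (if x \<in> set xs then 1 else 0)"
  using assms by (induction xs arbitrary: c) auto

lemma apart_set:
  assumes "distinct xs" "\<not> (x \<in> set xs \<and> y \<in> set xs)" "c x \<noteq> c y"
    and "x \<in> set xs \<Longrightarrow> h x \<noteq> c y" "y \<in> set xs \<Longrightarrow> c x \<noteq> h y"
  shows "apart x y c (map (\<lambda>x. (x, h x)) xs)"
proof -
  have M: "apart x y c (map (\<lambda>x. (x, h x)) xs)"
    if "x \<notin> set xs" "c x \<noteq> c y" "y \<in> set xs \<Longrightarrow> c x \<noteq> h y" for x y
    by (rule apart_const) (use that in auto)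
  show ?thesis
  proof (cases "x \<in> set xs")
    case True
    with assms have "apart y x c (map (\<lambda>x. (x, h x)) xs)" by (intro M) auto
    then show ?thesis by (simp add: apart_sym)
  qed (use assms M in auto)
qed

text \<open>Color 5 occurs neither in the two colorings nor in the moves outside \<open>I\<close>,
  so vertices parked there are never in the way, and by independence not in each other's. They move
  twice, the others at most three times.\<close>

lemma recolor_four_colors:
  assumes G: "fgraph V R" and "\<not> has_K23 R" and pc: "proper V R {1..4::nat} c" and pd: "proper V R {1..4} d"
  shows "\<exists>ms. set ms \<subseteq> V \<times> {1..5} \<and> (\<forall>(x, y)\<in>R. apart x y c ms) \<and>
    (\<forall>x\<in>V. recolor ms c x = d x \<and> num_moves ms x \<le> 3)"
proof -
  obtain I ms where I: "I \<subseteq> V" "\<forall>(y, z)\<in>R. \<not> (y \<in> I \<and> z \<in> I)" and ms: "set ms \<subseteq> (V - I) \<times> {1..4}"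
      "\<forall>(y, z)\<in>R. y \<notin> I \<longrightarrow> z \<notin> I \<longrightarrow> apart y z c ms" "\<forall>y\<in>V - I. recolor ms c y = d y \<and> num_moves ms y \<le> 3"
    using recolor_around_independent[OF _ _ assms] by (elim meta_impE exE conjE) auto
  obtain xs where xs: "set xs = I" "distinct xs"
    using finite_subset[OF I(1) fgraphD(1)[OF G]] finite_distinct_list by blast
  define A where "A = map (\<lambda>x. (x, 5 :: nat)) xs"
  define B where "B = map (\<lambda>x. (x, d x)) xs"
  define c1 where "c1 = recolor A c"
  define c2 where "c2 = recolor ms c1"
  have c4: "c y \<in> {1..4}" "d y \<in> {1..4}" if "y \<in> V" for y using pc pd that by (auto simp: proper_def)
  have c1: "c1 y = (if y \<in> I then 5 else c y)" for y
    using recolor_set(1)[OF xs(2), of "\<lambda>_. 5" c] by (simp add: c1_def A_def xs(1))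
  have notI: "y \<notin> fst ` set ms" if "y \<in> I" for y using that ms(1) by auto
  have c2: "c2 y = (if y \<in> I then 5 else d y)" if "y \<in> V" for y
  proof (cases "y \<in> I")
    case True
    then show ?thesis using recolor_notin[OF notI[OF True], of c1] by (simp add: c2_def c1)
  next
    case False
    then have "recolor ms c1 y = recolor ms c y" by (intro recolor_cong) (simp add: c1)
    then show ?thesis using False that ms(3) by (simp add: c2_def)
  qed
  have A: "apart x y c A" if xy: "(x, y) \<in> R" for x y
    unfolding A_def
  proof (rule apart_set[OF xs(2)])
    have V: "x \<in> V" "y \<in> V" using fgraphD(5,6)[OF G xy] by auto
    show "5 \<noteq> c y" "c x \<noteq> 5" using c4(1)[OF V(1)] c4(1)[OF V(2)] by auto
    show "c x \<noteq> c y" using pc xy by (auto simp: proper_def)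
    show "\<not> (x \<in> set xs \<and> y \<in> set xs)" using I(2) xy xs(1) by auto
  qed
  have half: "apart x y c1 ms" if xy: "(x, y) \<in> R" "x \<in> I" for x y
  proof (rule apart_const)
    have y: "y \<in> V" "y \<notin> I" using fgraphD(6)[OF G xy(1)] I(2) xy by auto
    show "x \<notin> fst ` set ms" by (rule notI[OF xy(2)])
    show "c1 y \<noteq> c1 x" using y xy(2) c4(1)[OF y(1)] by (auto simp: c1)
    show "k \<noteq> c1 x" if "(y, k) \<in> set ms" for k using ms(1) that xy(2) by (auto simp: c1)
  qed
  have M: "apart x y c1 ms" if xy: "(x, y) \<in> R" for x y
  proof -
    consider "x \<in> I" | "y \<in> I" | "x \<notin> I" "y \<notin> I" by blast
    then show ?thesis
    proof cases
      case 2
      then show ?thesis using half[OF fgraphD(3)[OF G xy]] by (simp add: apart_sym)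
    next
      case 3
      then have "apart x y c1 ms \<longleftrightarrow> apart x y c ms" by (intro apart_cong) (auto simp: c1)
      then show ?thesis using 3 ms(2) xy by auto
    qed (rule half[OF xy])
  qed
  have B: "apart x y c2 B" if xy: "(x, y) \<in> R" for x y
    unfolding B_def
  proof (rule apart_set[OF xs(2)])
    have V: "x \<in> V" "y \<in> V" using fgraphD(5,6)[OF G xy] by auto
    have dxy: "d x \<noteq> d y" using pd xy by (auto simp: proper_def)
    show n: "\<not> (x \<in> set xs \<and> y \<in> set xs)" using I(2) xy xs(1) by auto
    show "c2 x \<noteq> c2 y" using apart_end[OF M[OF xy]] by (simp add: c2_def)
    show "d x \<noteq> c2 y" if "x \<in> set xs" using that n dxy xs(1) by (simp add: c2[OF V(2)])
    show "c2 x \<noteq> d y" if "y \<in> set xs" using that n dxy xs(1) by (simp add: c2[OF V(1)])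
  qed
  let ?zs = "A @ ms @ B"
  have "set ?zs \<subseteq> V \<times> {1..5}"
  proof -
    have "set A \<subseteq> V \<times> {1..5}" "set B \<subseteq> V \<times> {1..5}" using I(1) c4(2) xs(1) by (fastforce simp: A_def B_def)+
    moreover have "set ms \<subseteq> V \<times> {1..5}" using ms(1) by fastforce
    ultimately show ?thesis by simp
  qed
  moreover have "apart x y c ?zs" if "(x, y) \<in> R" for x y
    using A[OF that] M[OF that] B[OF that] by (simp add: apart_append c1_def[symmetric] c2_def[symmetric])
  moreover have "recolor ?zs c x = d x \<and> num_moves ?zs x \<le> 3" if x: "x \<in> V" for x
  proof -
    have "recolor ?zs c x = recolor B c2 x" by (simp add: c1_def c2_def)
    also have "\<dots> = d x" using x by (simp add: B_def recolor_set(1)[OF xs(2)] xs(1) c2)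
    finally have "recolor ?zs c x = d x" .
    moreover have "num_moves ?zs x \<le> 3"
    proof (cases "x \<in> I")
      case True
      then show ?thesis using num_moves_eq_0[OF notI[OF True]] by (simp add: A_def B_def recolor_set(2)[OF xs(2)] xs(1))
    next
      case False
      then show ?thesis using ms(3) x by (simp add: A_def B_def recolor_set(2)[OF xs(2)] xs(1))
    qed
    ultimately show ?thesis by simp
  qed
  ultimately show ?thesis by (intro exI[of _ ?zs]) auto
qed

text \<open>The bound is 2 + 3 + 2: both colorings are reduced, and the reduction of
  \<open>d\<close> is undone at the end.\<close>

lemma recolor_five_colors:
  assumes G: "fgraph V R" and noK: "\<not> has_K23 R" and pc: "proper V R {1..5::nat} c" and pd: "proper V R {1..5} d"
  shows "\<exists>ms. set ms \<subseteq> V \<times> {1..5} \<and> (\<forall>(x, y)\<in>R. apart x y c ms) \<and>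
    (\<forall>x\<in>V. recolor ms c x = d x \<and> num_moves ms x \<le> 7)"
proof -
  obtain A where A: "set A \<subseteq> V \<times> {1..5}" "\<forall>(x, y)\<in>R. apart x y c A"
      "\<forall>x\<in>V. recolor A c x \<in> {1..4} \<and> num_moves A x \<le> 2"
    using reduce_to_four_colors[OF G noK pc] by auto
  obtain C where C: "set C \<subseteq> V \<times> {1..5}" "\<forall>(x, y)\<in>R. apart x y d C"
      "\<forall>x\<in>V. recolor C d x \<in> {1..4} \<and> num_moves C x \<le> 2"
    using reduce_to_four_colors[OF G noK pd] by auto
  define c1 where "c1 = recolor A c"
  define d1 where "d1 = recolor C d"
  have "proper V R {1..4} c1" "proper V R {1..4} d1"
    using A C apart_end unfolding proper_def c1_def d1_def by (fastforce simp: image_subset_iff)+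
  then obtain B where B: "set B \<subseteq> V \<times> {1..5}" "\<forall>(x, y)\<in>R. apart x y c1 B"
      "\<forall>x\<in>V. recolor B c1 x = d1 x \<and> num_moves B x \<le> 3"
    using recolor_four_colors[OF G noK] by blast
  define c2 where "c2 = recolor B c1"
  let ?zs = "A @ B @ undo C d"
  have fC: "fst ` set C \<subseteq> V" using C(1) by auto
  have d5: "d ` V \<subseteq> {1..5}" using pd by (simp add: proper_def)
  have "set (undo C d) \<subseteq> V \<times> {1..5}"
  proof
    fix m assume m: "m \<in> set (undo C d)"
    then have "fst m \<in> V" using fst_undo[of C d] fC by (metis image_eqI subsetD)
    moreover have "snd m \<in> {1..5}"
    proof -
      have "snd m \<in> snd ` set C \<union> d ` fst ` set C" using snd_undo[of C d] m by blast
      moreover have "d ` fst ` set C \<subseteq> {1..5}" using d5 fC by blast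
      moreover have "snd ` set C \<subseteq> {1..5}" using C(1) by auto
      ultimately show ?thesis by blast
    qed
    ultimately show "m \<in> V \<times> {1..5}" by (simp add: mem_Times_iff)
  qed
  then have "set ?zs \<subseteq> V \<times> {1..5}" using A(1) B(1) by simp
  moreover have "apart x y c ?zs" if xy: "(x, y) \<in> R" for x y
  proof -
    have "x \<in> V" "y \<in> V" using fgraphD(5,6)[OF G xy] by auto
    then have "apart x y c2 (undo C d) \<longleftrightarrow> apart x y (recolor C d) (undo C d)"
      using B(3) by (intro apart_cong) (auto simp: c2_def d1_def)
    moreover have "apart x y (recolor C d) (undo C d)" using C(2) xy by (auto simp: apart_undo)
    ultimately show ?thesis using A(2) B(2) xy by (auto simp: apart_append c1_def c2_def)
  qed
  moreover have "recolor ?zs c x = d x \<and> num_moves ?zs x \<le> 7" if x: "x \<in> V" for x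
  proof -
    have "recolor ?zs c x = recolor (undo C d) c2 x" by (simp add: c1_def c2_def)
    also have "\<dots> = recolor (undo C d) (recolor C d) x"
      using B(3) x by (intro recolor_cong) (simp add: c2_def d1_def)
    finally show ?thesis using A(3) B(3) C(3) x by fastforce
  qed
  ultimately show ?thesis by (intro exI[of _ ?zs]) auto
qed

section \<open>Minors and paths of the reconfiguration graph\<close>

lemma connected_induce:
  assumes "conn (parcs G) S"
  shows "Digraph_Component.connected (with_proj G \<restriction> S)"
proof -
  let ?H = "mk_symmetric (with_proj G \<restriction> S)"
  have arcs: "parcs G \<inter> S \<times> S \<subseteq> parcs ?H"
    by (auto simp: parcs_mk_symmetric induce_subgraph_def with_proj_def)
  have V: "pverts ?H = S" by simp
  have "(x, y) \<in> rtrancl_on S (parcs ?H)" if "x \<in> S" "(x, y) \<in> (parcs G \<inter> S \<times> S)\<^sup>*" for x y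
    using that(2)
  proof (induction rule: rtrancl_induct)
    case (step y z)
    then show ?case using arcs by (auto intro: rtrancl_on_into_rtrancl_on)
  qed (use that(1) in simp)
  then show ?thesis
    using assms V unfolding connected_def strongly_connected_def reachable_def conn_def by simp
qed

lemma not_K23_minor_free:
  fixes G :: "'a pair_pre_digraph"
  assumes G: "fgraph (pverts G) (parcs G)" and "has_K23 (parcs G)"
  shows "\<not> K23_minor_free G"
proof -
  from assms(2) obtain h where h: "K23_model (parcs G) h" by (auto simp: has_K23_def)
  let ?U = "{0, 1} :: nat set" and ?W = "{2, 3, 4} :: nat set"
  define H where "H = \<lparr> pverts = ?U \<union> ?W, parcs = ?U \<times> ?W \<union> ?W \<times> ?U \<rparr>"
  have "K\<^bsub>2,3\<^esub> (with_proj H)"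
    unfolding complete_bipartite_digraph_pair_def
    by (intro conjI exI[of _ ?U] exI[of _ ?W]) (auto simp: H_def)
  moreover have "minor_of H G"
    unfolding minor_of_def
  proof (intro exI[of _ h] conjI)
    have edge: "\<exists>u\<in>h x. \<exists>v\<in>h y. (u, v) \<in> parcs G \<and> (v, u) \<in> parcs G" if "x \<in> ?U" "y \<in> ?W" for x y
      using K23_model_edge[OF h that] fgraphD(3)[OF G] by blast
    have five: "x < 5" if "x \<in> pverts H" for x using that by (auto simp: H_def)
    have conn: "conn (parcs G) (h x)" if "x \<in> pverts H" for x
      using h five[OF that] by (simp add: K23_model_def)
    have "h x \<subseteq> pverts G" if x: "x \<in> pverts H" for x
    proof
      fix u assume u: "u \<in> h x"
      have "\<exists>v\<in>h x. v \<in> pverts G"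
      proof -
        consider "x \<in> ?U" | "x \<in> ?W" using x by (auto simp: H_def)
        then show ?thesis
        proof cases
          case 1
          then obtain a b where "a \<in> h x" "(a, b) \<in> parcs G" using edge[of x 2] by auto
          then show ?thesis using fgraphD(5)[OF G] by blast
        next
          case 2
          then obtain a b where "a \<in> h x" "(a, b) \<in> parcs G" using edge[of 0 x] by auto
          then show ?thesis using fgraphD(5)[OF G] by blast
        qed
      qed
      then obtain v where v: "v \<in> h x" "v \<in> pverts G" by auto
      with conn[OF x] u have "(v, u) \<in> (parcs G \<inter> h x \<times> h x)\<^sup>*" by (simp add: conn_def)
      then show "u \<in> pverts G"
      proof (cases rule: rtranclE)
        case base
        with v show ?thesis by simp
      next
        case (step w)
        then show ?thesis using fgraphD(6)[OF G] by blast
      qed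
    qed
    with conn show "\<forall>x\<in>pverts H. h x \<subseteq> pverts G \<and> Digraph_Component.connected (with_proj G \<restriction> h x)"
      by (simp add: connected_induce)
    show "\<forall>x\<in>pverts H. \<forall>y\<in>pverts H. x \<noteq> y \<longrightarrow> h x \<inter> h y = {}"
      using h five by (simp add: K23_model_def)
    show "\<forall>(x, y)\<in>parcs H. \<exists>u\<in>h x. \<exists>v\<in>h y. (u, v) \<in> parcs G"
    proof (intro ballI case_prodI2)
      fix e x y assume e: "e \<in> parcs H" "e = (x, y)"
      then have "x \<in> ?U \<and> y \<in> ?W \<or> x \<in> ?W \<and> y \<in> ?U" by (auto simp: H_def)
      then show "\<exists>u\<in>h x. \<exists>v\<in>h y. (u, v) \<in> parcs G" using edge by blast
    qed
  qed
  ultimately show ?thesis by (auto simp: K23_minor_free_def)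
qed

lemma fgraph_pair_graph:
  assumes "pair_graph G"
  shows "fgraph (pverts G) (parcs G)"
proof -
  interpret pair_graph G by fact
  have "sym (parcs G)" using sym_arcs by (simp add: symmetric_def)
  moreover have "(a, a) \<notin> parcs G" for a using no_loops[of "(a, a)"] by auto
  then have "irrefl (parcs G)" by (simp add: irrefl_def)
  moreover have "parcs G \<subseteq> pverts G \<times> pverts G" using in_arcsD1 in_arcsD2 by auto
  ultimately show ?thesis by (simp add: fgraph_def)
qed

section \<open>From moves to walks and paths of the reconfiguration graph\<close>

lemma recolorings_append [simp]: "recolorings (p @ q) v = recolorings p v + recolorings q v"
  by (simp add: recolorings_def)

text \<open>A transformation must be a path. Cutting a closed subwalk out of a walk keeps its ends
  and cannot raise the number of recolorings of any vertex.\<close>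

lemma awalk_imp_transformation:
  assumes "pair_graph G" and "pre_digraph.awalk (with_proj (reconf_graph G l)) \<alpha> p \<beta>"
  shows "\<exists>q. transformation G l \<alpha> q \<beta> \<and> (\<forall>v. recolorings q v \<le> recolorings p v)"
  using assms(2)
proof (induction "length p" arbitrary: p rule: less_induct)
  case less
  interpret pair_graph "reconf_graph G l" by (rule pair_graph_reconf_graph[OF assms(1)])
  show ?case
  proof (cases "distinct (awalk_verts \<alpha> p)")
    case True
    with less.prems have "transformation G l \<alpha> p \<beta>" by (simp add: transformation_def apath_def)
    then show ?thesis by blast
  next
    case False
    obtain q r s where qrs: "p = q @ r @ s" "0 < length r" "\<exists>w. awalk \<alpha> q w \<and> awalk w r w \<and> awalk w s \<beta>"
      using awalk_not_distinct_decomp[OF less.prems False] by blast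
    then have "awalk \<alpha> (q @ s) \<beta>" by auto
    with less.hyps[of "q @ s"] qrs(1,2) obtain t where
      "transformation G l \<alpha> t \<beta>" "\<forall>v. recolorings t v \<le> recolorings (q @ s) v" by auto
    then show ?thesis using qrs(1) by (intro exI[of _ t]) (auto intro: order.trans)
  qed
qed

lemma moves_imp_awalk:
  assumes G: "pair_graph G"
  shows "\<alpha> \<in> colorings G l \<Longrightarrow> set ms \<subseteq> pverts G \<times> {1..l} \<Longrightarrow> \<forall>(x, y)\<in>parcs G. apart x y \<alpha> ms \<Longrightarrow>
    \<exists>p. pre_digraph.awalk (with_proj (reconf_graph G l)) \<alpha> p (recolor ms \<alpha>) \<and>
      (\<forall>v. recolorings p v \<le> num_moves ms v)"
proof (induction ms arbitrary: \<alpha>)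
  case Nil
  interpret R: pair_graph "reconf_graph G l" by (rule pair_graph_reconf_graph[OF G])
  have "\<alpha> \<in> pverts (reconf_graph G l)" using Nil.prems(1) by (simp add: reconf_graph_def)
  then have "R.awalk \<alpha> [] \<alpha>" by (simp add: R.awalk_Nil_iff)
  then show ?case by (intro exI[of _ "[]"]) (simp add: recolorings_def)
next
  case (Cons m ms)
  interpret R: pair_graph "reconf_graph G l" by (rule pair_graph_reconf_graph[OF G])
  let ?\<gamma> = "\<alpha>(fst m := snd m)"
  have "m \<in> pverts G \<times> {1..l}" using Cons.prems(2) by simp
  then have m: "fst m \<in> pverts G" "snd m \<in> {1..l}" by (simp_all add: mem_Times_iff)
  have ap: "\<forall>(x, y)\<in>parcs G. apart x y ?\<gamma> ms"
    using Cons.prems(3) by (simp add: case_prod_unfold del: fun_upd_apply)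
  have "?\<gamma> \<in> pverts G \<rightarrow>\<^sub>E {1..l}"
    using Cons.prems(1) m by (auto simp: colorings_def PiE_iff extensional_def)
  moreover have "?\<gamma> x \<noteq> ?\<gamma> y" if "(x, y) \<in> parcs G" for x y
    using bspec[OF ap that] by (simp del: fun_upd_apply add: apart_start)
  ultimately have \<gamma>: "?\<gamma> \<in> colorings G l"
    by (simp add: colorings_def case_prod_unfold del: fun_upd_apply)
  have "set ms \<subseteq> pverts G \<times> {1..l}" using Cons.prems(2) by simp
  from Cons.IH[OF \<gamma> this ap] obtain p where
    p: "R.awalk ?\<gamma> p (recolor ms ?\<gamma>)" "\<forall>v. recolorings p v \<le> num_moves ms v" by (elim exE conjE)
  show ?case
  proof (cases "snd m = \<alpha> (fst m)")
    case True
    \<comment> \<open>Lists of moves may give a vertex the color it already has. Such a move is not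
      an edge of the reconfiguration graph and is skipped, so the counts are related by an
      inequality only.\<close>
    then have \<gamma>\<alpha>: "?\<gamma> = \<alpha>" by (simp add: fun_upd_idem)
    have "recolor (m # ms) \<alpha> = recolor ms \<alpha>" by (simp only: recolor_simps \<gamma>\<alpha>)
    moreover have "num_moves ms v \<le> num_moves (m # ms) v" for v by simp
    ultimately show ?thesis using p unfolding \<gamma>\<alpha> by (intro exI[of _ p]) (metis order.trans)
  next
    case False
    have "\<exists>!v. v \<in> pverts G \<and> \<alpha> v \<noteq> ?\<gamma> v"
      using m(1) False by (intro ex1I[of _ "fst m"]) (auto split: if_splits)
    then have "(\<alpha>, ?\<gamma>) \<in> parcs (reconf_graph G l)"
      using Cons.prems(1) \<gamma> unfolding reconf_graph_def by simp
    then have "R.awalk \<alpha> ((\<alpha>, ?\<gamma>) # p) (recolor ms ?\<gamma>)"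
      using p(1) by (simp add: R.awalk_Cons_iff)
    moreover have "recolorings ((\<alpha>, ?\<gamma>) # p) v \<le> num_moves (m # ms) v" for v
      using spec[OF p(2), of v] by (simp add: recolorings_def)
    ultimately show ?thesis by (intro exI[of _ "(\<alpha>, ?\<gamma>) # p"]) simp
  qed
qed

lemma moves_imp_transformation:
  assumes G: "pair_graph G" and c: "\<alpha> \<in> colorings G l" "\<beta> \<in> colorings G l"
    and ms: "set ms \<subseteq> pverts G \<times> {1..l}" "\<forall>(x, y)\<in>parcs G. apart x y \<alpha> ms"
      "\<forall>x\<in>pverts G. recolor ms \<alpha> x = \<beta> x \<and> num_moves ms x \<le> b"
  shows "\<exists>p. transformation G l \<alpha> p \<beta> \<and> (\<forall>v\<in>pverts G. recolorings p v \<le> b)"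
proof -
  have "recolor ms \<alpha> = \<beta>"
  proof
    fix x
    show "recolor ms \<alpha> x = \<beta> x"
    proof (cases "x \<in> pverts G")
      case False
      then have "x \<notin> fst ` set ms" using ms(1) by auto
      then have "recolor ms \<alpha> x = \<alpha> x" by (rule recolor_notin)
      also have "\<dots> = \<beta> x" using False c by (auto simp: colorings_def PiE_iff extensional_def)
      finally show ?thesis .
    qed (use ms(3) in blast)
  qed
  with moves_imp_awalk[OF G c(1) ms(1,2)] obtain q where
    "pre_digraph.awalk (with_proj (reconf_graph G l)) \<alpha> q \<beta>" and q: "\<And>v. recolorings q v \<le> num_moves ms v"
    by auto
  from awalk_imp_transformation[OF G this(1)] obtain p where
    p: "transformation G l \<alpha> p \<beta>" "\<And>v. recolorings p v \<le> recolorings q v"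
    by auto
  have "recolorings p v \<le> b" if "v \<in> pverts G" for v
    using p(2)[of v] q[of v] bspec[OF ms(3) that] by linarith
  with p(1) show ?thesis by auto
qed

lemma colorings_proper: "c \<in> colorings G l \<Longrightarrow> proper (pverts G) (parcs G) {1..l} c"
  by (auto simp: colorings_def proper_def)

theorem theorem1p2:
  fixes G :: "'a pair_pre_digraph" and l :: nat and \<alpha> \<beta> :: "'a \<Rightarrow> nat"
  assumes "pair_graph G"
    and "K23_minor_free G"
    and "l \<ge> 5"
    and "\<alpha> \<in> colorings G l"
    and "\<beta> \<in> colorings G l"
  shows "(l \<ge> 6 \<longrightarrow>
            (\<exists>p. transformation G l \<alpha> p \<beta> \<and> (\<forall>v\<in>pverts G. recolorings p v \<le> 3))) \<and>
         (l = 5 \<longrightarrow>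
            (\<exists>p. transformation G l \<alpha> p \<beta> \<and> (\<forall>v\<in>pverts G. recolorings p v \<le> 1387)))"
proof (intro conjI impI)
  note G = fgraph_pair_graph[OF assms(1)]
  note pc = colorings_proper[OF assms(4)] and pd = colorings_proper[OF assms(5)]
  have noK: "\<not> has_K23 (parcs G)" using not_K23_minor_free[OF G] assms(2) by blast
  show "\<exists>p. transformation G l \<alpha> p \<beta> \<and> (\<forall>v\<in>pverts G. recolorings p v \<le> 3)" if "l \<ge> 6"
  proof -
    have "finite {1..l}" "6 \<le> card {1..l}" using that by simp_all
    from recolor_six_colors[OF this G noK pc pd] obtain ms where
      ms: "set ms \<subseteq> pverts G \<times> {1..l}" "\<forall>(x, y)\<in>parcs G. apart x y \<alpha> ms"
        "\<forall>x\<in>pverts G. recolor ms \<alpha> x = \<beta> x \<and> num_moves ms x \<le> 3"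
      by (elim exE conjE) (rule that; assumption)
    show ?thesis by (rule moves_imp_transformation[OF assms(1,4,5) ms])
  qed
  show "\<exists>p. transformation G l \<alpha> p \<beta> \<and> (\<forall>v\<in>pverts G. recolorings p v \<le> 1387)" if l: "l = 5"
  proof -
    from recolor_five_colors[OF G noK pc[unfolded l] pd[unfolded l]] obtain ms where
      "set ms \<subseteq> pverts G \<times> {1..5}" and ms: "\<forall>(x, y)\<in>parcs G. apart x y \<alpha> ms"
        "\<forall>x\<in>pverts G. recolor ms \<alpha> x = \<beta> x \<and> num_moves ms x \<le> 7"
      by (elim exE conjE) (rule that; assumption)
    then have "set ms \<subseteq> pverts G \<times> {1..l}" using l by simp
    from moves_imp_transformation[OF assms(1,4,5) this ms] obtain p where
      p: "transformation G l \<alpha> p \<beta>" "\<forall>v\<in>pverts G. recolorings p v \<le> 7"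
      by auto
    \<comment> \<open>Seven is well below the required bound.\<close>
    have "recolorings p v \<le> 1387" if "v \<in> pverts G" for v
      using bspec[OF p(2) that] by linarith
    with p(1) show ?thesis by auto
  qed
qed

end
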